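(* Let $\mathcal{B}(\Omega)$ be a strong Bergman-type space and let $T\in\mathcal{T}_{\mathrm{BUC}}$. Then $\lim_{d(z,0)\to\infty}\tilde T(z)=0$ if and only if $\lim_{d(z,0)\to\infty}\|T^zf\|=0$ for every $f\in\mathcal{B}(\Omega)$. In particular, if in addition the Rudin–Forelli constant satisfies $\kappa>0$ and $\tilde T(z)\to0$ as $d(z,0)\to\infty$, then $T$ is compact.
   Context: Notation: $A\lesssim B$ means $A\le CB$ for a constant $C$ independent of the relevant variables; $A\simeq B$ means $A\lesssim B$ and $B\lesssim A$. Bergman-type space: $\Omega\subset\mathbb{C}^n$ is a domain containing $0$ such that: (A.1) for each $z\in\Omega$ there is an involutive biholomorphic automorphism $\varphi_z$ of $\Omega$ with $\varphi_z(0)=z$; (A.2) there is a metric $d$ on $\Omega$ with $d(u,v)\simeq d(\varphi_z(u),\varphi_z(v))$ uniformly in $u,v,z$; $(\Omega,d)$ is separable and every closed $d$-ball is compact; $D(z,r)$ denotes the $d$-ball of center $z$ and radius $r$; (A.3) $\sigma$ is a finite Borel measure on $\Omega$, $\mathcal{B}(\Omega)$ is the space of holomorphic functions on $\Omega$ lying in $L^2(\Omega;d\sigma)$ with the $L^2(\sigma)$ norm $\|\cdot\|$ and inner product $\langle\cdot,\cdot\rangle$; $\mathcal{B}(\Omega)$ is a reproducing kernel Hilbert space with reproducing kernel $K_z$ ($f(z)=\langle f,K_z\rangle$) and normalized kernel $k_z=K_z/\|K_z\|$; $z\mapsto\|K_z\|$ is continuous on $(\Omega,d)$; (A.4) the measure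 $d\lambda(z):=\|K_z\|^2d\sigma(z)$ satisfies $\lambda(E)\simeq\lambda(\varphi_z(E))$ for Borel $E$, uniformly in $z$, and is doubling: $\lambda(D(z,2r))\le C\lambda(D(z,r))$ for all $z,r>0$; (A.5) $|\langle k_z,k_w\rangle|\simeq 1/\|K_{\varphi_z(w)}\|$ uniformly in $z,w$; (A.6) (Rudin–Forelli estimates) there is a constant $\kappa\in[0,2)$ such that, if $\kappa>0$, for all $r>\kappa>s>0$ one has $\sup_{z\in\Omega}\int_\Omega \frac{|\langle K_z,K_w\rangle|^{(r+s)/2}}{\|K_z\|^s\|K_w\|^r}d\lambda(w)<\infty$, and if $\kappa=0$ this holds for all $r=s>0$; (A.7) $\|K_z\|\to\infty$ as $d(z,0)\to\infty$. A strong Bergman-type space is one in which $\simeq$ can be replaced by $=$ in (A.2), (A.4), (A.5), i.e. $d(u,v)=d(\varphi_z(u),\varphi_z(v))$, $\lambda(E)=\lambda(\varphi_z(E))$, $|\langle k_z,k_w\rangle|=1/\|K_{\varphi_z(w)}\|$. $P$ is the orthogonal projection of $L^2(\Omega;d\sigma)$ onto $\mathcal{B}(\Omega)$; $T_u:=PM_u$ with $M_uf=uf$. $\mathrm{BUC}(\Omega,d)$ is the algebra of bounded, uniformly continuous (w.r.t. $d$) complex functions on $\Omega$, and $\mathcal{T}_{\mathrm{BUC}}$ is the operator-norm closure in $\mathcal{L}(\mathcal{B}(\Omega))$ of finite sums of finite products of Toeplitz operators $T_u$ with $u\in\mathrm{BUC}(\Omega,d)$. $U_zf(w):=f(\varphi_z(w))k_z(w)$,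 $T^z:=U_zTU_z^*$. The Berezin transform of $T$ is $\tilde T(z):=\langle Tk_z,k_z\rangle$. *)

theory Defs
  imports "HOL-Analysis.Analysis"
begin

text \<open>Points of \<open>\<complex>^n\<close> are modelled by the type \<open>complex ^ 'n\<close>; functions on the domain
  are functions \<open>complex ^ 'n \<Rightarrow> complex\<close> which we require to vanish outside the domain.\<close>

type_synonym 'n pt = "complex ^ 'n"
type_synonym 'n fn = "'n pt \<Rightarrow> complex"
type_synonym 'n op = "'n fn \<Rightarrow> 'n fn"

definition is_domain :: "('n::finite) pt set \<Rightarrow> bool" where
  "is_domain \<Omega> \<longleftrightarrow> open \<Omega> \<and> connected \<Omega> \<and> 0 \<in> \<Omega>"

definition holo_on :: "('n::finite) pt set \<Rightarrow> ('n::finite) fn \<Rightarrow> bool" where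
  "holo_on \<Omega> f \<longleftrightarrow> open \<Omega> \<and> (\<forall>z\<in>\<Omega>. \<exists>L. (f has_derivative L) (at z) \<and>
        (\<forall>c v. L (c *s v) = c * L v))"

definition holo_map_on :: "('n::finite) pt set \<Rightarrow> (('n::finite) pt \<Rightarrow> ('n::finite) pt) \<Rightarrow> bool" where
  "holo_map_on \<Omega> F \<longleftrightarrow> (\<forall>i. holo_on \<Omega> (\<lambda>w. F w $ i))"

text \<open>Involutive biholomorphic automorphism of \<open>\<Omega>\<close> (its own inverse, hence biholomorphic).\<close>
definition inv_biholo_aut :: "('n::finite) pt set \<Rightarrow> (('n::finite) pt \<Rightarrow> ('n::finite) pt) \<Rightarrow> bool" where
  "inv_biholo_aut \<Omega> F \<longleftrightarrow> F ` \<Omega> \<subseteq> \<Omega> \<and> (\<forall>w\<in>\<Omega>. F (F w) = w) \<and> holo_map_on \<Omega> F"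

definition ip :: "('n::finite) pt measure \<Rightarrow> ('n::finite) fn \<Rightarrow> ('n::finite) fn \<Rightarrow> complex" where
  "ip \<sigma> f g = (\<integral>w. f w * cnj (g w) \<partial>\<sigma>)"

definition nrm :: "('n::finite) pt measure \<Rightarrow> ('n::finite) fn \<Rightarrow> real" where
  "nrm \<sigma> f = sqrt (\<integral>w. (cmod (f w))\<^sup>2 \<partial>\<sigma>)"

definition L2 :: "('n::finite) pt set \<Rightarrow> ('n::finite) pt measure \<Rightarrow> ('n::finite) fn set" where
  "L2 \<Omega> \<sigma> = {f. f \<in> borel_measurable \<sigma> \<and> integrable \<sigma> (\<lambda>w. (cmod (f w))\<^sup>2) \<and> (\<forall>w. w \<notin> \<Omega> \<longrightarrow> f w = 0)}"

definition Bsp :: "('n::finite) pt set \<Rightarrow> ('n::finite) pt measure \<Rightarrow> ('n::finite) fn set" where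
  "Bsp \<Omega> \<sigma> = {f \<in> L2 \<Omega> \<sigma>. holo_on \<Omega> f}"

definition nkern :: "('n::finite) pt measure \<Rightarrow> (('n::finite) pt \<Rightarrow> ('n::finite) fn) \<Rightarrow> ('n::finite) pt \<Rightarrow> ('n::finite) fn" where
  "nkern \<sigma> K z = (\<lambda>w. K z w / complex_of_real (nrm \<sigma> (K z)))"

definition lam :: "('n::finite) pt measure \<Rightarrow> (('n::finite) pt \<Rightarrow> ('n::finite) fn) \<Rightarrow> ('n::finite) pt measure" where
  "lam \<sigma> K = density \<sigma> (\<lambda>z. ennreal ((nrm \<sigma> (K z))\<^sup>2))"

text \<open>Strong Bergman-type space, conditions (A.1)--(A.7) with equalities in (A.2),(A.4),(A.5).\<close>
definition strong_bergman_type ::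
  "('n::finite) pt set \<Rightarrow> (('n::finite) pt \<Rightarrow> ('n::finite) pt \<Rightarrow> ('n::finite) pt) \<Rightarrow> (('n::finite) pt \<Rightarrow> ('n::finite) pt \<Rightarrow> real) \<Rightarrow>
   ('n::finite) pt measure \<Rightarrow> (('n::finite) pt \<Rightarrow> ('n::finite) fn) \<Rightarrow> real \<Rightarrow> bool" where
  "strong_bergman_type \<Omega> \<phi> d \<sigma> K \<kappa> \<longleftrightarrow>
     is_domain \<Omega> \<and>
     \<comment> \<open>(A.1)\<close>
     (\<forall>z\<in>\<Omega>. inv_biholo_aut \<Omega> (\<phi> z) \<and> \<phi> z 0 = z) \<and>
     \<comment> \<open>(A.2)\<close>
     Metric_space \<Omega> d \<and>
     (\<forall>z\<in>\<Omega>. \<forall>u\<in>\<Omega>. \<forall>v\<in>\<Omega>. d (\<phi> z u) (\<phi> z v) = d u v) \<and>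
     separable_space (Metric_space.mtopology \<Omega> d) \<and>
     (\<forall>z\<in>\<Omega>. \<forall>r. compactin (Metric_space.mtopology \<Omega> d) (Metric_space.mcball \<Omega> d z r)) \<and>
     \<comment> \<open>(A.3)\<close>
     finite_measure \<sigma> \<and> sets \<sigma> = sets borel \<and> emeasure \<sigma> (- \<Omega>) = 0 \<and>
     (\<forall>z\<in>\<Omega>. K z \<in> Bsp \<Omega> \<sigma>) \<and>
     (\<forall>f\<in>Bsp \<Omega> \<sigma>. \<forall>z\<in>\<Omega>. f z = ip \<sigma> f (K z)) \<and>
     continuous_map (Metric_space.mtopology \<Omega> d) euclideanreal (\<lambda>z. nrm \<sigma> (K z)) \<and>
     \<comment> \<open>(A.4)\<close>
     (\<forall>z\<in>\<Omega>. \<forall>E\<in>sets borel. E \<subseteq> \<Omega> \<longrightarrow> emeasure (lam \<sigma> K) (\<phi> z ` E) = emeasure (lam \<sigma> K) E) \<and>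
     (\<forall>z\<in>\<Omega>. \<forall>r. Metric_space.mball \<Omega> d z r \<in> sets borel) \<and>
     (\<exists>C. \<forall>z\<in>\<Omega>. \<forall>r>0. emeasure (lam \<sigma> K) (Metric_space.mball \<Omega> d z (2 * r))
                         \<le> ennreal C * emeasure (lam \<sigma> K) (Metric_space.mball \<Omega> d z r)) \<and>
     \<comment> \<open>(A.5)\<close>
     (\<forall>z\<in>\<Omega>. \<forall>w\<in>\<Omega>. cmod (ip \<sigma> (nkern \<sigma> K z) (nkern \<sigma> K w)) = 1 / nrm \<sigma> (K (\<phi> z w))) \<and>
     \<comment> \<open>(A.6)\<close>
     0 \<le> \<kappa> \<and> \<kappa> < 2 \<and>
     (let RF = (\<lambda>r s. \<exists>M::real. \<forall>z\<in>\<Omega>.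
              (\<integral>\<^sup>+ w. ennreal (cmod (ip \<sigma> (K z) (K w)) powr ((r + s) / 2)
                     / (nrm \<sigma> (K z) powr s * nrm \<sigma> (K w) powr r)) \<partial>lam \<sigma> K) \<le> ennreal M)
      in (\<kappa> > 0 \<longrightarrow> (\<forall>r s. r > \<kappa> \<and> \<kappa> > s \<and> s > 0 \<longrightarrow> RF r s)) \<and>
         (\<kappa> = 0 \<longrightarrow> (\<forall>r>0. RF r r))) \<and>
     \<comment> \<open>(A.7)\<close>
     (\<forall>M. \<exists>R. \<forall>z\<in>\<Omega>. d z 0 > R \<longrightarrow> nrm \<sigma> (K z) > M)"

definition proj :: "('n::finite) pt set \<Rightarrow> ('n::finite) pt measure \<Rightarrow> ('n::finite) op" where
  "proj \<Omega> \<sigma> g = (THE h. h \<in> Bsp \<Omega> \<sigma> \<and> (\<forall>f\<in>Bsp \<Omega> \<sigma>. ip \<sigma> (\<lambda>w. g w - h w) f = 0))"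

definition toeplitz :: "('n::finite) pt set \<Rightarrow> ('n::finite) pt measure \<Rightarrow> ('n::finite) fn \<Rightarrow> ('n::finite) op" where
  "toeplitz \<Omega> \<sigma> u f = proj \<Omega> \<sigma> (\<lambda>w. u w * f w)"

text \<open>\<open>BUC(\<Omega>,d)\<close> (we also require Borel measurability so that \<open>M_u\<close> acts on \<open>L\<^sup>2(\<sigma>)\<close>).\<close>
definition BUC :: "('n::finite) pt set \<Rightarrow> (('n::finite) pt \<Rightarrow> ('n::finite) pt \<Rightarrow> real) \<Rightarrow> ('n::finite) fn set" where
  "BUC \<Omega> d = {u. u \<in> borel_measurable borel \<and> (\<exists>B. \<forall>z\<in>\<Omega>. cmod (u z) \<le> B) \<and>
      (\<forall>e>0. \<exists>\<delta>>0. \<forall>x\<in>\<Omega>. \<forall>y\<in>\<Omega>. d x y < \<delta> \<longrightarrow> cmod (u x - u y) < e)}"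

inductive_set toep_alg :: "('n::finite) pt set \<Rightarrow> ('n::finite) pt measure \<Rightarrow> (('n::finite) pt \<Rightarrow> ('n::finite) pt \<Rightarrow> real) \<Rightarrow> ('n::finite) op set"
  for \<Omega> \<sigma> d where
  base: "u \<in> BUC \<Omega> d \<Longrightarrow> toeplitz \<Omega> \<sigma> u \<in> toep_alg \<Omega> \<sigma> d"
| add: "S \<in> toep_alg \<Omega> \<sigma> d \<Longrightarrow> T \<in> toep_alg \<Omega> \<sigma> d \<Longrightarrow> (\<lambda>f w. S f w + T f w) \<in> toep_alg \<Omega> \<sigma> d"
| mult: "S \<in> toep_alg \<Omega> \<sigma> d \<Longrightarrow> T \<in> toep_alg \<Omega> \<sigma> d \<Longrightarrow> (\<lambda>f. S (T f)) \<in> toep_alg \<Omega> \<sigma> d"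

definition T_BUC :: "('n::finite) pt set \<Rightarrow> ('n::finite) pt measure \<Rightarrow> (('n::finite) pt \<Rightarrow> ('n::finite) pt \<Rightarrow> real) \<Rightarrow> ('n::finite) op set" where
  "T_BUC \<Omega> \<sigma> d = {T. (\<forall>f\<in>Bsp \<Omega> \<sigma>. T f \<in> Bsp \<Omega> \<sigma>) \<and>
      (\<forall>e>0. \<exists>S\<in>toep_alg \<Omega> \<sigma> d. \<forall>f\<in>Bsp \<Omega> \<sigma>. nrm \<sigma> (\<lambda>w. T f w - S f w) \<le> e * nrm \<sigma> f)}"

definition adj :: "('n::finite) pt set \<Rightarrow> ('n::finite) pt measure \<Rightarrow> ('n::finite) op \<Rightarrow> ('n::finite) op" where
  "adj \<Omega> \<sigma> A g = (THE h. h \<in> Bsp \<Omega> \<sigma> \<and> (\<forall>f\<in>Bsp \<Omega> \<sigma>. ip \<sigma> (A f) g = ip \<sigma> f h))"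

definition Uop :: "('n::finite) pt set \<Rightarrow> (('n::finite) pt \<Rightarrow> ('n::finite) pt \<Rightarrow> ('n::finite) pt) \<Rightarrow> ('n::finite) pt measure \<Rightarrow> (('n::finite) pt \<Rightarrow> ('n::finite) fn) \<Rightarrow> ('n::finite) pt \<Rightarrow> ('n::finite) op" where
  "Uop \<Omega> \<phi> \<sigma> K z f = (\<lambda>w. if w \<in> \<Omega> then f (\<phi> z w) * nkern \<sigma> K z w else 0)"

definition transl :: "('n::finite) pt set \<Rightarrow> (('n::finite) pt \<Rightarrow> ('n::finite) pt \<Rightarrow> ('n::finite) pt) \<Rightarrow> ('n::finite) pt measure \<Rightarrow> (('n::finite) pt \<Rightarrow> ('n::finite) fn) \<Rightarrow> ('n::finite) op \<Rightarrow> ('n::finite) pt \<Rightarrow> ('n::finite) op" where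
  "transl \<Omega> \<phi> \<sigma> K T z f = Uop \<Omega> \<phi> \<sigma> K z (T (adj \<Omega> \<sigma> (Uop \<Omega> \<phi> \<sigma> K z) f))"

definition berezin :: "('n::finite) pt measure \<Rightarrow> (('n::finite) pt \<Rightarrow> ('n::finite) fn) \<Rightarrow> ('n::finite) op \<Rightarrow> ('n::finite) pt \<Rightarrow> complex" where
  "berezin \<sigma> K T z = ip \<sigma> (T (nkern \<sigma> K z)) (nkern \<sigma> K z)"

definition vanishes_at_inf :: "('n::finite) pt set \<Rightarrow> (('n::finite) pt \<Rightarrow> ('n::finite) pt \<Rightarrow> real) \<Rightarrow> (('n::finite) pt \<Rightarrow> real) \<Rightarrow> bool" where
  "vanishes_at_inf \<Omega> d F \<longleftrightarrow> (\<forall>e>0. \<exists>R. \<forall>z\<in>\<Omega>. d z 0 > R \<longrightarrow> \<bar>F z\<bar> < e)"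

definition compact_op :: "('n::finite) pt set \<Rightarrow> ('n::finite) pt measure \<Rightarrow> ('n::finite) op \<Rightarrow> bool" where
  "compact_op \<Omega> \<sigma> T \<longleftrightarrow> (\<forall>f :: nat \<Rightarrow> ('n::finite) fn. (\<forall>n. f n \<in> Bsp \<Omega> \<sigma>) \<and> (\<exists>B. \<forall>n. nrm \<sigma> (f n) \<le> B) \<longrightarrow>
      (\<exists>r g. strict_mono r \<and> g \<in> Bsp \<Omega> \<sigma> \<and>
         (\<lambda>n. nrm \<sigma> (\<lambda>w. T (f (r n)) w - g w)) \<longlonglongrightarrow> 0))"

end

theory Submission
  imports Defs "HOL-Complex_Analysis.Complex_Analysis"
begin

text \<open>
  Write \<open>N z = \<parallel>K\<^sub>z\<parallel>\<close>. The equalities in (A.5) give \<open>|K\<^sub>z(w)| = N z N w / N(\<phi>\<^sub>z w)\<close> and \<open>K\<^sub>0 = 1\<close>, and make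
  \<open>U\<^sub>z\<close> a self-adjoint unitary commuting with the projection \<open>P\<close>. Baire's theorem bounds \<open>N\<close> on some
  ball, the automorphisms transport the bound everywhere, and so \<open>B(\<Omega>)\<close> is complete.

  Since \<open>T\<^sub>u\<close> is translated to the Toeplitz operator with symbol \<open>u \<circ> \<phi>\<^sub>z\<close>, and these symbols are
  equicontinuous, every sequence of translates of \<open>T \<in> T_BUC\<close> has a strongly convergent subsequence.
  If \<open>z\<^sub>n\<close> tends to infinity the limit has Berezin transform \<open>lim T~(\<phi>\<^bsub>z\<^sub>n\<^esub> w) = 0\<close>, so it is zero because
  a function of \<open>(w, \<zeta>)\<close> that is holomorphic in \<open>w\<close>, antiholomorphic in \<open>\<zeta>\<close> and zero on the diagonal is zero.

  For compactness take \<open>h\<^sub>y(z) = c max 0 (1 - d(y,z)/\<rho>)\<close>, normalised by \<open>\<integral> h\<^sub>y(z)\<^sup>2 d\<lambda>(y) = 1\<close>, which is possible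
  with \<open>c\<close> independent of \<open>z\<close> by invariance of \<open>\<lambda>\<close>. Doubling makes the family vary slowly for large \<open>\<rho>\<close>, so
  the Schur test with the Rudin--Forelli estimates bounds \<open>\<integral> \<parallel>[P, h\<^sub>y] f\<parallel>\<^sup>2 d\<lambda>(y)\<close> by \<open>\<epsilon> \<parallel>f\<parallel>\<^sup>2\<close>. Commutator bounds
  of this kind pass to products, sums and norm limits, hence to \<open>T P\<close>, and therefore
  \<open>\<parallel>T g\<parallel>\<^sup>2\<close> is at most a constant times \<open>\<integral> \<parallel>T P (h\<^sub>y g)\<parallel>\<^sup>2 d\<lambda>(y) + \<epsilon> \<parallel>g\<parallel>\<^sup>2\<close>. Far out \<open>T P h\<^sub>y\<close> is uniformly small, being
  unitarily equivalent to a translate of \<open>T\<close> (strongly null) times a fixed compact operator; the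
  remaining part only sees \<open>g\<close> on a bounded set, where bounded sequences are precompact.
\<close>

subsection \<open>Holomorphic functions of several variables\<close>

text \<open>The hypotheses link the metric \<open>d\<close> to the Euclidean topology only weakly:
  \<open>d\<close>-balls are Borel sets. Holomorphy and Cauchy estimates live in the Euclidean
  topology. So the \<open>d\<close>-continuity of \<open>N\<close> gives no Euclidean local bound,
  which is why Baire's theorem is called, and measurability involving \<open>d\<close> comes from
  countable dense sets and \<open>d\<close>-balls instead of continuity. Conversely, compactness of
  closed \<open>d\<close>-balls bounds \<open>N\<close> on them, so that truncations to
  \<open>d\<close>-balls obey dominated convergence.

  The Schur test needs room in the exponents. For \<kappa> > 0 one can spare a small power of
  \<open>1 / N (\<phi> z w)\<close>, which by (A.7) tends to zero as \<open>z\<close> and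
  \<open>w\<close> move apart; this concentrates the kernel near the diagonal, where the multipliers
  hardly vary.

  Averaging over a continuous family of multipliers instead of a discrete covering keeps the
  normalisation exact: \<open>f\<close> is recovered in norm from its pieces, and every estimate
  reduces to balls around 0.

  The convention \<open>1 / 0 = 0\<close> makes (A.5) compatible with the zero space, so that case
  is split off in the theorem.\<close>

lemma norm_smult_complex: "norm (c *s (v :: complex ^ 'n)) = cmod c * norm v"
  by (simp add: norm_vec_def L2_set_right_distrib norm_mult)

lemma bounded_linear_smult_complex: "bounded_linear (\<lambda>c. c *s (v :: complex ^ 'n))"
  by (rule bounded_linear_intro[where K = "norm v"])
     (auto simp: vec_eq_iff algebra_simps norm_smult_complex)

lemma holo_onE:
  assumes "holo_on \<Omega> f" "z \<in> \<Omega>"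
  obtains L where "(f has_derivative L) (at z)" "\<And>c v. L (c *s v) = c * L v"
  using assms unfolding holo_on_def by blast

lemma holo_on_line:
  fixes f :: "('n::finite) fn"
  assumes "holo_on \<Omega> f" and "\<And>s. s \<in> A \<Longrightarrow> a + s *s v \<in> \<Omega>"
  shows "(\<lambda>s. f (a + s *s v)) holomorphic_on A"
  unfolding holomorphic_on_def
proof
  fix s assume "s \<in> A"
  then obtain L where L: "(f has_derivative L) (at (a + s *s v))" "\<And>c v. L (c *s v) = c * L v"
    using assms by (force simp: holo_on_def)
  have "((\<lambda>s. a + s *s v) has_derivative (\<lambda>h. h *s v)) (at s)"
    by (auto intro!: derivative_eq_intros bounded_linear_imp_has_derivative bounded_linear_smult_complex)
  from diff_chain_at[OF this L(1)]
  have "((\<lambda>s. f (a + s *s v)) has_derivative (\<lambda>h. h * L v)) (at s)"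
    by (simp add: o_def L(2))
  then have "((\<lambda>s. f (a + s *s v)) has_field_derivative L v) (at s)"
    by (simp add: has_field_derivative_def mult_commute_abs)
  then show "(\<lambda>s. f (a + s *s v)) field_differentiable at s within A"
    by (meson field_differentiable_at_within field_differentiable_def)
qed

lemma deriv_line:
  fixes f :: "('n::finite) fn"
  assumes "(f has_derivative L) (at a)" "\<And>c v. L (c *s v) = c * L v"
  shows "deriv (\<lambda>s. f (a + s *s v)) 0 = L v"
proof (rule DERIV_imp_deriv)
  have "((\<lambda>s. a + s *s v) has_derivative (\<lambda>h. h *s v)) (at 0)"
    by (auto intro!: derivative_eq_intros bounded_linear_imp_has_derivative bounded_linear_smult_complex)
  moreover have "(f has_derivative L) (at (a + 0 *s v))"
    using assms(1) by simp
  ultimately have "((\<lambda>s. f (a + s *s v)) has_derivative (\<lambda>h. h * L v)) (at 0)"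
    using diff_chain_at[of "\<lambda>s. a + s *s v" "\<lambda>h. h *s v" 0 f L] by (simp add: o_def assms(2))
  then show "((\<lambda>s. f (a + s *s v)) has_field_derivative L v) (at 0)"
    by (simp add: has_field_derivative_def mult_commute_abs)
qed

text \<open>This is the one-variable Cauchy inequality on the disc of directions \<open>s\<close> in
  \<open>a + s *s v\<close>. The disc has radius \<open>R / (2 * norm v)\<close>, half of what fits,
  so that its closure still maps into the ball; this is the factor 2 in the bound.\<close>

lemma holo_on_derivative_bound:
  fixes f :: "('n::finite) fn"
  assumes "holo_on \<Omega> f" "ball a R \<subseteq> \<Omega>" "0 < R"
    and M: "\<And>x. x \<in> ball a R \<Longrightarrow> cmod (f x) \<le> M"
    and L: "(f has_derivative L) (at a)" "\<And>c v. L (c *s v) = c * L v"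
  shows "cmod (L v) \<le> 2 * M / R * norm v"
proof (cases "v = 0")
  case True
  have "L (0 *s 0) = 0 * L 0" by (rule L(2))
  then show ?thesis using True by simp
next
  case False
  define \<rho> where "\<rho> = R / (2 * norm v)"
  have \<rho>: "\<rho> > 0" using False \<open>0 < R\<close> by (simp add: \<rho>_def)
  have in_ball: "a + s *s v \<in> ball a R" if "cmod s \<le> \<rho>" for s
  proof -
    have "cmod s * norm v \<le> \<rho> * norm v"
      using that by (simp add: mult_right_mono)
    also have "\<dots> < R" using False \<open>0 < R\<close> by (simp add: \<rho>_def)
    finally show ?thesis by (simp add: dist_norm norm_smult_complex)
  qed
  have hol: "(\<lambda>s. f (a + s *s v)) holomorphic_on cball 0 \<rho>"
    by (rule holo_on_line[OF assms(1)]) (use in_ball assms(2) in auto)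
  have "norm ((deriv ^^ 1) (\<lambda>s. f (a + s *s v)) 0) \<le> fact 1 * M / \<rho> ^ 1"
  proof (rule Cauchy_inequality)
    show "(\<lambda>s. f (a + s *s v)) holomorphic_on ball 0 \<rho>"
      using hol by (rule holomorphic_on_subset) auto
    show "continuous_on (cball 0 \<rho>) (\<lambda>s. f (a + s *s v))"
      using hol by (rule holomorphic_on_imp_continuous_on)
    show "cmod (f (a + x *s v)) \<le> M" if "cmod (0 - x) = \<rho>" for x
      using in_ball[of x] that by (intro M) auto
  qed (rule \<rho>)
  then show ?thesis
    using deriv_line[OF L] by (simp add: \<rho>_def field_simps)
qed

text \<open>Every point of the smaller ball has a ball of radius \<open>R\<close> around it on which
  \<open>M\<close> bounds \<open>f\<close>, so the derivative is bounded there and the mean value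
  inequality applies. Later equicontinuity in the Euclidean topology comes from this
  estimate.\<close>

lemma holo_on_lipschitz:
  fixes f :: "('n::finite) fn"
  assumes f: "holo_on \<Omega> f" and sub: "ball a (2 * R) \<subseteq> \<Omega>" and "0 < R"
    and M: "\<And>x. x \<in> ball a (2 * R) \<Longrightarrow> cmod (f x) \<le> M"
    and xy: "x \<in> ball a R" "y \<in> ball a R"
  shows "cmod (f x - f y) \<le> 2 * M / R * norm (x - y)"
proof -
  have inner: "ball z R \<subseteq> ball a (2 * R)" if "z \<in> ball a R" for z
    using that by (subst ball_subset_ball_iff) (auto simp: dist_commute)
  have "a \<in> ball a (2 * R)" using \<open>0 < R\<close> by simp
  then have M0: "0 \<le> M" using M norm_ge_zero order_trans by blast
  have "\<exists>L. (f has_derivative L) (at z) \<and> onorm L \<le> 2 * M / R" if z: "z \<in> ball a R" for z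
  proof -
    have "z \<in> \<Omega>" using inner[OF z] sub \<open>0 < R\<close> by force
    then obtain L where L: "(f has_derivative L) (at z)" "\<And>c v. L (c *s v) = c * L v"
      using f by (auto simp: holo_on_def)
    have "cmod (L v) \<le> 2 * M / R * norm v" for v
      by (rule holo_on_derivative_bound[OF f _ \<open>0 < R\<close> _ L]) (use inner[OF z] sub M in auto)
    then have "onorm L \<le> 2 * M / R"
      using M0 \<open>0 < R\<close> by (intro onorm_bound) auto
    with L show ?thesis by blast
  qed
  then obtain L where L: "\<And>z. z \<in> ball a R \<Longrightarrow> (f has_derivative L z) (at z) \<and> onorm (L z) \<le> 2 * M / R"
    by metis
  show ?thesis
    by (rule differentiable_bound[of "ball a R" f L]) (use L xy in \<open>auto intro: has_derivative_at_withinI\<close>)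
qed

lemma holo_on_imp_continuous_on: "holo_on \<Omega> f \<Longrightarrow> continuous_on \<Omega> f"
  unfolding holo_on_def
  by (meson continuous_at_imp_continuous_on has_derivative_continuous)

lemma holo_on_add:
  assumes "holo_on \<Omega> f" "holo_on \<Omega> g"
  shows "holo_on \<Omega> (\<lambda>w. f w + g w)"
  unfolding holo_on_def
proof (intro conjI ballI)
  fix z assume "z \<in> \<Omega>"
  obtain L where "(f has_derivative L) (at z)" "\<And>c v. L (c *s v) = c * L v"
    using holo_onE[OF assms(1) \<open>z \<in> \<Omega>\<close>] by blast
  moreover obtain L' where "(g has_derivative L') (at z)" "\<And>c v. L' (c *s v) = c * L' v"
    using holo_onE[OF assms(2) \<open>z \<in> \<Omega>\<close>] by blast
  ultimately show "\<exists>L. ((\<lambda>w. f w + g w) has_derivative L) (at z) \<and> (\<forall>c v. L (c *s v) = c * L v)"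
    by (intro exI[of _ "\<lambda>h. L h + L' h"] conjI has_derivative_add) (auto simp: algebra_simps)
qed (use assms in \<open>auto simp: holo_on_def\<close>)

lemma holo_on_mult:
  assumes "holo_on \<Omega> f" "holo_on \<Omega> g"
  shows "holo_on \<Omega> (\<lambda>w. f w * g w)"
  unfolding holo_on_def
proof (intro conjI ballI)
  fix z assume "z \<in> \<Omega>"
  obtain L where "(f has_derivative L) (at z)" "\<And>c v. L (c *s v) = c * L v"
    using holo_onE[OF assms(1) \<open>z \<in> \<Omega>\<close>] by blast
  moreover obtain L' where "(g has_derivative L') (at z)" "\<And>c v. L' (c *s v) = c * L' v"
    using holo_onE[OF assms(2) \<open>z \<in> \<Omega>\<close>] by blast
  ultimately show "\<exists>L. ((\<lambda>w. f w * g w) has_derivative L) (at z) \<and> (\<forall>c v. L (c *s v) = c * L v)"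
    by (intro exI[of _ "\<lambda>h. f z * L' h + L h * g z"] conjI has_derivative_mult) (auto simp: algebra_simps)
qed (use assms in \<open>auto simp: holo_on_def\<close>)

lemma holo_on_const: "open \<Omega> \<Longrightarrow> holo_on \<Omega> (\<lambda>w. c)"
  unfolding holo_on_def by (auto intro!: exI[of _ "\<lambda>h. 0"])

lemma holo_on_cong:
  assumes "holo_on \<Omega> f" "\<And>w. w \<in> \<Omega> \<Longrightarrow> g w = f w"
  shows "holo_on \<Omega> g"
  unfolding holo_on_def
proof (intro conjI ballI)
  show op: "open \<Omega>" using assms by (auto simp: holo_on_def)
  fix z assume z: "z \<in> \<Omega>"
  then obtain L where L: "(f has_derivative L) (at z)" "\<forall>c v. L (c *s v) = c * L v"
    using assms by (auto simp: holo_on_def)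
  have "(g has_derivative L) (at z)"
    by (rule has_derivative_transform_within_open[OF L(1) op z]) (use assms in auto)
  with L show "\<exists>L. (g has_derivative L) (at z) \<and> (\<forall>c v. L (c *s v) = c * L v)"
    by blast
qed

lemma holo_on_cmult: "holo_on \<Omega> f \<Longrightarrow> holo_on \<Omega> (\<lambda>w. c * f w)"
  by (intro holo_on_mult holo_on_const) (auto simp: holo_on_def)

lemma holo_on_diff: "holo_on \<Omega> f \<Longrightarrow> holo_on \<Omega> g \<Longrightarrow> holo_on \<Omega> (\<lambda>w. f w - g w)"
  using holo_on_add[of \<Omega> f "\<lambda>w. - 1 * g w"] holo_on_cmult[of \<Omega> g "- 1"] by simp

lemma has_derivative_vec_lambda:
  fixes F :: "'a::real_normed_vector \<Rightarrow> complex ^ 'n"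
  assumes "\<And>i. ((\<lambda>x. F x $ i) has_derivative L i) (at z)"
  shows "(F has_derivative (\<lambda>h. \<chi> i. L i h)) (at z)"
  unfolding has_derivative_componentwise_within[of F]
proof
  fix b :: "complex ^ 'n" assume "b \<in> Basis"
  then obtain i u where b: "b = axis i u" by (auto simp: Basis_vec_def)
  show "((\<lambda>x. F x \<bullet> b) has_derivative (\<lambda>x. (\<chi> i. L i x) \<bullet> b)) (at z)"
    unfolding b inner_axis by (auto intro!: derivative_intros assms)
qed

lemma holo_map_on_imp_continuous_on: "holo_map_on \<Omega> F \<Longrightarrow> continuous_on \<Omega> F"
  unfolding holo_map_on_def
  by (subst continuous_on_componentwise)
     (auto simp: Basis_vec_def inner_axis intro!: continuous_intros holo_on_imp_continuous_on)

lemma holo_on_compose: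
  assumes f: "holo_on \<Omega> f" and F: "holo_map_on \<Omega> F" "F ` \<Omega> \<subseteq> \<Omega>"
  shows "holo_on \<Omega> (\<lambda>w. f (F w))"
  unfolding holo_on_def
proof (intro conjI ballI)
  fix z assume z: "z \<in> \<Omega>"
  then obtain L where L: "(f has_derivative L) (at (F z))" "\<forall>c v. L (c *s v) = c * L v"
    using holo_onE[OF f, of "F z"] F(2) by (metis image_subset_iff)
  have "\<forall>i. \<exists>L'. ((\<lambda>w. F w $ i) has_derivative L') (at z) \<and> (\<forall>c v. L' (c *s v) = c * L' v)"
    using F(1) z by (auto simp: holo_on_def holo_map_on_def)
  then obtain L' where L': "\<And>i. ((\<lambda>w. F w $ i) has_derivative L' i) (at z)"
      "\<And>i c v. L' i (c *s v) = c * L' i v"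
    by metis
  have "((\<lambda>w. f (F w)) has_derivative (\<lambda>h. L (\<chi> i. L' i h))) (at z)"
    using diff_chain_at[OF has_derivative_vec_lambda[OF L'(1)] L(1)] by (simp add: o_def)
  moreover have "(\<chi> i. L' i (c *s v)) = c *s (\<chi> i. L' i v)" for c v
    by (simp add: vec_eq_iff L'(2))
  ultimately show "\<exists>L. ((\<lambda>w. f (F w)) has_derivative L) (at z) \<and> (\<forall>c v. L (c *s v) = c * L v)"
    using L(2) by (intro exI[of _ "\<lambda>h. L (\<chi> i. L' i h)"]) auto
qed (use f in \<open>auto simp: holo_on_def\<close>)

text \<open>Cauchy estimates turn uniform convergence of the functions into uniform convergence of
  the derivatives on half the ball, so the limit is differentiable; complex homogeneity of the
  derivative survives pointwise limits.\<close>

lemma holo_on_locally_uniform_limit: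
  fixes f :: "nat \<Rightarrow> ('n::finite) fn"
  assumes hol: "\<And>n. holo_on \<Omega> (f n)" and "open \<Omega>"
    and lim: "\<And>z. z \<in> \<Omega> \<Longrightarrow> \<exists>r>0. ball z r \<subseteq> \<Omega> \<and> uniform_limit (ball z r) f g sequentially"
  shows "holo_on \<Omega> g"
  unfolding holo_on_def
proof (intro conjI ballI)
  fix z assume "z \<in> \<Omega>"
  then obtain r where r: "r > 0" "ball z r \<subseteq> \<Omega>" "uniform_limit (ball z r) f g sequentially"
    using lim by blast
  define S where "S = ball z (r/2)"
  have Ssub: "ball x (r/2) \<subseteq> ball z r" if "x \<in> S" for x
    using that unfolding S_def
    by (subst ball_subset_ball_iff) (auto simp: dist_commute)
  have zS: "z \<in> S" using r(1) by (simp add: S_def)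
  have SO: "S \<subseteq> \<Omega>" using r by (auto simp: S_def)
  have "\<forall>n. \<forall>x\<in>S. \<exists>L. (f n has_derivative L) (at x) \<and> (\<forall>c v. L (c *s v) = c * L v)"
    using hol SO by (auto simp: holo_on_def)
  then obtain L where L: "\<And>n x. x \<in> S \<Longrightarrow> (f n has_derivative L n x) (at x)"
      "\<And>n x c v. x \<in> S \<Longrightarrow> L n x (c *s v) = c * L n x v"
    by metis
  have cau: "\<exists>N. \<forall>n\<ge>N. \<forall>m\<ge>N. \<forall>x\<in>S. \<forall>h. cmod (L n x h - L m x h) \<le> e * norm h" if "e > 0" for e
  proof -
    \<comment> \<open>The difference of two members is at most \<open>2 * e'\<close>, and the Cauchy
      bound at radius \<open>r/2\<close> multiplies this by \<open>4 / r\<close>, giving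
      \<open>e\<close> in total.\<close>
    define e' where "e' = e * r / 8"
    have "e' > 0" using that r(1) by (simp add: e'_def)
    then obtain N where N: "\<And>n x. n \<ge> N \<Longrightarrow> x \<in> ball z r \<Longrightarrow> cmod (f n x - g x) < e'"
      using r(3) unfolding uniform_limit_sequentially_iff dist_norm by blast
    have "cmod (L n x h - L m x h) \<le> e * norm h" if nm: "n \<ge> N" "m \<ge> N" and x: "x \<in> S" for n m x h
    proof -
      have "cmod ((\<lambda>h. L n x h - L m x h) h) \<le> 2 * (2 * e') / (r/2) * norm h"
      proof (rule holo_on_derivative_bound[where f = "\<lambda>w. f n w - f m w"])
        show "holo_on \<Omega> (\<lambda>w. f n w - f m w)" by (intro holo_on_diff hol)
        show "ball x (r/2) \<subseteq> \<Omega>" using Ssub[OF x] r by auto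
        show "cmod (f n u - f m u) \<le> 2 * e'" if "u \<in> ball x (r/2)" for u
          using N[OF nm(1), of u] N[OF nm(2), of u] Ssub[OF x] that
          by (smt (verit) norm_diff_triangle_less norm_minus_commute subsetD)
      qed (use r L x in \<open>auto intro!: derivative_intros simp: algebra_simps\<close>)
      then show ?thesis using r(1) by (simp add: e'_def field_simps)
    qed
    then show ?thesis by blast
  qed
  have conv: "\<exists>l. (\<lambda>n. L n x h) \<longlonglongrightarrow> l" if x: "x \<in> S" for x h
    unfolding convergent_eq_Cauchy
  proof (rule CauchyI)
    fix e :: real assume "e > 0"
    then have "e / (norm h + 1) > 0" by (simp add: add_nonneg_pos)
    from cau[OF this] obtain N where N: "\<forall>n\<ge>N. \<forall>m\<ge>N. \<forall>x\<in>S. \<forall>h'. cmod (L n x h' - L m x h') \<le> e / (norm h + 1) * norm h'"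
      by blast
    have "e / (norm h + 1) * norm h < e / (norm h + 1) * (norm h + 1)"
      using \<open>e / (norm h + 1) > 0\<close> by (intro mult_strict_left_mono) auto
    also have "\<dots> = e" using norm_ge_zero[of h] by (simp add: add_nonneg_eq_0_iff)
    finally have "e / (norm h + 1) * norm h < e" .
    with N x show "\<exists>M. \<forall>m\<ge>M. \<forall>n\<ge>M. norm (L m x h - L n x h) < e"
      by (meson order_le_less_trans)
  qed
  then obtain G where G: "\<And>x h. x \<in> S \<Longrightarrow> (\<lambda>n. L n x h) \<longlonglongrightarrow> G x h"
    by metis
  have nle: "\<forall>\<^sub>F n in sequentially. \<forall>x\<in>S. \<forall>h. norm (L n x h - G x h) \<le> e * norm h" if e: "e > 0" for e
  proof -
    obtain N where N: "\<forall>n\<ge>N. \<forall>m\<ge>N. \<forall>x\<in>S. \<forall>h. cmod (L n x h - L m x h) \<le> e * norm h"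
      using cau[OF e] by blast
    have "norm (L n x h - G x h) \<le> e * norm h" if "n \<ge> N" "x \<in> S" for n x h
    proof (rule tendsto_upperbound)
      show "(\<lambda>m. norm (L n x h - L m x h)) \<longlonglongrightarrow> norm (L n x h - G x h)"
        by (intro tendsto_intros G that)
      show "\<forall>\<^sub>F m in sequentially. cmod (L n x h - L m x h) \<le> e * norm h"
        using N that by (auto simp: eventually_sequentially intro!: exI[of _ N])
    qed auto
    then show ?thesis by (auto simp: eventually_sequentially)
  qed
  have ptw: "(\<lambda>n. f n x) \<longlonglongrightarrow> g x" if "x \<in> S" for x
    using r(3) by (rule tendsto_uniform_limitI) (use that r(1) in \<open>auto simp: S_def\<close>)
  have "\<exists>g2. \<forall>x\<in>S. (\<lambda>n. f n x) \<longlonglongrightarrow> g2 x \<and> (g2 has_derivative G x) (at x within S)"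
  proof (rule has_derivative_sequence[where f = f and f' = L and g' = G, OF _ _ nle zS ptw[OF zS]])
    show "convex S" by (simp add: S_def)
    show "(f n has_derivative L n x) (at x within S)" if "x \<in> S" for n x
      using L(1)[OF that] by (rule has_derivative_at_withinI)
  qed
  then obtain g2 where g2: "\<And>x. x \<in> S \<Longrightarrow> (\<lambda>n. f n x) \<longlonglongrightarrow> g2 x"
      "\<And>x. x \<in> S \<Longrightarrow> (g2 has_derivative G x) (at x within S)"
    by blast
  have "open S" by (simp add: S_def)
  have eq: "g2 x = g x" if "x \<in> S" for x
    using LIMSEQ_unique g2(1) ptw that by blast
  have "(g2 has_derivative G z) (at z)"
    using g2(2)[OF zS] unfolding at_within_open[OF zS \<open>open S\<close>] .
  then have "(g has_derivative G z) (at z)"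
    by (rule has_derivative_transform_within_open[OF _ \<open>open S\<close> zS]) (simp add: eq)
  moreover have "G z (c *s v) = c * G z v" for c v
  proof (rule LIMSEQ_unique[OF G[OF zS]])
    show "(\<lambda>n. L n z (c *s v)) \<longlonglongrightarrow> c * G z v"
      unfolding L(2)[OF zS] by (intro tendsto_intros G zS)
  qed
  ultimately show "\<exists>L. (g has_derivative L) (at z) \<and> (\<forall>c v. L (c *s v) = c * L v)"
    by blast
qed (rule assms)

section \<open>Identity theorem and functions of constant modulus\<close>

text \<open>Restriction to the complex line through \<open>x\<close> and \<open>y\<close> leaves the
  one-variable identity theorem, on a disc that contains the parameter 1 of
  \<open>y\<close>.\<close>

lemma holo_on_zero_ball:
  fixes f :: "('n::finite) fn"
  assumes f: "holo_on \<Omega> f" and sub: "ball x R \<subseteq> \<Omega>" and "0 < r"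
    and zero: "\<And>u. u \<in> ball x r \<Longrightarrow> f u = 0" and y: "y \<in> ball x R"
  shows "f y = 0"
proof (cases "y = x")
  case True
  then show ?thesis using zero \<open>0 < r\<close> by simp
next
  case False
  define v where "v = y - x"
  have v: "norm v > 0" using False by (simp add: v_def)
  have R: "norm v < R" using y by (simp add: v_def dist_norm norm_minus_commute)
  have ball: "x + s *s v \<in> ball x t" if "cmod s < t / norm v" for s t
    using that v by (simp add: dist_norm norm_smult_complex field_simps)
  have "(\<lambda>s. f (x + s *s v)) 1 = 0"
  proof (rule analytic_continuation_open[where f = "\<lambda>s. f (x + s *s v)" and g = "\<lambda>s. 0"
        and s = "ball 0 (min R r / norm v)" and s' = "ball 0 (R / norm v)"])
    show "(\<lambda>s. f (x + s *s v)) holomorphic_on ball 0 (R / norm v)"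
      by (rule holo_on_line[OF f]) (use ball sub in auto)
    show "ball 0 (min R r / norm v) \<noteq> ({} :: complex set)"
      using v order.strict_trans[OF v R] \<open>0 < r\<close> by (auto simp: not_le min_def zero_less_divide_iff)
    show "ball 0 (min R r / norm v) \<subseteq> (ball 0 (R / norm v) :: complex set)"
      using v by (intro subset_ball divide_right_mono) auto
    show "f (x + s *s v) = 0" if "s \<in> ball 0 (min R r / norm v)" for s
    proof -
      have "min R r / norm v \<le> r / norm v" using v by (intro divide_right_mono) auto
      with that have "cmod s < r / norm v" by simp
      from zero[OF ball[OF this]] show ?thesis .
    qed
    show "(1::complex) \<in> ball 0 (R / norm v)" using v R by simp
  qed auto
  then show ?thesis by (simp add: v_def)
qed

text \<open>Membership in the set \<open>Z\<close> of points near which \<open>f\<close> vanishes is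
  locally constant, since vanishing spreads over a whole ball inside \<Omega>. Connectedness then
  carries it from \<open>x\<close> to \<open>y\<close>.\<close>

lemma holo_on_identity:
  fixes f :: "('n::finite) fn"
  assumes f: "holo_on \<Omega> f" and con: "connected \<Omega>" and x: "x \<in> \<Omega>" and "0 < r"
    and zero: "\<And>u. u \<in> ball x r \<Longrightarrow> f u = 0" and y: "y \<in> \<Omega>"
  shows "f y = 0"
proof -
  have op: "open \<Omega>" using f by (simp add: holo_on_def)
  define Z where "Z = {y. \<exists>r>0. \<forall>u\<in>ball y r. f u = 0}"
  have "(x \<in> Z) = (y \<in> Z)"
  proof (rule connected_equivalence_relation[OF con x y])
    fix a assume "a \<in> \<Omega>"
    then obtain r where r: "r > 0" "ball a r \<subseteq> \<Omega>" using op open_contains_ball by blast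
    have "(a \<in> Z) = (u \<in> Z)" if u: "u \<in> ball a (r/3)" for u
    proof
      assume "a \<in> Z"
      then have "f v = 0" if "v \<in> ball a r" for v
        using holo_on_zero_ball[OF f r(2)] that by (auto simp: Z_def)
      moreover have "ball u (r/3) \<subseteq> ball a r"
        using u r(1) by (subst ball_subset_ball_iff) (auto simp: dist_commute)
      ultimately show "u \<in> Z" using r(1) unfolding Z_def by (auto intro!: exI[of _ "r/3"])
    next
      assume "u \<in> Z"
      \<comment> \<open>The ball of radius \<open>2*r/3\<close> around \<open>u\<close> is small
        enough to stay inside \<open>ball a r\<close> and large enough to contain
        \<open>ball a (r/3)\<close>.\<close>
      moreover have "ball u (2*r/3) \<subseteq> ball a r"
        using u r(1) by (subst ball_subset_ball_iff) (auto simp: dist_commute)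
      ultimately have "f v = 0" if "v \<in> ball u (2*r/3)" for v
        using holo_on_zero_ball[OF f, of u "2*r/3" _ v] that r(2) unfolding Z_def by blast
      moreover have "ball a (r/3) \<subseteq> ball u (2*r/3)"
        using u r(1) by (subst ball_subset_ball_iff) (auto simp: dist_commute)
      ultimately show "a \<in> Z" using r(1) unfolding Z_def by (auto intro!: exI[of _ "r/3"])
    qed
    then show "\<exists>T. openin (top_of_set \<Omega>) T \<and> a \<in> T \<and> (\<forall>x\<in>T. (a \<in> Z) = (x \<in> Z))"
      using r op by (intro exI[of _ "ball a (r/3)"]) (auto simp: openin_open_eq)
  qed auto
  moreover have "x \<in> Z" using zero \<open>0 < r\<close> by (auto simp: Z_def)
  ultimately have "y \<in> Z" by simp
  then obtain t where "t > 0" "\<forall>u\<in>ball y t. f u = 0" by (auto simp: Z_def)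
  then show ?thesis by simp
qed

text \<open>Differentiating \<open>f w \<bullet> f w = 1\<close> makes every \<open>L h\<close>
  orthogonal to \<open>f z\<close> over the reals. Replacing \<open>h\<close> by \<i> times
  \<open>h\<close> kills the other real component as well, so the derivative is zero.\<close>

lemma holo_on_const_modulus:
  assumes f: "holo_on \<Omega> f" and con: "connected \<Omega>"
    and mod: "\<And>w. w \<in> \<Omega> \<Longrightarrow> cmod (f w) = 1" and xy: "x \<in> \<Omega>" "y \<in> \<Omega>"
  shows "f x = f y"
proof (rule has_derivative_zero_unique_connected[OF _ con _ xy])
  show op: "open \<Omega>" using f by (simp add: holo_on_def)
  fix z assume z: "z \<in> \<Omega>"
  then obtain L where L: "(f has_derivative L) (at z)" "\<And>c v. L (c *s v) = c * L v"
    using f by (auto simp: holo_on_def)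
  have "((\<lambda>w. f w \<bullet> f w) has_derivative (\<lambda>h. f z \<bullet> L h + L h \<bullet> f z)) (at z)"
    by (rule has_derivative_inner[OF L(1) L(1)])
  moreover have "((\<lambda>w. f w \<bullet> f w) has_derivative (\<lambda>h. 0)) (at z)"
    by (rule has_derivative_transform_within_open[OF has_derivative_const[of 1] op z])
       (simp add: mod dot_square_norm)
  ultimately have "(\<lambda>h. f z \<bullet> L h + L h \<bullet> f z) = (\<lambda>h. 0)"
    by (rule has_derivative_unique)
  then have orth: "f z \<bullet> L h = 0" for h by (simp add: inner_commute fun_eq_iff)
  have "L h = 0" for h
  proof -
    have "f z \<bullet> (\<i> * L h) = 0" using orth[of "\<i> *s h"] L(2) by simp
    with orth[of h] have "cnj (f z) * L h = 0"
      by (auto simp: inner_complex_def complex_eq_iff algebra_simps)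
    moreover have "f z \<noteq> 0" using mod[OF z] by auto
    ultimately show ?thesis by simp
  qed
  then have "L = (\<lambda>h. 0)" by auto
  with L(1) show "(f has_derivative (\<lambda>h. 0)) (at z)" by simp
qed

section \<open>Sesquiholomorphic functions vanishing on the diagonal\<close>

text \<open>Expand \<open>h s t\<close> in powers of \<open>s\<close>: the coefficients are
  holomorphic in \<open>t\<close> by assumption, and Cauchy's inequality gives a uniformly
  convergent series of holomorphic functions of \<open>x\<close>. Holomorphy in \<open>t\<close> is
  assumed for the Taylor coefficients because for operator kernels these are bounded functionals,
  for which it follows from Riesz.\<close>

lemma holomorphic_on_two_variables_comp:
  fixes h :: "complex \<Rightarrow> complex \<Rightarrow> complex"
  assumes hol1: "\<And>t. t \<in> ball 0 R \<Longrightarrow> (\<lambda>s. h s t) holomorphic_on ball 0 R"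
    and bd: "\<And>s t. s \<in> ball 0 R \<Longrightarrow> t \<in> ball 0 R \<Longrightarrow> cmod (h s t) \<le> M"
    and hol2: "\<And>n. (\<lambda>t. (deriv ^^ n) (\<lambda>s. h s t) 0) holomorphic_on ball 0 R"
    and A: "open A" and p: "p holomorphic_on A" "p ` A \<subseteq> ball 0 \<rho>" "\<rho> < R"
    and q: "q holomorphic_on A" "q ` A \<subseteq> ball 0 R"
  shows "(\<lambda>x. h (p x) (q x)) holomorphic_on A"
proof (cases "A = {}")
  case False
  obtain a where "a \<in> A" using False by blast
  then have "p a \<in> ball 0 \<rho>" using p(2) by blast
  then have "cmod (p a) < \<rho>" by simp
  then have "0 < \<rho>" using norm_ge_zero order_le_less_trans by blast
  \<comment> \<open>A radius strictly between \<rho> and \<open>R\<close>: the Cauchy inequality is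
    applied on it, and the ratio of the geometric majorant is \<open>\<rho> / \<rho>'\<close>, less
    than 1.\<close>
  define \<rho>' where "\<rho>' = (\<rho> + R) / 2"
  have \<rho>': "\<rho> < \<rho>'" "\<rho>' < R" "0 < \<rho>'" using p(3) \<open>0 < \<rho>\<close> by (auto simp: \<rho>'_def)
  define c where "c = (\<lambda>n t. (deriv ^^ n) (\<lambda>s. h s t) 0 / fact n)"
  have c_bd: "cmod (c n t) \<le> M / \<rho>' ^ n" if t: "t \<in> ball 0 R" for n t
  proof -
    have "cmod ((deriv ^^ n) (\<lambda>s. h s t) 0) \<le> fact n * M / \<rho>' ^ n"
    proof (rule Cauchy_inequality)
      show "(\<lambda>s. h s t) holomorphic_on ball 0 \<rho>'"
        by (rule holomorphic_on_subset[OF hol1[OF t]]) (use \<rho>' in auto)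
      show "continuous_on (cball 0 \<rho>') (\<lambda>s. h s t)"
        by (rule holomorphic_on_imp_continuous_on, rule holomorphic_on_subset[OF hol1[OF t]]) (use \<rho>' in auto)
    qed (use \<rho>' bd t in auto)
    then show ?thesis by (simp add: c_def norm_divide field_simps)
  qed
  have ser: "(\<lambda>n. c n t * s ^ n) sums h s t" if "s \<in> ball 0 R" "t \<in> ball 0 R" for s t
    using holomorphic_power_series[OF hol1[OF that(2)] that(1)] by (simp add: c_def)
  have unif: "uniform_limit A (\<lambda>N x. \<Sum>n<N. c n (q x) * p x ^ n) (\<lambda>x. \<Sum>n. c n (q x) * p x ^ n) sequentially"
  proof (rule Weierstrass_m_test)
    fix n x assume x: "x \<in> A"
    have "cmod (c n (q x) * p x ^ n) = cmod (c n (q x)) * cmod (p x) ^ n"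
      by (simp add: norm_mult norm_power)
    also have "\<dots> \<le> M / \<rho>' ^ n * \<rho> ^ n"
      using x p(2) q(2) \<rho>' by (intro mult_mono c_bd power_mono) (force intro: order_trans[OF norm_ge_zero c_bd])+
    finally show "norm (c n (q x) * p x ^ n) \<le> M * (\<rho> / \<rho>') ^ n" by (simp add: power_divide)
  next
    show "summable (\<lambda>n. M * (\<rho> / \<rho>') ^ n)"
      using \<rho>' \<open>0 < \<rho>\<close> by (intro summable_mult summable_geometric) auto
  qed
  have "(\<lambda>x. \<Sum>n. c n (q x) * p x ^ n) holomorphic_on A"
  proof (rule holomorphic_uniform_sequence[OF A])
    show "(\<lambda>x. \<Sum>n<N. c n (q x) * p x ^ n) holomorphic_on A" for N
    proof -
      have "(\<lambda>x. c n (q x)) holomorphic_on A" for n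
        using holomorphic_on_compose_gen[OF q(1) hol2[of n] q(2)]
        unfolding c_def o_def by (intro holomorphic_intros) auto
      then show ?thesis by (intro holomorphic_intros p)
    qed
    show "\<exists>d>0. cball x d \<subseteq> A \<and> uniform_limit (cball x d) (\<lambda>N x. \<Sum>n<N. c n (q x) * p x ^ n)
        (\<lambda>x. \<Sum>n. c n (q x) * p x ^ n) sequentially" if "x \<in> A" for x
      using A that unif by (meson open_contains_cball uniform_limit_on_subset)
  qed
  moreover have "(\<Sum>n. c n (q x) * p x ^ n) = h (p x) (q x)" if "x \<in> A" for x
    using ser[of "p x" "q x"] that p(2,3) q(2) by (intro sums_unique[symmetric]) force
  ultimately show ?thesis by (simp cong: holomorphic_cong)
qed (simp add: holomorphic_on_def)

lemma holomorphic_zero_on_reals: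
  assumes "f holomorphic_on ball 0 r" and "\<And>x::real. \<bar>x\<bar> < r \<Longrightarrow> f (of_real x) = 0" and "z \<in> ball 0 r"
  shows "f z = 0"
proof (rule analytic_continuation[OF assms(1), of "of_real ` {-r<..<r}" 0])
  have r: "r > 0" using assms(3) by (metis ball_eq_empty empty_iff not_less)
  show "complex_of_real ` {- r<..<r} \<subseteq> ball 0 r" by auto
  show "0 islimpt complex_of_real ` {- r<..<r}"
    unfolding islimpt_approachable
  proof (intro allI impI)
    fix e :: real assume "e > 0"
    then show "\<exists>x'\<in>complex_of_real ` {- r<..<r}. x' \<noteq> 0 \<and> dist x' 0 < e"
      using r by (intro bexI[of _ "of_real (min e r / 2)"] imageI) (auto simp: min_def)
  qed
  show "0 \<in> ball 0 r" using r by simp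
qed (use assms in \<open>auto simp: abs_less_iff\<close>)

lemma sesquiholomorphic_zero:
  fixes h :: "complex \<Rightarrow> complex \<Rightarrow> complex"
  assumes hol1: "\<And>t. t \<in> ball 0 R \<Longrightarrow> (\<lambda>s. h s t) holomorphic_on ball 0 R"
    and bd: "\<And>s t. s \<in> ball 0 R \<Longrightarrow> t \<in> ball 0 R \<Longrightarrow> cmod (h s t) \<le> M"
    and hol2: "\<And>n. (\<lambda>t. (deriv ^^ n) (\<lambda>s. h s t) 0) holomorphic_on ball 0 R"
    and zero: "\<And>s. s \<in> ball 0 R \<Longrightarrow> h s (cnj s) = 0"
    and st: "s \<in> ball 0 (R/2)" "t \<in> ball 0 (R/2)"
  shows "h s t = 0"
proof -
  \<comment> \<open>in the coordinates \<open>s = x + \<i> y\<close>, \<open>t = x - \<i> y\<close> the zero set contains all real \<open>x, y\<close>\<close>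
  define H where "H = (\<lambda>x y. h (x + \<i> * y) (x - \<i> * y))"
  have R: "R > 0" using st by (metis ball_eq_empty empty_iff half_gt_zero_iff not_less)
  have bnd: "cmod (x + \<i> * y) < R/2 + cmod y" "cmod (x - \<i> * y) < R/2 + cmod y"
     if "cmod x < R/2" for x y
    using that norm_triangle_ineq[of x "\<i> * y"] norm_triangle_ineq4[of x "\<i> * y"] by (auto simp: norm_mult)
  have bnd': "cmod (x + \<i> * y) < cmod x + R/2" "cmod (x - \<i> * y) < cmod x + R/2"
     if "cmod y < R/2" for x y
    using that norm_triangle_ineq[of x "\<i> * y"] norm_triangle_ineq4[of x "\<i> * y"] by (auto simp: norm_mult)
  have hx: "(\<lambda>x. H x y) holomorphic_on ball 0 (R/2)" if y: "cmod y < R/2" for y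
    unfolding H_def
    by (rule holomorphic_on_two_variables_comp[OF hol1 bd hol2, where \<rho> = "R/2 + cmod y"])
       (use y bnd[of _ y] in \<open>fastforce intro!: holomorphic_intros\<close>)+
  have hy: "(\<lambda>y. H x y) holomorphic_on ball 0 (R/2)" if x: "cmod x < R/2" for x
    unfolding H_def
    by (rule holomorphic_on_two_variables_comp[OF hol1 bd hol2, where \<rho> = "cmod x + R/2"])
       (use x bnd'[of _ x] in \<open>fastforce intro!: holomorphic_intros\<close>)+
  have H0: "H (of_real x) (of_real y) = 0" if "\<bar>x\<bar> < R/2" "\<bar>y\<bar> < R/2" for x y :: real
  proof -
    have "cmod (of_real x + \<i> * of_real y) < R"
      using bnd[of "of_real x" "of_real y"] that by simp
    then show ?thesis using zero[of "of_real x + \<i> * of_real y"] by (simp add: H_def)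
  qed
  have H1: "H x (of_real y) = 0" if "cmod x < R/2" "\<bar>y\<bar> < R/2" for x and y :: real
    using holomorphic_zero_on_reals[OF hx[of "of_real y"] H0, of x] that by simp
  have H2: "H x y = 0" if "cmod x < R/2" "cmod y < R/2" for x y
    using holomorphic_zero_on_reals[OF hy[of x] H1, of y] that by simp
  \<comment> \<open>These are the values of \<open>x\<close> and \<open>y\<close> belonging to
    \<open>s\<close> and \<open>t\<close>. Both must stay below \<open>R/2\<close> so that
    \<open>x + \<i> * y\<close> and \<open>x - \<i> * y\<close> have modulus below \<open>R\<close>;
    this explains the half radius in the conclusion.\<close>
  have "cmod ((s + t) / 2) < R/2" "cmod ((s - t) / (2 * \<i>)) < R/2"
    using st norm_triangle_ineq[of s t] norm_triangle_ineq4[of s t] by (auto simp: norm_divide norm_mult)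
  from H2[OF this] show ?thesis by (simp add: H_def field_simps)
qed

subsection \<open>The space of square integrable functions\<close>

text \<open>The best choice of \<open>t\<close> makes the two summands equal. If \<open>A\<close> or
  \<open>B\<close> is zero there is no such \<open>t\<close>, but a large or a small
  \<open>t\<close> already forces \<open>I\<close> to be zero.\<close>

lemma square_le_if_AMGM:
  fixes A B I :: real
  assumes nonneg: "A \<ge> 0" "B \<ge> 0" "I \<ge> 0"
    and le: "\<And>t. t > 0 \<Longrightarrow> 2 * I \<le> t * A + B / t"
  shows "I\<^sup>2 \<le> A * B"
proof (cases "A > 0 \<and> B > 0")
  case True
  define t where "t = sqrt B / sqrt A"
  have t: "t > 0" using True by (simp add: t_def)
  have "t * A = sqrt A * sqrt B" "B / t = sqrt A * sqrt B"
    using True by (auto simp: t_def field_simps)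
  with le[OF t] have "I \<le> sqrt (A * B)" by (simp add: real_sqrt_mult)
  with nonneg show ?thesis by (metis mult_nonneg_nonneg real_le_rsqrt real_sqrt_le_iff real_sqrt_pow2 power_mono)
next
  case False
  have "I \<le> 0"
  proof (rule ccontr)
    assume "\<not> I \<le> 0"
    then have I: "I > 0" by simp
    from False nonneg consider "A = 0" | "B = 0" by force
    then show False
    proof cases
      \<comment> \<open>With this \<open>t\<close> the right side is
        \<open>I * (B / (B + 1))\<close>, at most \<open>I\<close>, against \<open>2 * I\<close> on
        the left.\<close>
      case 1
      have "2 * I \<le> B / ((B + 1) / I)" using le[of "(B + 1) / I"] 1 I nonneg by simp
      also have "\<dots> = I * (B / (B + 1))" by simp
      also have "\<dots> \<le> I * 1" using I nonneg by (intro mult_left_mono) (auto simp: field_simps)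
      finally show False using I by simp
    next
      case 2
      have "2 * I \<le> I / (A + 1) * A" using le[of "I / (A + 1)"] 2 I nonneg by simp
      also have "\<dots> = I * (A / (A + 1))" by simp
      also have "\<dots> \<le> I * 1" using I nonneg by (intro mult_left_mono) (auto simp: field_simps)
      finally show False using I by simp
    qed
  qed
  then show ?thesis using nonneg by simp
qed

text \<open>Integrate \<open>2 * f * g \<le> t * f\<^sup>2 + g\<^sup>2 / t\<close> and optimise in
  \<open>t\<close> afterwards. The choice \<open>t = 1\<close> first shows that the integral is
  finite, which allows the passage to real numbers.\<close>

lemma nn_integral_Cauchy_Schwarz:
  fixes f g :: "'a \<Rightarrow> real"
  assumes [measurable]: "f \<in> borel_measurable M" "g \<in> borel_measurable M"
    and nonneg: "\<And>x. f x \<ge> 0" "\<And>x. g x \<ge> 0"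
    and A: "(\<integral>\<^sup>+x. ennreal ((f x)\<^sup>2) \<partial>M) \<le> ennreal A" "A \<ge> 0"
    and B: "(\<integral>\<^sup>+x. ennreal ((g x)\<^sup>2) \<partial>M) \<le> ennreal B" "B \<ge> 0"
  shows "(\<integral>\<^sup>+x. ennreal (f x * g x) \<partial>M) \<le> ennreal (sqrt (A * B))"
proof -
  define I where "I = (\<integral>\<^sup>+x. ennreal (f x * g x) \<partial>M)"
  have *: "2 * I \<le> ennreal (t * A + B / t)" if t: "t > 0" for t
  proof -
    have "2 * I = (\<integral>\<^sup>+x. ennreal (2 * (f x * g x)) \<partial>M)"
      unfolding I_def by (subst nn_integral_cmult[symmetric]) (auto simp: ennreal_mult nonneg)
    also have "\<dots> \<le> (\<integral>\<^sup>+x. ennreal t * ennreal ((f x)\<^sup>2) + ennreal (1 / t) * ennreal ((g x)\<^sup>2) \<partial>M)"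
    proof (intro nn_integral_mono)
      fix x
      have "0 \<le> (t * f x - g x)\<^sup>2 / t" using t by simp
      also have "\<dots> = t * (f x)\<^sup>2 + 1 / t * (g x)\<^sup>2 - 2 * (f x * g x)"
        using t by (simp add: field_simps power2_eq_square)
      finally have "2 * (f x * g x) \<le> t * (f x)\<^sup>2 + 1 / t * (g x)\<^sup>2" by simp
      then show "ennreal (2 * (f x * g x)) \<le> ennreal t * ennreal ((f x)\<^sup>2) + ennreal (1 / t) * ennreal ((g x)\<^sup>2)"
        using t by (auto simp: ennreal_mult'[symmetric] ennreal_plus[symmetric] simp del: ennreal_plus intro!: ennreal_leI)
    qed
    also have "\<dots> = ennreal t * (\<integral>\<^sup>+x. ennreal ((f x)\<^sup>2) \<partial>M) + ennreal (1 / t) * (\<integral>\<^sup>+x. ennreal ((g x)\<^sup>2) \<partial>M)"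
      by (simp add: nn_integral_add nn_integral_cmult)
    also have "\<dots> \<le> ennreal t * ennreal A + ennreal (1 / t) * ennreal B"
      using A B by (intro add_mono mult_left_mono) auto
    also have "\<dots> = ennreal (t * A + B / t)"
      using t A B by (simp add: ennreal_mult'[symmetric] ennreal_plus[symmetric] del: ennreal_plus)
    finally show ?thesis .
  qed
  have "I < \<infinity>"
    using *[of 1] by (cases "I = \<infinity>") (auto simp: ennreal_mult_top top_unique less_top)
  then obtain i where i: "I = ennreal i" "i \<ge> 0"
    by (cases I) auto
  have "i\<^sup>2 \<le> A * B"
  proof (rule square_le_if_AMGM)
    fix t :: real assume t: "t > 0"
    have "ennreal (2 * i) \<le> ennreal (t * A + B / t)"
      using *[OF t] i by (simp add: ennreal_mult)
    then show "2 * i \<le> t * A + B / t"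
      using t A B i by (subst (asm) ennreal_le_iff) auto
  qed (use A B i in auto)
  then have "i \<le> sqrt (A * B)" by (rule real_le_rsqrt)
  then show ?thesis using i unfolding I_def by (simp add: ennreal_leI)
qed

lemma nrm_nonneg [simp]: "0 \<le> nrm \<sigma> f"
  by (simp add: nrm_def)

lemma nrm_power2: "(nrm \<sigma> f)\<^sup>2 = (\<integral>w. (cmod (f w))\<^sup>2 \<partial>\<sigma>)"
  by (simp add: nrm_def)

lemma nrm_zero [simp]: "nrm \<sigma> (\<lambda>w. 0) = 0"
  by (simp add: nrm_def)

lemma nrm_cmult: "nrm \<sigma> (\<lambda>w. c * f w) = cmod c * nrm \<sigma> f"
  by (simp add: nrm_def norm_mult power_mult_distrib real_sqrt_mult)

lemma nrm_minus_commute: "nrm \<sigma> (\<lambda>w. f w - g w) = nrm \<sigma> (\<lambda>w. g w - f w)"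
  by (simp add: nrm_def norm_minus_commute)

lemma L2D:
  assumes "f \<in> L2 \<Omega> \<sigma>"
  shows "f \<in> borel_measurable \<sigma>" "integrable \<sigma> (\<lambda>w. (cmod (f w))\<^sup>2)" "w \<notin> \<Omega> \<Longrightarrow> f w = 0"
  using assms by (auto simp: L2_def)

lemma nn_integral_L2:
  assumes "f \<in> L2 \<Omega> \<sigma>"
  shows "(\<integral>\<^sup>+w. ennreal ((cmod (f w))\<^sup>2) \<partial>\<sigma>) = ennreal ((nrm \<sigma> f)\<^sup>2)"
  unfolding nrm_power2 using L2D[OF assms] by (intro nn_integral_eq_integral) auto

lemma L2I_nn_integral:
  assumes "f \<in> borel_measurable \<sigma>" "\<And>w. w \<notin> \<Omega> \<Longrightarrow> f w = 0" "c \<ge> 0"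
    and "(\<integral>\<^sup>+w. ennreal ((cmod (f w))\<^sup>2) \<partial>\<sigma>) \<le> ennreal (c\<^sup>2)"
  shows "f \<in> L2 \<Omega> \<sigma>" "nrm \<sigma> f \<le> c"
proof -
  have "integrable \<sigma> (\<lambda>w. (cmod (f w))\<^sup>2)"
    using assms(1,4) by (intro integrableI_bounded) (auto simp: le_less_trans)
  then show L2: "f \<in> L2 \<Omega> \<sigma>" using assms by (auto simp: L2_def)
  have "(nrm \<sigma> f)\<^sup>2 \<le> c\<^sup>2" using assms(4) unfolding nn_integral_L2[OF L2] by simp
  then show "nrm \<sigma> f \<le> c" using assms(3) power2_le_imp_le by blast
qed

lemma L2_zero [simp]: "(\<lambda>w. 0) \<in> L2 \<Omega> \<sigma>"
  by (simp add: L2_def)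

lemma L2_add:
  assumes f: "f \<in> L2 \<Omega> \<sigma>" and g: "g \<in> L2 \<Omega> \<sigma>"
  shows "(\<lambda>w. f w + g w) \<in> L2 \<Omega> \<sigma>"
proof -
  note [measurable] = L2D(1)[OF f] L2D(1)[OF g]
  have "integrable \<sigma> (\<lambda>w. (cmod (f w + g w))\<^sup>2)"
  proof (rule Bochner_Integration.integrable_bound)
    show "integrable \<sigma> (\<lambda>w. 2 * (cmod (f w))\<^sup>2 + 2 * (cmod (g w))\<^sup>2)"
      using L2D(2)[OF f] L2D(2)[OF g] by simp
    show "AE w in \<sigma>. norm ((cmod (f w + g w))\<^sup>2) \<le> norm (2 * (cmod (f w))\<^sup>2 + 2 * (cmod (g w))\<^sup>2)"
    proof (rule AE_I2)
      fix w
      have "(cmod (f w + g w))\<^sup>2 \<le> (cmod (f w) + cmod (g w))\<^sup>2"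
        by (intro power_mono norm_triangle_ineq) auto
      also have "\<dots> \<le> 2 * (cmod (f w))\<^sup>2 + 2 * (cmod (g w))\<^sup>2"
        using sum_squares_bound[of "cmod (f w)" "cmod (g w)"] by (simp add: power2_sum)
      finally show "norm ((cmod (f w + g w))\<^sup>2) \<le> norm (2 * (cmod (f w))\<^sup>2 + 2 * (cmod (g w))\<^sup>2)" by simp
    qed
  qed measurable
  then show ?thesis using L2D[OF f] L2D[OF g] by (auto simp: L2_def)
qed

lemma L2_bounded_mult:
  assumes f: "f \<in> L2 \<Omega> \<sigma>" and [measurable]: "u \<in> borel_measurable \<sigma>"
    and B: "\<And>w. w \<in> \<Omega> \<Longrightarrow> cmod (u w) \<le> B" "B \<ge> 0"
  shows "(\<lambda>w. u w * f w) \<in> L2 \<Omega> \<sigma>" "nrm \<sigma> (\<lambda>w. u w * f w) \<le> B * nrm \<sigma> f"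
proof -
  note [measurable] = L2D(1)[OF f]
  have "(\<integral>\<^sup>+w. ennreal ((cmod (u w * f w))\<^sup>2) \<partial>\<sigma>) \<le> (\<integral>\<^sup>+w. ennreal (B\<^sup>2) * ennreal ((cmod (f w))\<^sup>2) \<partial>\<sigma>)"
  proof (rule nn_integral_mono)
    fix w
    have "cmod (u w) * cmod (f w) \<le> B * cmod (f w)"
      using B L2D(3)[OF f, of w] by (cases "w \<in> \<Omega>") (auto intro: mult_right_mono)
    then have "(cmod (u w * f w))\<^sup>2 \<le> (B * cmod (f w))\<^sup>2"
      by (intro power_mono) (auto simp: norm_mult)
    then show "ennreal ((cmod (u w * f w))\<^sup>2) \<le> ennreal (B\<^sup>2) * ennreal ((cmod (f w))\<^sup>2)"
      by (simp add: ennreal_mult'[symmetric] power_mult_distrib ennreal_leI)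
  qed
  also have "\<dots> = ennreal (B\<^sup>2) * (\<integral>\<^sup>+w. ennreal ((cmod (f w))\<^sup>2) \<partial>\<sigma>)"
    by (simp add: nn_integral_cmult)
  also have "\<dots> = ennreal ((B * nrm \<sigma> f)\<^sup>2)"
    by (simp add: nn_integral_L2[OF f] ennreal_mult'[symmetric] power_mult_distrib)
  finally have *: "(\<integral>\<^sup>+w. ennreal ((cmod (u w * f w))\<^sup>2) \<partial>\<sigma>) \<le> ennreal ((B * nrm \<sigma> f)\<^sup>2)" .
  show "(\<lambda>w. u w * f w) \<in> L2 \<Omega> \<sigma>" "nrm \<sigma> (\<lambda>w. u w * f w) \<le> B * nrm \<sigma> f"
    using L2I_nn_integral[OF _ _ _ *] B(2) L2D(3)[OF f] by auto
qed

lemma L2_cmult: "f \<in> L2 \<Omega> \<sigma> \<Longrightarrow> (\<lambda>w. c * f w) \<in> L2 \<Omega> \<sigma>"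
  by (rule L2_bounded_mult(1)[where B = "cmod c"]) auto

lemma L2_diff:
  assumes "f \<in> L2 \<Omega> \<sigma>" "g \<in> L2 \<Omega> \<sigma>"
  shows "(\<lambda>w. f w - g w) \<in> L2 \<Omega> \<sigma>"
  using L2_add[OF assms(1) L2_cmult[OF assms(2), of "- 1"]] by simp

lemma L2_integrable_mult:
  assumes f: "f \<in> L2 \<Omega> \<sigma>" and g: "g \<in> L2 \<Omega> \<sigma>"
  shows "integrable \<sigma> (\<lambda>w. f w * cnj (g w))"
proof -
  note [measurable] = L2D(1)[OF f] L2D(1)[OF g]
  show ?thesis
  proof (rule Bochner_Integration.integrable_bound)
    show "integrable \<sigma> (\<lambda>w. (cmod (f w))\<^sup>2 + (cmod (g w))\<^sup>2)"
      using L2D(2)[OF f] L2D(2)[OF g] by simp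
    show "AE w in \<sigma>. norm (f w * cnj (g w)) \<le> norm ((cmod (f w))\<^sup>2 + (cmod (g w))\<^sup>2)"
    proof (rule AE_I2)
      fix w
      have "0 \<le> cmod (f w) * cmod (g w)" by simp
      moreover have "2 * (cmod (f w) * cmod (g w)) \<le> (cmod (f w))\<^sup>2 + (cmod (g w))\<^sup>2"
        using sum_squares_bound[of "cmod (f w)" "cmod (g w)"] by (simp add: mult.assoc)
      ultimately have "cmod (f w) * cmod (g w) \<le> (cmod (f w))\<^sup>2 + (cmod (g w))\<^sup>2" by linarith
      then show "norm (f w * cnj (g w)) \<le> norm ((cmod (f w))\<^sup>2 + (cmod (g w))\<^sup>2)"
        by (simp add: norm_mult)
    qed
    have "cnj \<in> borel_measurable borel" by (intro borel_measurable_continuous_onI continuous_intros)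
    then show "(\<lambda>w. f w * cnj (g w)) \<in> borel_measurable \<sigma>" by measurable
  qed
qed

lemma L2_nn_Cauchy_Schwarz:
  assumes f: "f \<in> L2 \<Omega> \<sigma>" and g: "g \<in> L2 \<Omega> \<sigma>"
  shows "(\<integral>\<^sup>+w. ennreal (cmod (f w) * cmod (g w)) \<partial>\<sigma>) \<le> ennreal (nrm \<sigma> f * nrm \<sigma> g)"
proof -
  note [measurable] = L2D(1)[OF f] L2D(1)[OF g]
  have "(\<integral>\<^sup>+w. ennreal (cmod (f w) * cmod (g w)) \<partial>\<sigma>) \<le> ennreal (sqrt ((nrm \<sigma> f)\<^sup>2 * (nrm \<sigma> g)\<^sup>2))"
    by (rule nn_integral_Cauchy_Schwarz) (auto simp: nn_integral_L2[OF f] nn_integral_L2[OF g])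
  then show ?thesis by (simp add: real_sqrt_mult)
qed

lemma ip_Cauchy_Schwarz:
  assumes f: "f \<in> L2 \<Omega> \<sigma>" and g: "g \<in> L2 \<Omega> \<sigma>"
  shows "cmod (ip \<sigma> f g) \<le> nrm \<sigma> f * nrm \<sigma> g"
proof -
  have "ennreal (cmod (ip \<sigma> f g)) \<le> (\<integral>\<^sup>+w. ennreal (cmod (f w * cnj (g w))) \<partial>\<sigma>)"
    unfolding ip_def by (rule integral_norm_bound_ennreal[OF L2_integrable_mult[OF f g]])
  also have "\<dots> \<le> ennreal (nrm \<sigma> f * nrm \<sigma> g)"
    using L2_nn_Cauchy_Schwarz[OF f g] by (simp add: norm_mult)
  finally show ?thesis by (simp add: mult_nonneg_nonneg)
qed

lemma ip_commute: "ip \<sigma> g f = cnj (ip \<sigma> f g)"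
  unfolding ip_def by (subst Bochner_Integration.integral_cnj[symmetric]) (simp add: mult.commute)

lemma ip_add_left:
  assumes "f \<in> L2 \<Omega> \<sigma>" "g \<in> L2 \<Omega> \<sigma>" "h \<in> L2 \<Omega> \<sigma>"
  shows "ip \<sigma> (\<lambda>w. f w + g w) h = ip \<sigma> f h + ip \<sigma> g h"
  unfolding ip_def
  by (subst Bochner_Integration.integral_add[symmetric]) (auto intro!: L2_integrable_mult assms simp: algebra_simps)

lemma ip_diff_left:
  assumes "f \<in> L2 \<Omega> \<sigma>" "g \<in> L2 \<Omega> \<sigma>" "h \<in> L2 \<Omega> \<sigma>"
  shows "ip \<sigma> (\<lambda>w. f w - g w) h = ip \<sigma> f h - ip \<sigma> g h"
  unfolding ip_def
  by (subst Bochner_Integration.integral_diff[symmetric]) (auto intro!: L2_integrable_mult assms simp: algebra_simps)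

lemma ip_cmult_left: "ip \<sigma> (\<lambda>w. c * f w) h = c * ip \<sigma> f h"
  unfolding ip_def by (simp add: mult.assoc)

lemma ip_add_right:
  assumes "f \<in> L2 \<Omega> \<sigma>" "g \<in> L2 \<Omega> \<sigma>" "h \<in> L2 \<Omega> \<sigma>"
  shows "ip \<sigma> h (\<lambda>w. f w + g w) = ip \<sigma> h f + ip \<sigma> h g"
  using ip_add_left[OF assms] by (metis ip_commute complex_cnj_add)

lemma ip_cmult_right: "ip \<sigma> h (\<lambda>w. c * f w) = cnj c * ip \<sigma> h f"
  by (metis ip_cmult_left ip_commute complex_cnj_mult)

lemma ip_zero_left [simp]: "ip \<sigma> (\<lambda>w. 0) f = 0"
  by (simp add: ip_def)

lemma ip_zero_right [simp]: "ip \<sigma> f (\<lambda>w. 0) = 0"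
  by (simp add: ip_def)

lemma ip_self: "ip \<sigma> f f = of_real ((nrm \<sigma> f)\<^sup>2)"
  unfolding ip_def nrm_power2 complex_norm_square[symmetric] of_real_power[symmetric]
  by (rule integral_complex_of_real)

lemma nrm_add_power2:
  assumes f: "f \<in> L2 \<Omega> \<sigma>" and g: "g \<in> L2 \<Omega> \<sigma>"
  shows "(nrm \<sigma> (\<lambda>w. f w + g w))\<^sup>2 = (nrm \<sigma> f)\<^sup>2 + (nrm \<sigma> g)\<^sup>2 + 2 * Re (ip \<sigma> f g)"
proof -
  have "complex_of_real ((nrm \<sigma> (\<lambda>w. f w + g w))\<^sup>2)
      = ip \<sigma> f f + ip \<sigma> f g + (ip \<sigma> g f + ip \<sigma> g g)"
    unfolding ip_self[symmetric]
    using ip_add_left[OF f g L2_add[OF f g]] ip_add_right[OF f g f] ip_add_right[OF f g g] by simp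
  also have "ip \<sigma> g f = cnj (ip \<sigma> f g)" by (rule ip_commute)
  finally have "Re (complex_of_real ((nrm \<sigma> (\<lambda>w. f w + g w))\<^sup>2))
      = Re (ip \<sigma> f f + ip \<sigma> f g + (cnj (ip \<sigma> f g) + ip \<sigma> g g))" by (rule arg_cong)
  then show ?thesis by (simp add: ip_self del: of_real_power)
qed

lemma nrm_triangle:
  assumes f: "f \<in> L2 \<Omega> \<sigma>" and g: "g \<in> L2 \<Omega> \<sigma>"
  shows "nrm \<sigma> (\<lambda>w. f w + g w) \<le> nrm \<sigma> f + nrm \<sigma> g"
proof (rule power2_le_imp_le)
  have "Re (ip \<sigma> f g) \<le> nrm \<sigma> f * nrm \<sigma> g"
    using ip_Cauchy_Schwarz[OF f g] complex_Re_le_cmod order_trans by blast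
  then show "(nrm \<sigma> (\<lambda>w. f w + g w))\<^sup>2 \<le> (nrm \<sigma> f + nrm \<sigma> g)\<^sup>2"
    unfolding nrm_add_power2[OF f g] by (simp add: power2_sum)
qed simp

lemma nrm_diff_triangle:
  assumes f: "f \<in> L2 \<Omega> \<sigma>" and g: "g \<in> L2 \<Omega> \<sigma>" and h: "h \<in> L2 \<Omega> \<sigma>"
  shows "nrm \<sigma> (\<lambda>w. f w - h w) \<le> nrm \<sigma> (\<lambda>w. f w - g w) + nrm \<sigma> (\<lambda>w. g w - h w)"
  using nrm_triangle[OF L2_diff[OF f g] L2_diff[OF g h]] by simp

lemma nrm_triangle_diff:
  assumes f: "f \<in> L2 \<Omega> \<sigma>" and g: "g \<in> L2 \<Omega> \<sigma>"
  shows "nrm \<sigma> (\<lambda>w. f w - g w) \<le> nrm \<sigma> f + nrm \<sigma> g"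
  using nrm_triangle[OF f L2_cmult[OF g, of "- 1"]] by (simp add: nrm_cmult[of _ "-1", simplified])

lemma nrm_le_add_diff:
  assumes f: "f \<in> L2 \<Omega> \<sigma>" and g: "g \<in> L2 \<Omega> \<sigma>"
  shows "nrm \<sigma> f \<le> nrm \<sigma> g + nrm \<sigma> (\<lambda>w. f w - g w)"
  using nrm_triangle[OF g L2_diff[OF f g]] by simp

lemma nrm_parallelogram:
  assumes f: "f \<in> L2 \<Omega> \<sigma>" and g: "g \<in> L2 \<Omega> \<sigma>"
  shows "(nrm \<sigma> (\<lambda>w. f w - g w))\<^sup>2 = 2 * (nrm \<sigma> f)\<^sup>2 + 2 * (nrm \<sigma> g)\<^sup>2 - (nrm \<sigma> (\<lambda>w. f w + g w))\<^sup>2"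
  using nrm_add_power2[OF f g] nrm_add_power2[OF f L2_cmult[OF g, of "- 1"]]
  by (simp add: nrm_cmult[of _ "-1", simplified] ip_cmult_right[of _ _ "-1", simplified])

text \<open>Fatou's lemma for the squared moduli. It stands in for weak compactness: bounds survive
  pointwise limits, both for functions and, applied to values of operators, for operators.\<close>

lemma L2_Fatou:
  assumes f: "\<And>n. f n \<in> L2 \<Omega> \<sigma>" and lim: "\<And>w. (\<lambda>n. f n w) \<longlonglongrightarrow> g w"
    and c: "\<forall>\<^sub>F n in sequentially. nrm \<sigma> (f n) \<le> c" and "c \<ge> 0"
  shows "g \<in> L2 \<Omega> \<sigma>" "nrm \<sigma> g \<le> c"
proof -
  note [measurable] = L2D(1)[OF f]
  have [measurable]: "g \<in> borel_measurable \<sigma>"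
    by (rule borel_measurable_LIMSEQ_metric[OF _ lim]) measurable
  have "(\<integral>\<^sup>+w. ennreal ((cmod (g w))\<^sup>2) \<partial>\<sigma>) = (\<integral>\<^sup>+w. liminf (\<lambda>n. ennreal ((cmod (f n w))\<^sup>2)) \<partial>\<sigma>)"
    by (intro nn_integral_cong lim_imp_Liminf[symmetric]) (auto intro!: tendsto_intros lim)
  also have "\<dots> \<le> liminf (\<lambda>n. \<integral>\<^sup>+w. ennreal ((cmod (f n w))\<^sup>2) \<partial>\<sigma>)"
    by (rule nn_integral_liminf) measurable
  also have "\<dots> \<le> ennreal (c\<^sup>2)"
  proof (rule Liminf_le)
    show "\<forall>\<^sub>F n in sequentially. (\<integral>\<^sup>+w. ennreal ((cmod (f n w))\<^sup>2) \<partial>\<sigma>) \<le> ennreal (c\<^sup>2)"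
      using c by eventually_elim (auto simp: nn_integral_L2[OF f] intro!: ennreal_leI power_mono)
  qed simp
  finally have *: "(\<integral>\<^sup>+w. ennreal ((cmod (g w))\<^sup>2) \<partial>\<sigma>) \<le> ennreal (c\<^sup>2)" .
  have z: "g w = 0" if "w \<notin> \<Omega>" for w
    using lim[of w] L2D(3)[OF f that] by (simp add: LIMSEQ_const_iff)
  show "g \<in> L2 \<Omega> \<sigma>" "nrm \<sigma> g \<le> c"
    using L2I_nn_integral[OF _ z \<open>c \<ge> 0\<close> *] by auto
qed

lemma nrm_dominated_convergence:
  assumes f: "\<And>n. f n \<in> L2 \<Omega> \<sigma>" and G: "integrable \<sigma> (\<lambda>w. (G w)\<^sup>2)"
    and lim: "\<And>w. (\<lambda>n. f n w) \<longlonglongrightarrow> 0" and bd: "\<And>n w. cmod (f n w) \<le> G w"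
  shows "(\<lambda>n. nrm \<sigma> (f n)) \<longlonglongrightarrow> 0"
proof -
  note [measurable] = L2D(1)[OF f]
  have "(\<lambda>n. \<integral>w. (cmod (f n w))\<^sup>2 \<partial>\<sigma>) \<longlonglongrightarrow> (\<integral>w. 0 \<partial>\<sigma>)"
  proof (rule integral_dominated_convergence[where w = "\<lambda>w. (G w)\<^sup>2"])
    show "AE x in \<sigma>. (\<lambda>i. (cmod (f i x))\<^sup>2) \<longlonglongrightarrow> 0"
      using tendsto_power[OF tendsto_norm_zero[OF lim], of _ 2] by simp
    show "AE x in \<sigma>. norm ((cmod (f i x))\<^sup>2) \<le> (G x)\<^sup>2" for i
      using bd by (auto intro!: power_mono)
  qed (use G in auto)
  then have "(\<lambda>n. sqrt (\<integral>w. (cmod (f n w))\<^sup>2 \<partial>\<sigma>)) \<longlonglongrightarrow> sqrt 0"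
    by (intro tendsto_real_sqrt) simp
  then show ?thesis by (simp add: nrm_def)
qed

subsection \<open>The reproducing kernel and the projection\<close>

lemma Bsp_L2: "f \<in> Bsp \<Omega> \<sigma> \<Longrightarrow> f \<in> L2 \<Omega> \<sigma>"
  by (simp add: Bsp_def)

lemma Bsp_holo: "f \<in> Bsp \<Omega> \<sigma> \<Longrightarrow> holo_on \<Omega> f"
  by (simp add: Bsp_def)

lemma Bsp_add: "f \<in> Bsp \<Omega> \<sigma> \<Longrightarrow> g \<in> Bsp \<Omega> \<sigma> \<Longrightarrow> (\<lambda>w. f w + g w) \<in> Bsp \<Omega> \<sigma>"
  by (simp add: Bsp_def L2_add holo_on_add)

lemma Bsp_diff: "f \<in> Bsp \<Omega> \<sigma> \<Longrightarrow> g \<in> Bsp \<Omega> \<sigma> \<Longrightarrow> (\<lambda>w. f w - g w) \<in> Bsp \<Omega> \<sigma>"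
  by (simp add: Bsp_def L2_diff holo_on_diff)

lemma Bsp_cmult: "f \<in> Bsp \<Omega> \<sigma> \<Longrightarrow> (\<lambda>w. c * f w) \<in> Bsp \<Omega> \<sigma>"
  by (simp add: Bsp_def L2_cmult holo_on_cmult)

text \<open>\<open>nondegenerate\<close> excludes the zero space, which (A.5) admits through
  \<open>1 / 0 = 0\<close>; the theorem treats that space by hand.\<close>

locale bergman =
  fixes \<Omega> :: "('n::finite) pt set" and \<phi> :: "'n pt \<Rightarrow> 'n pt \<Rightarrow> 'n pt" and d :: "'n pt \<Rightarrow> 'n pt \<Rightarrow> real"
    and \<sigma> :: "'n pt measure" and K :: "'n pt \<Rightarrow> 'n fn" and \<kappa> :: real
  assumes SB: "strong_bergman_type \<Omega> \<phi> d \<sigma> K \<kappa>"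
    and nondegenerate: "nrm \<sigma> (K 0) \<noteq> 0"
begin

abbreviation nm :: "'n fn \<Rightarrow> real" where "nm \<equiv> nrm \<sigma>"
abbreviation N :: "'n pt \<Rightarrow> real" where "N z \<equiv> nm (K z)"
abbreviation B :: "'n fn set" where "B \<equiv> Bsp \<Omega> \<sigma>"
abbreviation H :: "'n fn set" where "H \<equiv> L2 \<Omega> \<sigma>"
abbreviation P :: "'n op" where "P \<equiv> proj \<Omega> \<sigma>"
abbreviation U :: "'n pt \<Rightarrow> 'n op" where "U \<equiv> Uop \<Omega> \<phi> \<sigma> K"
abbreviation lm :: "'n pt measure" where "lm \<equiv> lam \<sigma> K"

lemma open_dom: "open \<Omega>" and connected_dom: "connected \<Omega>" and zero_in [simp]: "0 \<in> \<Omega>"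
  using SB by (auto simp: strong_bergman_type_def is_domain_def)

lemma phi_aut: "z \<in> \<Omega> \<Longrightarrow> inv_biholo_aut \<Omega> (\<phi> z)" and phi_zero [simp]: "z \<in> \<Omega> \<Longrightarrow> \<phi> z 0 = z"
  using SB by (auto simp: strong_bergman_type_def)

lemma phi_in [simp]: "z \<in> \<Omega> \<Longrightarrow> w \<in> \<Omega> \<Longrightarrow> \<phi> z w \<in> \<Omega>"
  and phi_phi [simp]: "z \<in> \<Omega> \<Longrightarrow> w \<in> \<Omega> \<Longrightarrow> \<phi> z (\<phi> z w) = w"
  and phi_holo: "z \<in> \<Omega> \<Longrightarrow> holo_map_on \<Omega> (\<phi> z)"
  using phi_aut by (auto simp: inv_biholo_aut_def)

lemma phi_self [simp]: "z \<in> \<Omega> \<Longrightarrow> \<phi> z z = 0"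
  using phi_phi[of z 0] by simp

lemma phi_cont: "z \<in> \<Omega> \<Longrightarrow> continuous_on \<Omega> (\<phi> z)"
  by (rule holo_map_on_imp_continuous_on[OF phi_holo])

sublocale Met: Metric_space \<Omega> d
  using SB by (simp add: strong_bergman_type_def)

lemma d_phi: "z \<in> \<Omega> \<Longrightarrow> u \<in> \<Omega> \<Longrightarrow> v \<in> \<Omega> \<Longrightarrow> d (\<phi> z u) (\<phi> z v) = d u v"
  using SB by (simp add: strong_bergman_type_def)

lemma d_phi_zero: "z \<in> \<Omega> \<Longrightarrow> w \<in> \<Omega> \<Longrightarrow> d (\<phi> z w) 0 = d w z"
  using d_phi[of z w z] by simp

sublocale finite_measure \<sigma>
  using SB by (simp add: strong_bergman_type_def)

lemma sets_sigma [measurable_cong, simp]: "sets \<sigma> = sets borel"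
  and null_outside: "emeasure \<sigma> (- \<Omega>) = 0"
  using SB by (auto simp: strong_bergman_type_def)

lemma space_sigma [simp]: "space \<sigma> = UNIV"
  using sets_eq_imp_space_eq[OF sets_sigma] by simp

lemma dom_sets [measurable]: "\<Omega> \<in> sets borel"
  using open_dom by simp

lemma AE_dom: "AE w in \<sigma>. w \<in> \<Omega>"
  by (rule AE_I[where N = "- \<Omega>"]) (use null_outside in auto)

lemma K_in: "z \<in> \<Omega> \<Longrightarrow> K z \<in> B"
  and reproducing: "f \<in> B \<Longrightarrow> z \<in> \<Omega> \<Longrightarrow> f z = ip \<sigma> f (K z)"
  using SB by (auto simp: strong_bergman_type_def)

lemma K_L2: "z \<in> \<Omega> \<Longrightarrow> K z \<in> H"
  by (rule Bsp_L2[OF K_in])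

lemma B_zero [simp]: "(\<lambda>w. 0) \<in> B"
  by (simp add: Bsp_def holo_on_const open_dom)

lemma point_bound: "f \<in> B \<Longrightarrow> z \<in> \<Omega> \<Longrightarrow> cmod (f z) \<le> nm f * N z"
  by (metis reproducing ip_Cauchy_Schwarz Bsp_L2 K_L2)

lemma B_cont: "f \<in> B \<Longrightarrow> continuous_on \<Omega> f"
  by (rule holo_on_imp_continuous_on[OF Bsp_holo])

lemma B_outside: "f \<in> B \<Longrightarrow> w \<notin> \<Omega> \<Longrightarrow> f w = 0"
  using L2D(3)[OF Bsp_L2] by blast

lemma B_eq_zeroI:
  assumes "f \<in> B" "nm f = 0"
  shows "f = (\<lambda>w. 0)"
proof
  fix w show "f w = 0"
    using point_bound[OF assms(1), of w] assms(2) B_outside[OF assms(1), of w] by (cases "w \<in> \<Omega>") auto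
qed

lemma B_eqI:
  assumes "f \<in> B" "g \<in> B" "nm (\<lambda>w. f w - g w) = 0"
  shows "f = g"
  using B_eq_zeroI[OF Bsp_diff[OF assms(1,2)] assms(3)] by (metis (no_types) eq_iff_diff_eq_0 ext)

lemma K_ip: "z \<in> \<Omega> \<Longrightarrow> w \<in> \<Omega> \<Longrightarrow> K z w = ip \<sigma> (K z) (K w)"
  by (rule reproducing[OF K_in])

lemma K_sym: "z \<in> \<Omega> \<Longrightarrow> w \<in> \<Omega> \<Longrightarrow> K w z = cnj (K z w)"
  by (metis K_ip ip_commute)

lemma K_diag: "z \<in> \<Omega> \<Longrightarrow> K z z = of_real ((N z)\<^sup>2)"
  by (simp only: K_ip ip_self)

section \<open>What (A.5) says about the kernel\<close>

lemma kernel_modulus_aux: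
  assumes "z \<in> \<Omega>" "w \<in> \<Omega>"
  shows "cmod (K z w) / (N z * N w) = 1 / N (\<phi> z w)"
proof -
  have "ip \<sigma> (nkern \<sigma> K z) (nkern \<sigma> K w) = ip \<sigma> (K z) (K w) / (of_real (N z) * of_real (N w))"
    using ip_cmult_left[of \<sigma> "inverse (of_real (N z))" "K z" "\<lambda>v. inverse (of_real (N w)) * K w v"]
      ip_cmult_right[of \<sigma> "K z" "inverse (of_real (N w))" "K w"]
    by (simp add: nkern_def divide_inverse mult.commute)
  then have "cmod (ip \<sigma> (nkern \<sigma> K z) (nkern \<sigma> K w)) = cmod (K z w) / (N z * N w)"
    by (simp add: K_ip[OF assms, symmetric] norm_divide norm_mult)
  then show ?thesis using SB assms by (simp add: strong_bergman_type_def)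
qed

text \<open>Since \<open>\<phi> z z = 0\<close>, a vanishing \<open>N z\<close> would turn (A.5) at
  the pair \<open>z\<close>, \<open>z\<close> into \<open>0 = 1 / N 0\<close>.\<close>

lemma N_pos [simp]:
  assumes "z \<in> \<Omega>" shows "N z > 0"
proof (rule ccontr)
  assume "\<not> N z > 0"
  then have "N z = 0" using nrm_nonneg[of \<sigma> "K z"] by linarith
  then have "1 / N 0 = 0" using kernel_modulus_aux[OF assms assms] assms by simp
  then show False using nondegenerate by simp
qed

lemma N_nonzero [simp]: "z \<in> \<Omega> \<Longrightarrow> N z \<noteq> 0"
  by (metis N_pos less_irrefl)

lemma kernel_modulus: "z \<in> \<Omega> \<Longrightarrow> w \<in> \<Omega> \<Longrightarrow> cmod (K z w) = N z * N w / N (\<phi> z w)"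
  using kernel_modulus_aux[of z w] by (simp add: field_simps)

text \<open>At \<open>z = w = 0\<close> the left side of (A.5) is the squared norm of a unit vector,
  hence \<open>1 = 1 / N 0\<close>.\<close>

lemma N_zero [simp]: "N 0 = 1"
  using kernel_modulus_aux[of 0 0] K_diag[of 0] nondegenerate by (simp add: norm_mult power2_eq_square)

lemma K_nonzero: "z \<in> \<Omega> \<Longrightarrow> w \<in> \<Omega> \<Longrightarrow> K z w \<noteq> 0"
  using kernel_modulus[of z w] N_pos[of z] N_pos[of w] N_pos[of "\<phi> z w"] by (auto simp del: N_pos)

text \<open>By (A.5) and \<open>\<phi> v 0 = v\<close> the kernel at 0 has modulus one everywhere,
  so it is constant, with value \<open>(N 0)\<^sup>2\<close> at 0.\<close>

lemma K_zero_left [simp]: "w \<in> \<Omega> \<Longrightarrow> K 0 w = 1"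
proof -
  assume w: "w \<in> \<Omega>"
  have m: "cmod (K 0 v) = 1" if "v \<in> \<Omega>" for v
    using kernel_modulus[of v 0] K_sym[of v 0] that by simp
  have "K 0 w = K 0 0"
    by (rule holo_on_const_modulus[OF Bsp_holo[OF K_in[OF zero_in]] connected_dom m w zero_in])
  then show ?thesis using K_diag[of 0] by simp
qed

lemma K_zero_right [simp]: "z \<in> \<Omega> \<Longrightarrow> K z 0 = 1"
  using K_sym[of 0 z] by simp

lemma N_ge_1: "z \<in> \<Omega> \<Longrightarrow> N z \<ge> 1"
  using point_bound[OF K_in[of z], of 0] by simp

section \<open>Local boundedness of \<open>N\<close> and completeness\<close>

text \<open>\<open>N w\<close> is the supremum of \<open>cmod (f w)\<close> over the unit ball of
  \<open>B\<close>, attained at the normalised kernel. So the sets where \<open>N\<close> exceeds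
  \<open>n\<close> are open in the Euclidean topology. Their intersection is empty, hence by Baire
  one of them is not dense in a fixed closed ball and misses a smaller ball.\<close>

lemma N_locally_bounded_somewhere: "\<exists>z\<in>\<Omega>. \<exists>r>0. \<exists>M. ball z r \<subseteq> \<Omega> \<and> (\<forall>w\<in>ball z r. N w \<le> M)"
proof -
  define V where "V = (\<lambda>n::nat. {w \<in> \<Omega>. N w > real n})"
  have V_eq: "V n = (\<Union>f\<in>{f \<in> B. nm f \<le> 1}. {w \<in> \<Omega>. cmod (f w) > real n})" for n
  proof (intro subset_antisym subsetI)
    fix w assume w: "w \<in> V n"
    then have w': "w \<in> \<Omega>" by (simp add: V_def)
    have "cmod ((\<lambda>v. inverse (of_real (N w)) * K w v) w) = N w"
      using w' K_diag[OF w'] by (simp add: norm_mult norm_inverse norm_power power2_eq_square field_simps)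
    moreover have "nm (\<lambda>v. inverse (of_real (N w)) * K w v) = 1"
      using w' by (simp add: nrm_cmult norm_inverse)
    ultimately show "w \<in> (\<Union>f\<in>{f \<in> B. nm f \<le> 1}. {w \<in> \<Omega>. cmod (f w) > real n})"
      using w Bsp_cmult[OF K_in[OF w']] unfolding V_def
      by (auto intro!: exI[of _ "\<lambda>v. inverse (of_real (N w)) * K w v"])
  next
    fix w assume "w \<in> (\<Union>f\<in>{f \<in> B. nm f \<le> 1}. {w \<in> \<Omega>. cmod (f w) > real n})"
    then obtain f where f: "f \<in> B" "nm f \<le> 1" "w \<in> \<Omega>" "cmod (f w) > real n" by auto
    have "cmod (f w) \<le> 1 * N w"
      using point_bound[OF f(1,3)] mult_right_mono[OF f(2), of "N w"] by simp
    then show "w \<in> V n" using f by (simp add: V_def)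
  qed
  have Vo: "open (V n)" for n
    unfolding V_eq
  proof (intro open_UN ballI)
    fix f assume "f \<in> {f \<in> B. nm f \<le> 1}"
    then have "continuous_on \<Omega> (\<lambda>w. cmod (f w))"
      by (intro continuous_intros B_cont) auto
    then have "open ((\<lambda>w. cmod (f w)) -` {real n<..} \<inter> \<Omega>)"
      by (simp add: continuous_on_open_vimage[OF open_dom])
    moreover have "(\<lambda>w. cmod (f w)) -` {real n<..} \<inter> \<Omega> = {w \<in> \<Omega>. real n < cmod (f w)}" by auto
    ultimately show "open {w \<in> \<Omega>. real n < cmod (f w)}" by simp
  qed
  obtain r0 where r0: "r0 > 0" "cball 0 r0 \<subseteq> \<Omega>"
    using open_dom zero_in open_contains_cball by blast
  define S where "S = cball (0::'n pt) r0"
  have "\<exists>n. \<not> S \<subseteq> closure (S \<inter> V n)"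
  proof (rule ccontr)
    assume "\<nexists>n. \<not> S \<subseteq> closure (S \<inter> V n)"
    then have "S \<subseteq> closure (\<Inter>(range (\<lambda>n. S \<inter> V n)))"
      by (intro Baire) (auto simp: S_def Vo openin_open_Int)
    moreover have "(\<Inter>(range (\<lambda>n. S \<inter> V n))) = {}"
    proof (rule equals0I)
      fix w assume "w \<in> (\<Inter>(range (\<lambda>n. S \<inter> V n)))"
      then have "N w > real n" for n by (auto simp: V_def)
      moreover obtain n where "N w \<le> real n" using real_arch_simple by blast
      ultimately show False by (meson not_less)
    qed
    ultimately show False using r0 by (simp add: S_def)
  qed
  then obtain n x where x: "x \<in> S" "x \<notin> closure (S \<inter> V n)" by blast
  then obtain e where e: "e > 0" "\<And>y. y \<in> S \<inter> V n \<Longrightarrow> dist y x \<ge> e"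
    unfolding closure_approachable by (meson not_less)
  have "x \<in> closure (ball 0 r0)" using x(1) r0 by (simp add: S_def)
  then obtain y where y: "y \<in> ball 0 r0" "dist y x < e" using e(1) closure_approachable by blast
  then have "y \<in> ball 0 r0 \<inter> ball x e" by (simp add: dist_commute)
  then obtain r where r: "r > 0" "ball y r \<subseteq> ball 0 r0 \<inter> ball x e"
    using open_contains_ball[of "ball 0 r0 \<inter> ball x e"] by blast
  have sub: "ball y r \<subseteq> \<Omega>" using r(2) r0(2) ball_subset_cball[of 0 r0] by blast
  have "N w \<le> real n" if "w \<in> ball y r" for w
  proof (rule ccontr)
    assume "\<not> N w \<le> real n"
    then have "w \<in> S \<inter> V n" using that r(2) sub by (auto simp: V_def S_def)
    moreover have "w \<in> ball x e" using that r(2) by blast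
    ultimately show False using e(2)[of w] by (auto simp: dist_commute)
  qed
  moreover have "y \<in> \<Omega>" using sub r(1) by auto
  ultimately show ?thesis using sub r(1) by blast
qed

text \<open>For \<open>y = \<phi> z u\<close> the kernel formula reads
  \<open>N y = N z * N u / cmod (K z u)\<close>. The continuous function \<open>K z\<close> has no
  zero, so the denominator is bounded below near \<open>w\<close>.\<close>

lemma N_locally_bounded_phi:
  assumes z: "z \<in> \<Omega>" and w: "w \<in> \<Omega>" and r: "r > 0" "ball w r \<subseteq> \<Omega>" "\<And>u. u \<in> ball w r \<Longrightarrow> N u \<le> M"
  shows "\<exists>r>0. \<exists>M. ball (\<phi> z w) r \<subseteq> \<Omega> \<and> (\<forall>u\<in>ball (\<phi> z w) r. N u \<le> M)"
proof -
  define c where "c = cmod (K z w) / 2"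
  have c: "c > 0" using K_nonzero[OF z w] by (simp add: c_def)
  have "continuous_on \<Omega> (\<lambda>u. cmod (K z u))"
    by (intro continuous_intros B_cont K_in z)
  then have oA: "open ((\<lambda>u. cmod (K z u)) -` {c<..} \<inter> \<Omega>)"
    by (simp add: continuous_on_open_vimage[OF open_dom])
  define A where "A = ((\<lambda>u. cmod (K z u)) -` {c<..} \<inter> \<Omega>) \<inter> ball w r"
  have "open A" using oA by (auto simp: A_def)
  then have "open (\<phi> z -` A \<inter> \<Omega>)"
    using phi_cont[OF z] by (simp add: continuous_on_open_vimage[OF open_dom])
  moreover have "\<phi> z w \<in> \<phi> z -` A \<inter> \<Omega>"
    using z w r c K_nonzero[OF z w] by (simp add: A_def c_def)
  ultimately obtain s where s: "s > 0" "ball (\<phi> z w) s \<subseteq> \<phi> z -` A \<inter> \<Omega>"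
    by (meson open_contains_ball)
  have "N y \<le> N z * M / c" if "y \<in> ball (\<phi> z w) s" for y
  proof -
    define u where "u = \<phi> z y"
    have y: "y \<in> \<Omega>" "u \<in> A" using s(2) that by (auto simp: u_def)
    then have u: "u \<in> \<Omega>" "cmod (K z u) > c" "N u \<le> M" "\<phi> z u = y"
      using r(3) z by (auto simp: A_def u_def)
    have "N y = N z * N u / cmod (K z u)"
      using kernel_modulus[OF z u(1)] K_nonzero[OF z u(1)] u y by (simp add: field_simps)
    also have "\<dots> \<le> N z * M / c"
      using u c z order_trans[OF nrm_nonneg u(3)] by (intro frac_le mult_left_mono mult_nonneg_nonneg) auto
    finally show ?thesis .
  qed
  then show ?thesis using s by blast
qed

text \<open>Two transports: from the point \<open>a\<close> found by Baire to
  \<open>\<phi> a a = 0\<close>, and from 0 to \<open>\<phi> z 0 = z\<close>.\<close>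

lemma N_locally_bounded:
  assumes "z \<in> \<Omega>"
  obtains r M where "r > 0" "ball z r \<subseteq> \<Omega>" "\<And>w. w \<in> ball z r \<Longrightarrow> N w \<le> M"
proof -
  obtain a r M where a: "a \<in> \<Omega>" "r > 0" "ball a r \<subseteq> \<Omega>" "\<And>w. w \<in> ball a r \<Longrightarrow> N w \<le> M"
    using N_locally_bounded_somewhere by blast
  obtain r M where r: "r > 0" "ball 0 r \<subseteq> \<Omega>" "\<And>w. w \<in> ball 0 r \<Longrightarrow> N w \<le> M"
    using N_locally_bounded_phi[OF a(1) a] unfolding phi_self[OF a(1)] by blast
  show ?thesis
    using N_locally_bounded_phi[OF assms zero_in r] that unfolding phi_zero[OF assms] by blast
qed

text \<open>The kernel bound makes the sequence Cauchy at each point, Fatou puts the tails of the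
  differences into L2 with small norm, and the Euclidean local bound on \<open>N\<close> makes
  convergence locally uniform, hence the limit holomorphic.\<close>

lemma B_complete:
  assumes f: "\<And>n. f n \<in> B"
    and cauchy: "\<And>e. e > 0 \<Longrightarrow> \<exists>M. \<forall>m\<ge>M. \<forall>n\<ge>M. nm (\<lambda>w. f m w - f n w) \<le> e"
  obtains g where "g \<in> B" "(\<lambda>n. nm (\<lambda>w. f n w - g w)) \<longlonglongrightarrow> 0"
proof -
  have diff_bound: "cmod (f m w - f n w) \<le> nm (\<lambda>w. f m w - f n w) * N w" if "w \<in> \<Omega>" for m n w
    using point_bound[OF Bsp_diff[OF f f], of w m n] that by simp
  have "\<exists>l. (\<lambda>n. f n w) \<longlonglongrightarrow> l" for w
  proof (cases "w \<in> \<Omega>")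
    case True
    show ?thesis unfolding convergent_eq_Cauchy
    proof (rule CauchyI)
      fix e :: real assume "e > 0"
      then have "e / (2 * N w) > 0" using True by simp
      from cauchy[OF this] obtain M where M: "\<forall>m\<ge>M. \<forall>n\<ge>M. nm (\<lambda>w. f m w - f n w) \<le> e / (2 * N w)" by blast
      have "cmod (f m w - f n w) < e" if "m \<ge> M" "n \<ge> M" for m n
      proof -
        have "cmod (f m w - f n w) \<le> e / (2 * N w) * N w"
          using diff_bound[OF True, of m n] M that True
          by (meson N_pos less_imp_le mult_right_mono order_trans)
        also have "\<dots> < e" using True \<open>e > 0\<close> by simp
        finally show ?thesis .
      qed
      then show "\<exists>M. \<forall>m\<ge>M. \<forall>n\<ge>M. norm (f m w - f n w) < e" by blast
    qed
  next
    case False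
    then show ?thesis using B_outside[OF f] by (auto intro!: exI[of _ 0])
  qed
  then obtain g where g: "\<And>w. (\<lambda>n. f n w) \<longlonglongrightarrow> g w" by metis
  have tail: "\<exists>M. \<forall>n\<ge>M. (\<lambda>w. f n w - g w) \<in> H \<and> nm (\<lambda>w. f n w - g w) \<le> e" if e: "e > 0" for e
  proof -
    obtain M where M: "\<forall>m\<ge>M. \<forall>n\<ge>M. nm (\<lambda>w. f m w - f n w) \<le> e" using cauchy[OF e] by blast
    have "(\<lambda>w. f n w - g w) \<in> H \<and> nm (\<lambda>w. f n w - g w) \<le> e" if "n \<ge> M" for n
    proof -
      have ev: "\<forall>\<^sub>F m in sequentially. nm (\<lambda>w. f n w - f m w) \<le> e"
        using M that by (auto simp: eventually_sequentially)
      show ?thesis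
        using L2_Fatou[where f = "\<lambda>m w. f n w - f m w" and g = "\<lambda>w. f n w - g w", OF L2_diff[OF Bsp_L2[OF f] Bsp_L2[OF f]] _ ev]
        using \<open>e > 0\<close> tendsto_diff[OF tendsto_const g] by auto
    qed
    then show ?thesis by blast
  qed
  have gH: "g \<in> H"
  proof -
    obtain M where "\<forall>n\<ge>M. (\<lambda>w. f n w - g w) \<in> H" using tail[of 1] by auto
    then have "(\<lambda>w. f M w - g w) \<in> H" by simp
    from L2_diff[OF Bsp_L2[OF f[of M]] this] show ?thesis by simp
  qed
  have "holo_on \<Omega> g"
  proof (rule holo_on_locally_uniform_limit[OF Bsp_holo[OF f] open_dom])
    fix z assume "z \<in> \<Omega>"
    then obtain r M where r: "r > 0" "ball z r \<subseteq> \<Omega>" "\<And>w. w \<in> ball z r \<Longrightarrow> N w \<le> M"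
      using N_locally_bounded by blast
    have M: "M > 0" using r(3)[of z] N_pos[OF \<open>z \<in> \<Omega>\<close>] r(1) by (simp del: N_pos)
    have "uniform_limit (ball z r) f g sequentially"
      unfolding uniform_limit_sequentially_iff
    proof (intro allI impI)
      fix e :: real assume "e > 0"
      then have "e / (2 * M) > 0" using M by simp
      from cauchy[OF this] obtain n0 where n0: "\<forall>m\<ge>n0. \<forall>n\<ge>n0. nm (\<lambda>w. f m w - f n w) \<le> e / (2 * M)" by blast
      have "cmod (f n w - g w) \<le> e / 2" if n: "n \<ge> n0" and w: "w \<in> ball z r" for n w
      proof (rule tendsto_upperbound)
        show "(\<lambda>m. cmod (f n w - f m w)) \<longlonglongrightarrow> cmod (f n w - g w)"
          by (intro tendsto_intros g)
        have "cmod (f n w - f m w) \<le> e / 2" if "m \<ge> n0" for m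
        proof -
          have "cmod (f n w - f m w) \<le> e / (2 * M) * M"
            using diff_bound[of w n m] n0 n that w r(2) r(3)[OF w] \<open>e / (2 * M) > 0\<close>
            by (meson less_imp_le mult_mono nrm_nonneg order_trans subsetD)
          then show ?thesis using M by simp
        qed
        then show "\<forall>\<^sub>F m in sequentially. cmod (f n w - f m w) \<le> e / 2"
          by (auto simp: eventually_sequentially)
      qed auto
      then show "\<exists>n0. \<forall>n\<ge>n0. \<forall>x\<in>ball z r. dist (f n x) (g x) < e"
        using \<open>e > 0\<close> by (intro exI[of _ n0]) (force simp: dist_norm)
    qed
    then show "\<exists>r>0. ball z r \<subseteq> \<Omega> \<and> uniform_limit (ball z r) f g sequentially"
      using r by blast
  qed
  with gH have "g \<in> B" by (simp add: Bsp_def)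
  moreover have "(\<lambda>n. nm (\<lambda>w. f n w - g w)) \<longlonglongrightarrow> 0"
  proof (rule LIMSEQ_I)
    fix e :: real assume "e > 0"
    then obtain M where "\<forall>n\<ge>M. nm (\<lambda>w. f n w - g w) \<le> e/2" using tail[of "e/2"] by auto
    then show "\<exists>M. \<forall>n\<ge>M. norm (nm (\<lambda>w. f n w - g w) - 0) < e"
      using \<open>e > 0\<close> by (intro exI[of _ M]) force
  qed
  ultimately show ?thesis using that by blast
qed

section \<open>Riesz representation and the orthogonal projection\<close>

lemma Riesz:
  fixes \<Lambda> :: "'n fn \<Rightarrow> complex"
  assumes add: "\<And>f g. f \<in> B \<Longrightarrow> g \<in> B \<Longrightarrow> \<Lambda> (\<lambda>w. f w + g w) = \<Lambda> f + \<Lambda> g"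
    and cmult: "\<And>c f. f \<in> B \<Longrightarrow> \<Lambda> (\<lambda>w. c * f w) = c * \<Lambda> f"
    and bd: "\<And>f. f \<in> B \<Longrightarrow> cmod (\<Lambda> f) \<le> C * nm f"
  obtains h where "h \<in> B" "\<And>f. f \<in> B \<Longrightarrow> \<Lambda> f = ip \<sigma> f h"
proof -
  \<comment> \<open>the representing vector minimises this functional\<close>
  define J where "J = (\<lambda>f. (nm f)\<^sup>2 - 2 * Re (\<Lambda> f))"
  have lower: "J f \<ge> - C\<^sup>2" if "f \<in> B" for f
  proof -
    have "Re (\<Lambda> f) \<le> C * nm f" using bd[OF that] complex_Re_le_cmod order_trans by blast
    moreover have "0 \<le> (nm f - C)\<^sup>2" by simp
    ultimately show ?thesis by (simp add: J_def power2_diff algebra_simps)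
  qed
  define m where "m = Inf (J ` B)"
  have bdd: "bdd_below (J ` B)" using lower by (auto intro!: bdd_belowI[of _ "- C\<^sup>2"])
  have m_le: "m \<le> J f" if "f \<in> B" for f
    unfolding m_def using bdd that by (intro cInf_lower) auto
  have "\<exists>f\<in>B. J f < m + 1 / real (Suc n)" for n
  proof -
    have "m < m + 1 / real (Suc n)" by simp
    then show ?thesis unfolding m_def
      using cInf_lessD[of "J ` B" "Inf (J ` B) + 1 / real (Suc n)"] B_zero by blast
  qed
  then obtain f where f: "\<And>n. f n \<in> B" "\<And>n. J (f n) < m + 1 / real (Suc n)" by metis
  \<comment> \<open>The midpoint of \<open>a\<close> and \<open>b\<close> has \<open>J\<close> at
    least \<open>m\<close>. With the parallelogram law this controls the distance of two
    near-minimisers and makes a minimising sequence Cauchy.\<close>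
  have par: "(nm (\<lambda>w. a w - b w))\<^sup>2 \<le> 2 * (J a - m) + 2 * (J b - m)" if ab: "a \<in> B" "b \<in> B" for a b
  proof -
    define c where "c = (\<lambda>w. 1/2 * (a w + b w))"
    have "c \<in> B" unfolding c_def using ab by (intro Bsp_cmult Bsp_add)
    moreover have "nm c = 1/2 * nm (\<lambda>w. a w + b w)"
      unfolding c_def by (subst nrm_cmult) simp
    moreover have "\<Lambda> c = 1/2 * (\<Lambda> a + \<Lambda> b)"
      unfolding c_def cmult[OF Bsp_add[OF ab]] add[OF ab] ..
    ultimately have "m \<le> (1/2 * nm (\<lambda>w. a w + b w))\<^sup>2 - 2 * Re (1/2 * (\<Lambda> a + \<Lambda> b))"
      using m_le[of c] unfolding J_def by metis
    then have "m \<le> (nm (\<lambda>w. a w + b w))\<^sup>2 / 4 - Re (\<Lambda> a) - Re (\<Lambda> b)"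
      by (simp add: power_divide add_divide_distrib)
    then show ?thesis
      using nrm_parallelogram[OF Bsp_L2[OF ab(1)] Bsp_L2[OF ab(2)]] by (simp add: J_def)
  qed
  obtain h where h: "h \<in> B" "(\<lambda>n. nm (\<lambda>w. f n w - h w)) \<longlonglongrightarrow> 0"
  proof (rule B_complete[OF f(1)])
    fix e :: real assume e: "e > 0"
    then have "e\<^sup>2 / 4 > 0" by simp
    from reals_Archimedean[OF this] obtain M where M: "1 / real (Suc M) < e\<^sup>2 / 4"
      unfolding inverse_eq_divide by blast
    have "nm (\<lambda>w. f k w - f n w) \<le> e" if "k \<ge> M" "n \<ge> M" for k n
    proof (rule power2_le_imp_le)
      have "1 / real (Suc k) \<le> 1 / real (Suc M)" "1 / real (Suc n) \<le> 1 / real (Suc M)"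
        using that by (auto simp: frac_le)
      then have "J (f k) - m \<le> e\<^sup>2 / 4" "J (f n) - m \<le> e\<^sup>2 / 4"
        using f(2)[of k] f(2)[of n] M by argo+
      then show "(nm (\<lambda>w. f k w - f n w))\<^sup>2 \<le> e\<^sup>2"
        using par[OF f(1) f(1), of k n] by argo
    qed (use e in simp)
    then show "\<exists>M. \<forall>m\<ge>M. \<forall>n\<ge>M. nm (\<lambda>w. f m w - f n w) \<le> e" by blast
  qed auto
  have min: "J h \<le> m"
  proof -
    have "J h \<le> J (f n) + 2 * (nm h + C) * nm (\<lambda>w. f n w - h w)" for n
    proof -
      let ?g = "\<lambda>w. f n w - h w"
      have g: "?g \<in> B" by (intro Bsp_diff f h)
      have "(nm (f n))\<^sup>2 = (nm h)\<^sup>2 + (nm ?g)\<^sup>2 + 2 * Re (ip \<sigma> h ?g)"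
        using nrm_add_power2[OF Bsp_L2[OF h(1)] Bsp_L2[OF g]] by simp
      moreover have "Re (\<Lambda> (f n)) = Re (\<Lambda> h) + Re (\<Lambda> ?g)" using add[OF h(1) g] by simp
      moreover have "- Re (ip \<sigma> h ?g) \<le> nm h * nm ?g"
        using ip_Cauchy_Schwarz[OF Bsp_L2[OF h(1)] Bsp_L2[OF g]] abs_Re_le_cmod[of "ip \<sigma> h ?g"] by linarith
      moreover have "Re (\<Lambda> ?g) \<le> C * nm ?g"
        using bd[OF g] complex_Re_le_cmod[of "\<Lambda> ?g"] by linarith
      moreover have "0 \<le> (nm ?g)\<^sup>2" by simp
      moreover have "2 * (nm h + C) * nm ?g = 2 * (nm h * nm ?g) + 2 * (C * nm ?g)"
        by (simp add: algebra_simps)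
      ultimately show ?thesis unfolding J_def by argo
    qed
    then have le: "J h \<le> m + 1 / real (Suc n) + 2 * (nm h + C) * nm (\<lambda>w. f n w - h w)" for n
      using f(2)[of n] by (meson add_right_mono less_imp_le order_trans)
    have "(\<lambda>n. m + 1 / real (Suc n) + 2 * (nm h + C) * nm (\<lambda>w. f n w - h w)) \<longlonglongrightarrow> m + 0 + 2 * (nm h + C) * 0"
      by (intro tendsto_intros h(2)) (use LIMSEQ_inverse_real_of_nat in \<open>simp add: divide_inverse\<close>)
    then show ?thesis by (intro LIMSEQ_le_const[of _ m]) (use le in auto)
  qed
  have re: "Re (\<Lambda> g) = Re (ip \<sigma> g h)" if g: "g \<in> B" for g
  proof -
    have "0 \<le> t * (2 * (Re (ip \<sigma> g h) - Re (\<Lambda> g)) + t * (nm g)\<^sup>2)" for t :: real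
    proof -
      have tg: "(\<lambda>w. of_real t * g w) \<in> B" by (rule Bsp_cmult[OF g])
      have "J h \<le> J (\<lambda>w. h w + of_real t * g w)"
        using min m_le[OF Bsp_add[OF h(1) tg]] by linarith
      then show ?thesis
        using nrm_add_power2[OF Bsp_L2[OF h(1)] Bsp_L2[OF tg]] add[OF h(1) tg] cmult[OF g, of "of_real t"]
          ip_commute[of \<sigma> h g]
        by (simp add: J_def nrm_cmult ip_cmult_right power_mult_distrib algebra_simps power2_eq_square)
    qed
    note q = this
    show ?thesis
    proof (rule ccontr)
      define a where "a = 2 * (Re (ip \<sigma> g h) - Re (\<Lambda> g))"
      define b where "b = (nm g)\<^sup>2"
      assume "Re (\<Lambda> g) \<noteq> Re (ip \<sigma> g h)"
      then have "a \<noteq> 0" by (simp add: a_def)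
      have "0 \<le> b" by (simp add: b_def)
      \<comment> \<open>The first variation is \<open>t * (a + t * b)\<close>. At
        \<open>t = - a / (b + 1)\<close> it is strictly negative; the \<open>+ 1\<close> keeps the
        quotient meaningful when \<open>b = 0\<close>.\<close>
      have "0 \<le> (- a / (b + 1)) * (a + (- a / (b + 1)) * b)" using q[of "- a / (b + 1)"] by (simp add: a_def b_def)
      also have "\<dots> = - (a\<^sup>2 / (b + 1)\<^sup>2)" using \<open>0 \<le> b\<close> by (simp add: field_simps power2_eq_square)
      also have "\<dots> < 0" using \<open>a \<noteq> 0\<close> \<open>0 \<le> b\<close> by simp
      finally show False by simp
    qed
  qed
  \<comment> \<open>Minimality yields only real parts; the imaginary part is the real part at \<i>
    times \<open>g\<close>.\<close>
  have "\<Lambda> g = ip \<sigma> g h" if g: "g \<in> B" for g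
    using re[OF g] re[OF Bsp_cmult[OF g, of "\<i>"]] cmult[OF g, of "\<i>"]
    by (simp add: complex_eq_iff ip_cmult_left)
  with h(1) show ?thesis using that by blast
qed

lemma B_ip_eqI:
  assumes "f \<in> B" "g \<in> B" "\<And>h. h \<in> B \<Longrightarrow> ip \<sigma> f h = ip \<sigma> g h"
  shows "f = g"
proof
  fix w show "f w = g w"
    using assms reproducing[of f w] reproducing[of g w] K_in[of w] B_outside[of f w] B_outside[of g w]
    by (cases "w \<in> \<Omega>") auto
qed

text \<open>\<open>proj\<close> is a definite description, so nothing can be said about it before
  existence and uniqueness are known. Existence is Riesz for
  \<open>f \<mapsto> ip \<sigma> f g\<close>.\<close>

lemma proj_exists:
  assumes g: "g \<in> H"
  shows "\<exists>!h. h \<in> B \<and> (\<forall>f\<in>B. ip \<sigma> (\<lambda>w. g w - h w) f = 0)"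
proof -
  obtain h where h: "h \<in> B" "\<And>f. f \<in> B \<Longrightarrow> ip \<sigma> f g = ip \<sigma> f h"
  proof (rule Riesz[of "\<lambda>f. ip \<sigma> f g" "nm g"])
    fix f assume f: "f \<in> B"
    show "ip \<sigma> (\<lambda>w. f w + f' w) g = ip \<sigma> f g + ip \<sigma> f' g" if "f' \<in> B" for f'
      by (rule ip_add_left[OF Bsp_L2[OF f] Bsp_L2[OF that] g])
    show "ip \<sigma> (\<lambda>w. c * f w) g = c * ip \<sigma> f g" for c
      by (rule ip_cmult_left)
    show "cmod (ip \<sigma> f g) \<le> nm g * nm f"
      using ip_Cauchy_Schwarz[OF Bsp_L2[OF f] g] by (simp add: mult.commute)
  qed blast
  have "ip \<sigma> (\<lambda>w. g w - h w) f = 0" if "f \<in> B" for f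
    using h(2)[OF that] ip_diff_left[OF g Bsp_L2[OF h(1)] Bsp_L2[OF that]] by (metis ip_commute right_minus_eq)
  moreover have "h' = h" if h': "h' \<in> B" "\<forall>f\<in>B. ip \<sigma> (\<lambda>w. g w - h' w) f = 0" for h'
  proof (rule B_ip_eqI[OF h'(1) h(1)])
    fix f assume f: "f \<in> B"
    then have "ip \<sigma> g f = ip \<sigma> h' f"
      using h'(2) ip_diff_left[OF g Bsp_L2[OF h'(1)] Bsp_L2[OF f]] by simp
    then show "ip \<sigma> h' f = ip \<sigma> h f" using h(2)[OF f] by (metis ip_commute)
  qed
  ultimately show ?thesis using h(1) by blast
qed

lemma P_in: "g \<in> H \<Longrightarrow> P g \<in> B"
  and P_orth: "g \<in> H \<Longrightarrow> f \<in> B \<Longrightarrow> ip \<sigma> (\<lambda>w. g w - P g w) f = 0"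
  using theI'[OF proj_exists] by (auto simp: proj_def)

lemma P_L2: "g \<in> H \<Longrightarrow> P g \<in> H"
  by (rule Bsp_L2[OF P_in])

lemma P_ip: "g \<in> H \<Longrightarrow> f \<in> B \<Longrightarrow> ip \<sigma> (P g) f = ip \<sigma> g f"
  using P_orth[of g f] ip_diff_left[of g \<Omega> \<sigma> "P g" f] by (simp add: P_L2 Bsp_L2)

lemma P_eqI:
  assumes "g \<in> H" "h \<in> B" "\<And>f. f \<in> B \<Longrightarrow> ip \<sigma> h f = ip \<sigma> g f"
  shows "P g = h"
  by (rule B_ip_eqI) (use assms in \<open>auto simp: P_in P_ip\<close>)

lemma P_value: "g \<in> H \<Longrightarrow> z \<in> \<Omega> \<Longrightarrow> P g z = ip \<sigma> g (K z)"
  using reproducing[OF P_in] P_ip K_in by metis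

lemma P_id: "f \<in> B \<Longrightarrow> P f = f"
  by (rule P_eqI) (auto simp: Bsp_L2)

lemma P_add: "f \<in> H \<Longrightarrow> g \<in> H \<Longrightarrow> P (\<lambda>w. f w + g w) = (\<lambda>w. P f w + P g w)"
  by (rule P_eqI) (auto intro!: L2_add Bsp_add P_in simp: P_ip ip_add_left[of _ \<Omega>] P_L2 Bsp_L2)

lemma P_diff: "f \<in> H \<Longrightarrow> g \<in> H \<Longrightarrow> P (\<lambda>w. f w - g w) = (\<lambda>w. P f w - P g w)"
  by (rule P_eqI) (auto intro!: L2_diff Bsp_diff P_in simp: P_ip ip_diff_left[of _ \<Omega>] P_L2 Bsp_L2)

lemma P_cmult: "f \<in> H \<Longrightarrow> P (\<lambda>w. c * f w) = (\<lambda>w. c * P f w)"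
  by (rule P_eqI) (auto intro!: L2_cmult Bsp_cmult P_in simp: P_ip ip_cmult_left)

lemma P_nrm: "g \<in> H \<Longrightarrow> nm (P g) \<le> nm g"
proof -
  assume g: "g \<in> H"
  have "complex_of_real ((nm (P g))\<^sup>2) = ip \<sigma> g (P g)"
    unfolding ip_self[symmetric] by (rule P_ip[OF g P_in[OF g]])
  then have "(nm (P g))\<^sup>2 = cmod (ip \<sigma> g (P g))"
    by (metis abs_of_nonneg norm_of_real zero_le_power2)
  also have "\<dots> \<le> nm g * nm (P g)" by (rule ip_Cauchy_Schwarz[OF g P_L2[OF g]])
  finally have le: "nm (P g) * nm (P g) \<le> nm g * nm (P g)" by (simp add: power2_eq_square)
  show ?thesis
  proof (cases "nm (P g) = 0")
    case False
    then have "nm (P g) > 0" using nrm_nonneg[of \<sigma> "P g"] by linarith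
    with le show ?thesis by simp
  qed simp
qed

end

subsection \<open>Automorphisms and the invariant measure\<close>

context bergman
begin

section \<open>Joint measurability of the kernel and the metric\<close>

text \<open>Near \<open>z0\<close> the functions \<open>K z\<close> share one Lipschitz constant at
  \<open>w0\<close>, thanks to the local bounds on \<open>N\<close>. Continuity in the first
  variable at fixed \<open>w0\<close> follows from conjugate symmetry. Joint continuity is what
  makes \<open>K\<close> measurable on the product space, as Tonelli requires.\<close>

lemma K_joint_cont: "continuous_on (\<Omega> \<times> \<Omega>) (\<lambda>p. K (fst p) (snd p))"
proof (rule continuous_at_imp_continuous_on, rule ballI)
  fix p assume "p \<in> \<Omega> \<times> \<Omega>"
  then obtain z0 w0 where p: "p = (z0, w0)" and z0: "z0 \<in> \<Omega>" and w0: "w0 \<in> \<Omega>" by auto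
  obtain r M where r: "r > 0" "ball z0 r \<subseteq> \<Omega>" "\<And>w. w \<in> ball z0 r \<Longrightarrow> N w \<le> M"
    using N_locally_bounded[OF z0] by blast
  obtain R M' where R: "R > 0" "ball w0 R \<subseteq> \<Omega>" "\<And>w. w \<in> ball w0 R \<Longrightarrow> N w \<le> M'"
    using N_locally_bounded[OF w0] by blast
  have M: "0 \<le> M" using r(3)[of z0] r(1) nrm_nonneg order_trans by (metis centre_in_ball)
  define C where "C = 2 * (M * M') / (R/2)"
  have lip: "cmod (K z w - K z w0) \<le> C * norm (w - w0)" if "z \<in> ball z0 r" "w \<in> ball w0 (R/2)" for z w
    unfolding C_def
  proof (rule holo_on_lipschitz[OF Bsp_holo[OF K_in]])
    show "z \<in> \<Omega>" using that r(2) by auto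
    show "ball w0 (2 * (R / 2)) \<subseteq> \<Omega>" using R by simp
    show "cmod (K z x) \<le> M * M'" if "x \<in> ball w0 (2 * (R / 2))" for x
    proof -
      have x: "x \<in> ball w0 R" "x \<in> \<Omega>" using that R(2) by auto
      have "cmod (K z x) \<le> N z * N x" using point_bound[OF K_in[OF \<open>z \<in> \<Omega>\<close>] x(2)] .
      also have "\<dots> \<le> M * M'" using r(3) \<open>z \<in> ball z0 r\<close> R(3)[OF x(1)] M by (intro mult_mono) auto
      finally show ?thesis .
    qed
  qed (use that R in auto)
  have cont0: "isCont (K w0) z0"
    using B_cont[OF K_in[OF w0]] z0 open_dom by (simp add: continuous_on_eq_continuous_at)
  have "((\<lambda>q. K (fst q) (snd q) - K z0 w0) \<longlongrightarrow> 0) (at (z0, w0))"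
  proof (rule Lim_null_comparison)
    have "open (ball z0 r \<times> ball w0 (R/2))" by (intro open_Times) auto
    moreover have "(z0, w0) \<in> ball z0 r \<times> ball w0 (R/2)" using r R by simp
    ultimately have "\<forall>\<^sub>F q in at (z0, w0). q \<in> ball z0 r \<times> ball w0 (R/2)"
      by (rule eventually_at_in_open')
    then show "\<forall>\<^sub>F q in at (z0, w0). norm (K (fst q) (snd q) - K z0 w0)
        \<le> C * norm (snd q - w0) + cmod (K w0 (fst q) - K w0 z0)"
    proof eventually_elim
      case (elim q)
      then obtain z w where q: "q = (z, w)" "z \<in> ball z0 r" "w \<in> ball w0 (R/2)" by auto
      have "z \<in> \<Omega>" using q r by auto
      have "cmod (K z w0 - K z0 w0) = cmod (cnj (K w0 z - K w0 z0))"
        using K_sym[of w0 z] K_sym[of w0 z0] \<open>z \<in> \<Omega>\<close> z0 w0 by simp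
      then show ?case
        using lip[OF q(2,3)] norm_triangle_ineq[of "K z w - K z w0" "K z w0 - K z0 w0"] q(1)
        by (simp only: complex_mod_cnj fst_conv snd_conv) simp
    qed
    have "((\<lambda>q. K w0 (fst q)) \<longlongrightarrow> K w0 z0) (at (z0, w0))"
      by (rule isCont_tendsto_compose[OF cont0]) (auto intro!: tendsto_eq_intros)
    then have "((\<lambda>q. C * norm (snd q - w0) + cmod (K w0 (fst q) - K w0 z0)) \<longlongrightarrow> C * norm (w0 - w0) + cmod (K w0 z0 - K w0 z0)) (at (z0, w0))"
      by (intro tendsto_intros) (auto intro!: tendsto_eq_intros)
    then show "((\<lambda>q. C * norm (snd q - w0) + cmod (K w0 (fst q) - K w0 z0)) \<longlongrightarrow> 0) (at (z0, w0))"
      by simp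
  qed
  then show "isCont (\<lambda>p. K (fst p) (snd p)) p"
    unfolding p isCont_def by (simp add: LIM_zero_iff)
qed

text \<open>Outside \<open>\<Omega>\<close> the functions \<open>K\<close>, \<open>d\<close> and \<open>\<phi>\<close> are arbitrary, possibly not measurable; the variants
  \<open>Kx\<close>, \<open>Nx\<close>, \<open>dx\<close>, \<open>phix\<close> are their Borel measurable modifications there.\<close>

definition Kx :: "'n pt \<Rightarrow> 'n pt \<Rightarrow> complex" where
  "Kx z w = (if z \<in> \<Omega> \<and> w \<in> \<Omega> then K z w else 0)"

definition Nx :: "'n pt \<Rightarrow> real" where
  "Nx z = (if z \<in> \<Omega> then N z else 0)"

lemma Kx_measurable [measurable]: "(\<lambda>p. Kx (fst p) (snd p)) \<in> borel_measurable (borel \<Otimes>\<^sub>M borel)"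
proof -
  have "(\<lambda>p. indicator (\<Omega> \<times> \<Omega>) p *\<^sub>R K (fst p) (snd p)) \<in> borel_measurable borel"
    by (intro borel_measurable_continuous_on_indicator K_joint_cont borel_open open_Times open_dom)
  moreover have "(\<lambda>p. indicator (\<Omega> \<times> \<Omega>) p *\<^sub>R K (fst p) (snd p)) = (\<lambda>p. Kx (fst p) (snd p))"
    by (auto simp: Kx_def fun_eq_iff indicator_def)
  ultimately show ?thesis by (simp add: borel_prod)
qed

lemma Kx_measurable2 [measurable (raw)]:
  assumes "f \<in> borel_measurable M" "g \<in> borel_measurable M"
  shows "(\<lambda>x. Kx (f x) (g x)) \<in> borel_measurable M"
  using measurable_compose[OF measurable_Pair[OF assms] Kx_measurable] by simp

lemma Nx_measurable [measurable]: "Nx \<in> borel_measurable borel"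
proof -
  have "Nx = (\<lambda>z. sqrt (cmod (Kx z z)))"
    using K_diag by (auto simp: Nx_def Kx_def fun_eq_iff norm_power)
  then show ?thesis by simp
qed

lemma dense_countable:
  obtains Q where "countable Q" "Q \<subseteq> \<Omega>" "\<And>x e. x \<in> \<Omega> \<Longrightarrow> e > 0 \<Longrightarrow> \<exists>q\<in>Q. d x q < e"
proof -
  have "separable_space Met.mtopology"
    using SB by (simp add: strong_bergman_type_def)
  then obtain Q where Q: "countable Q" "Q \<subseteq> \<Omega>" "Met.mtopology closure_of Q = \<Omega>"
    by (auto simp: separable_space_def)
  have "\<exists>q\<in>Q. d x q < e" if "x \<in> \<Omega>" "e > 0" for x e
  proof -
    have "x \<in> Met.mtopology closure_of Q" using Q(3) that by simp
    then show ?thesis using that by (auto simp: Met.metric_closure_of)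
  qed
  with Q that show ?thesis by blast
qed

lemma mball_borel: "z \<in> \<Omega> \<Longrightarrow> Met.mball z r \<in> sets borel"
  using SB by (simp add: strong_bergman_type_def)

definition dx :: "'n pt \<Rightarrow> 'n pt \<Rightarrow> real" where
  "dx y z = (if y \<in> \<Omega> \<and> z \<in> \<Omega> then d y z else 0)"

lemma dx_measurable: "(\<lambda>p. dx (fst p) (snd p)) \<in> borel_measurable (borel \<Otimes>\<^sub>M borel)"
  unfolding borel_measurable_iff_less
proof
  fix a :: real
  obtain Q where Q: "countable Q" "Q \<subseteq> \<Omega>" "\<And>x e. x \<in> \<Omega> \<Longrightarrow> e > 0 \<Longrightarrow> \<exists>q\<in>Q. d x q < e"
    using dense_countable by blast
  have eq: "{p \<in> \<Omega> \<times> \<Omega>. d (fst p) (snd p) < a} = (\<Union>q\<in>Q. \<Union>b\<in>\<rat>. Met.mball q b \<times> Met.mball q (a - b))"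
  proof (intro subset_antisym subsetI)
    fix p assume "p \<in> {p \<in> \<Omega> \<times> \<Omega>. d (fst p) (snd p) < a}"
    then obtain y z where p: "p = (y, z)" "y \<in> \<Omega>" "z \<in> \<Omega>" "d y z < a" by auto
    \<comment> \<open>A third of the slack: from \<open>d y q < b < e\<close> follows
      \<open>d q z < b + (a - 3 * b)\<close>, which is below \<open>a - b\<close>.\<close>
    define e where "e = (a - d y z) / 3"
    have e: "e > 0" using p by (simp add: e_def)
    obtain q where q: "q \<in> Q" "d y q < e" using Q(3)[OF p(2) e] by blast
    obtain b where b: "b \<in> \<rat>" "d y q < b" "b < e" using Rats_dense_in_real[OF q(2)] by blast
    have "q \<in> \<Omega>" using q Q by auto
    have "d q z \<le> d q y + d y z" using \<open>q \<in> \<Omega>\<close> p by (intro Met.triangle)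
    moreover have "0 < b" using b(2) Met.nonneg[of y q] by linarith
    moreover have "3 * b < a - d y z" using b(3) by (simp add: e_def)
    ultimately have "d q z < a - b" using b(2) Met.commute[of q y] by linarith
    then have "p \<in> Met.mball q b \<times> Met.mball q (a - b)"
      using p b \<open>q \<in> \<Omega>\<close> by (auto simp: Met.commute[of q y])
    then show "p \<in> (\<Union>q\<in>Q. \<Union>b\<in>\<rat>. Met.mball q b \<times> Met.mball q (a - b))" using q b by blast
  next
    fix p assume "p \<in> (\<Union>q\<in>Q. \<Union>b\<in>\<rat>. Met.mball q b \<times> Met.mball q (a - b))"
    then obtain q b y z where p: "p = (y, z)" "q \<in> \<Omega>" "y \<in> \<Omega>" "z \<in> \<Omega>" "d q y < b" "d q z < a - b" by auto
    have "d y z \<le> d y q + d q z" using p by (intro Met.triangle)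
    then show "p \<in> {p \<in> \<Omega> \<times> \<Omega>. d (fst p) (snd p) < a}" using p by (simp add: Met.commute[of y q])
  qed
  have S: "{p \<in> \<Omega> \<times> \<Omega>. d (fst p) (snd p) < a} \<in> sets (borel \<Otimes>\<^sub>M borel)"
    unfolding eq using Q countable_rat
    by (intro sets.countable_UN'' pair_measureI mball_borel) auto
  have "{p. dx (fst p) (snd p) < a} = {p \<in> \<Omega> \<times> \<Omega>. d (fst p) (snd p) < a} \<union> (if a > 0 then - (\<Omega> \<times> \<Omega>) else {})"
    by (auto simp: dx_def)
  moreover have "- (\<Omega> \<times> \<Omega>) \<in> sets (borel \<Otimes>\<^sub>M borel)"
    using sets.compl_sets[OF pair_measureI[OF dom_sets dom_sets]] by (simp add: space_pair_measure Compl_eq_Diff_UNIV)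
  ultimately show "{p \<in> space (borel \<Otimes>\<^sub>M borel). dx (fst p) (snd p) < a} \<in> sets (borel \<Otimes>\<^sub>M borel)"
    using S by (simp add: space_pair_measure)
qed

lemma dx_measurable2 [measurable (raw)]:
  assumes "f \<in> borel_measurable M" "g \<in> borel_measurable M"
  shows "(\<lambda>x. dx (f x) (g x)) \<in> borel_measurable M"
  using measurable_compose[OF measurable_Pair[OF assms] dx_measurable] by simp

section \<open>The invariant measure\<close>

lemma lm_density: "lm = density \<sigma> (\<lambda>z. ennreal ((Nx z)\<^sup>2))"
  unfolding lam_def density_def
  by (rule arg_cong[where f = "measure_of _ _"], rule ext, rule nn_integral_cong_AE)
     (use AE_dom in \<open>auto simp: Nx_def\<close>)

lemma sets_lm [measurable_cong, simp]: "sets lm = sets borel"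
  by (simp add: lm_density)

lemma space_lm [simp]: "space lm = UNIV"
  by (simp add: lm_density)

lemma nn_integral_lm:
  "f \<in> borel_measurable borel \<Longrightarrow> (\<integral>\<^sup>+w. f w \<partial>lm) = (\<integral>\<^sup>+w. ennreal ((Nx w)\<^sup>2) * f w \<partial>\<sigma>)"
  unfolding lm_density by (rule nn_integral_density) measurable

lemma AE_lm_dom: "AE w in lm. w \<in> \<Omega>"
  unfolding lm_density by (subst AE_density) (use AE_dom in auto)

sublocale lm: sigma_finite_measure lm
  unfolding lm_density by (subst sigma_finite_iff_density_finite) auto

definition phix :: "'n pt \<Rightarrow> 'n pt \<Rightarrow> 'n pt" where
  "phix z w = (if w \<in> \<Omega> then \<phi> z w else w)"

lemma phix_measurable [measurable]: "z \<in> \<Omega> \<Longrightarrow> phix z \<in> borel_measurable borel"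
  unfolding phix_def by (intro borel_measurable_continuous_on_if phi_cont continuous_on_id dom_sets)

text \<open>On \<Omega> the map \<open>\<phi> z\<close> is its own inverse, so preimages are images
  and (A.4) becomes a statement about the image measure. In this form it gives a change of variables
  for integrals. Off \<Omega>, a null set, \<open>phix z\<close> is the identity.\<close>

lemma lm_phix: assumes z: "z \<in> \<Omega>" shows "distr lm borel (phix z) = lm"
proof (rule measure_eqI)
  fix A assume "A \<in> sets (distr lm borel (phix z))"
  then have A [measurable]: "A \<in> sets borel" by simp
  have [measurable]: "phix z \<in> borel_measurable borel" using z by simp
  have inv: "emeasure lm (\<phi> z ` E) = emeasure lm E" if "E \<in> sets borel" "E \<subseteq> \<Omega>" for E
    using SB z that by (simp add: strong_bergman_type_def)
  have "emeasure (distr lm borel (phix z)) A = emeasure lm (phix z -` A)"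
    by (subst emeasure_distr) auto
  also have "\<dots> = emeasure lm (phix z -` A \<inter> \<Omega>)"
    using AE_lm_dom by (intro emeasure_eq_AE) (auto simp: measurable_sets_borel[OF \<open>phix z \<in> borel_measurable borel\<close> A])
  also have "phix z -` A \<inter> \<Omega> = \<phi> z ` (A \<inter> \<Omega>)"
    using z by (force simp: phix_def image_iff)
  also have "emeasure lm (\<phi> z ` (A \<inter> \<Omega>)) = emeasure lm (A \<inter> \<Omega>)" by (rule inv) auto
  also have "\<dots> = emeasure lm A"
    using AE_lm_dom by (intro emeasure_eq_AE) auto
  finally show "emeasure (distr lm borel (phix z)) A = emeasure lm A" .
qed simp

lemma nn_integral_phi:
  assumes z: "z \<in> \<Omega>" and f [measurable]: "f \<in> borel_measurable borel"
  shows "(\<integral>\<^sup>+w. f (phix z w) \<partial>lm) = (\<integral>\<^sup>+w. f w \<partial>lm)"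
proof -
  have [measurable]: "phix z \<in> borel_measurable borel" using z by simp
  have "(\<integral>\<^sup>+w. f w \<partial>distr lm borel (phix z)) = (\<integral>\<^sup>+w. f (phix z w) \<partial>lm)"
    by (rule nn_integral_distr) auto
  then show ?thesis by (simp add: lm_phix[OF z])
qed

section \<open>The unitary operators \<open>U z\<close>\<close>

lemma phi_image: "z \<in> \<Omega> \<Longrightarrow> \<phi> z ` \<Omega> \<subseteq> \<Omega>"
  by auto

lemma nkern_in: "z \<in> \<Omega> \<Longrightarrow> nkern \<sigma> K z \<in> B"
  using Bsp_cmult[OF K_in, of z "inverse (of_real (N z))"] by (simp add: nkern_def divide_inverse mult.commute)

lemma nkern_modulus: "z \<in> \<Omega> \<Longrightarrow> w \<in> \<Omega> \<Longrightarrow> cmod (nkern \<sigma> K z w) = N w / N (\<phi> z w)"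
  using kernel_modulus[of z w] by (simp add: nkern_def norm_divide)

text \<open>The product is holomorphic in \<open>w\<close> and its modulus is
  \<open>N w / N (\<phi> z w)\<close> times the reciprocal, hence one; so it is constant, and at
  \<open>w = 0\<close> it equals 1. This cocycle identity makes \<open>U z\<close> an
  involution.\<close>

lemma nkern_phi:
  assumes z: "z \<in> \<Omega>" and w: "w \<in> \<Omega>"
  shows "nkern \<sigma> K z (\<phi> z w) * nkern \<sigma> K z w = 1"
proof -
  let ?c = "\<lambda>w. nkern \<sigma> K z (\<phi> z w) * nkern \<sigma> K z w"
  have "?c w = ?c 0"
  proof (rule holo_on_const_modulus[OF _ connected_dom _ w zero_in])
    show "holo_on \<Omega> ?c"
      using holo_on_mult[OF holo_on_compose[OF Bsp_holo[OF nkern_in[OF z]] phi_holo[OF z] phi_image[OF z]]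
          Bsp_holo[OF nkern_in[OF z]]] .
    show "cmod (?c v) = 1" if "v \<in> \<Omega>" for v
      using that z by (simp add: norm_mult nkern_modulus)
  qed
  also have "?c 0 = 1" using z by (simp add: nkern_def K_diag power2_eq_square)
  finally show ?thesis .
qed

lemma U_apply: "w \<in> \<Omega> \<Longrightarrow> U z f w = f (\<phi> z w) * nkern \<sigma> K z w"
  by (simp add: Uop_def)

lemma U_outside: "w \<notin> \<Omega> \<Longrightarrow> U z f w = 0"
  by (simp add: Uop_def)

lemma U_measurable:
  assumes z: "z \<in> \<Omega>" and [measurable]: "f \<in> borel_measurable \<sigma>"
  shows "U z f \<in> borel_measurable \<sigma>"
proof -
  have [measurable]: "f \<in> borel_measurable borel" "phix z \<in> borel_measurable borel" "nkern \<sigma> K z \<in> borel_measurable borel"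
    using z L2D(1)[OF Bsp_L2[OF nkern_in[OF z]]] assms(2) measurable_cong_sets[OF sets_sigma refl, of borel]
    by (blast, blast intro: phix_measurable, blast)
  have "U z f = (\<lambda>w. if w \<in> \<Omega> then f (phix z w) * nkern \<sigma> K z w else 0)"
    by (auto simp: Uop_def phix_def fun_eq_iff)
  also have "\<dots> \<in> borel_measurable \<sigma>" by measurable
  finally show ?thesis .
qed

lemma U_isometry:
  assumes z: "z \<in> \<Omega>" and f: "f \<in> H"
  shows "U z f \<in> H" "nm (U z f) = nm f"
proof -
  have fm [measurable]: "f \<in> borel_measurable borel"
    using L2D(1)[OF f] measurable_cong_sets[OF sets_sigma refl, of borel] by blast
  have [measurable]: "phix z \<in> borel_measurable borel" using z by simp
  define q where "q = (\<lambda>w. ennreal ((cmod (f w) / Nx w)\<^sup>2))"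
  have [measurable]: "q \<in> borel_measurable borel" unfolding q_def by measurable
  have "(\<integral>\<^sup>+w. ennreal ((cmod (U z f w))\<^sup>2) \<partial>\<sigma>) = (\<integral>\<^sup>+w. ennreal ((Nx w)\<^sup>2) * q (phix z w) \<partial>\<sigma>)"
  proof (rule nn_integral_cong)
    fix w
    show "ennreal ((cmod (U z f w))\<^sup>2) = ennreal ((Nx w)\<^sup>2) * q (phix z w)"
    proof (cases "w \<in> \<Omega>")
      case True
      then show ?thesis using z
        by (simp add: U_apply q_def phix_def Nx_def norm_mult nkern_modulus ennreal_mult'[symmetric]
            power_mult_distrib power_divide)
    next
      case False then show ?thesis by (simp add: U_outside Nx_def)
    qed
  qed
  also have "\<dots> = (\<integral>\<^sup>+w. q (phix z w) \<partial>lm)" by (rule nn_integral_lm[symmetric]) measurable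
  also have "\<dots> = (\<integral>\<^sup>+w. q w \<partial>lm)" by (rule nn_integral_phi[OF z]) measurable
  also have "\<dots> = (\<integral>\<^sup>+w. ennreal ((Nx w)\<^sup>2) * q w \<partial>\<sigma>)" by (rule nn_integral_lm) measurable
  also have "\<dots> = (\<integral>\<^sup>+w. ennreal ((cmod (f w))\<^sup>2) \<partial>\<sigma>)"
  proof (rule nn_integral_cong)
    fix w show "ennreal ((Nx w)\<^sup>2) * q w = ennreal ((cmod (f w))\<^sup>2)"
      using L2D(3)[OF f, of w] by (cases "w \<in> \<Omega>") (auto simp: q_def Nx_def ennreal_mult'[symmetric] power_divide)
  qed
  also have "\<dots> = ennreal ((nm f)\<^sup>2)" by (rule nn_integral_L2[OF f])
  finally have *: "(\<integral>\<^sup>+w. ennreal ((cmod (U z f w))\<^sup>2) \<partial>\<sigma>) = ennreal ((nm f)\<^sup>2)" .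
  show UH: "U z f \<in> H"
    using L2I_nn_integral(1)[OF U_measurable[OF z L2D(1)[OF f]] U_outside, of \<Omega> "nm f"] * by simp
  have "(nm (U z f))\<^sup>2 = (nm f)\<^sup>2"
    using * unfolding nn_integral_L2[OF UH] by simp
  then show "nm (U z f) = nm f" by (simp add: power2_eq_iff_nonneg)
qed

lemma U_in:
  assumes z: "z \<in> \<Omega>" and f: "f \<in> B"
  shows "U z f \<in> B"
proof -
  have "holo_on \<Omega> (\<lambda>w. f (\<phi> z w) * nkern \<sigma> K z w)"
    using holo_on_mult[OF holo_on_compose[OF Bsp_holo[OF f] phi_holo[OF z] phi_image[OF z]]
          Bsp_holo[OF nkern_in[OF z]]] .
  then have "holo_on \<Omega> (U z f)" by (rule holo_on_cong) (simp add: U_apply)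
  then show ?thesis using U_isometry(1)[OF z Bsp_L2[OF f]] by (simp add: Bsp_def)
qed

lemma U_U: "z \<in> \<Omega> \<Longrightarrow> f \<in> H \<Longrightarrow> U z (U z f) = f"
proof
  fix w assume z: "z \<in> \<Omega>" and f: "f \<in> H"
  show "U z (U z f) w = f w"
    using nkern_phi[OF z, of w] L2D(3)[OF f, of w] z
    by (cases "w \<in> \<Omega>") (auto simp: U_apply U_outside mult.assoc)
qed

lemma U_add: "U z (\<lambda>w. f w + g w) = (\<lambda>w. U z f w + U z g w)"
  and U_diff: "U z (\<lambda>w. f w - g w) = (\<lambda>w. U z f w - U z g w)"
  and U_cmult: "U z (\<lambda>w. c * f w) = (\<lambda>w. c * U z f w)"
  by (auto simp: Uop_def fun_eq_iff algebra_simps)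

lemma U_ip_ip:
  assumes z: "z \<in> \<Omega>" and f: "f \<in> H" and g: "g \<in> H"
  shows "ip \<sigma> (U z f) (U z g) = ip \<sigma> f g"
proof -
  have re: "Re (ip \<sigma> (U z a) (U z g)) = Re (ip \<sigma> a g)" if a: "a \<in> H" for a
    using nrm_add_power2[OF a g] nrm_add_power2[OF U_isometry(1)[OF z a] U_isometry(1)[OF z g]]
      U_isometry(2)[OF z L2_add[OF a g]] U_isometry(2)[OF z a] U_isometry(2)[OF z g]
    by (simp add: U_add)
  show ?thesis
    using re[OF f] re[OF L2_cmult[OF f, of "\<i>"]]
    by (simp add: complex_eq_iff ip_cmult_left U_cmult)
qed

lemma U_ip:
  assumes z: "z \<in> \<Omega>" and f: "f \<in> H" and g: "g \<in> H"
  shows "ip \<sigma> (U z f) g = ip \<sigma> f (U z g)"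
  using U_ip_ip[OF z f U_isometry(1)[OF z g]] by (simp add: U_U[OF z g])

text \<open>A self-adjoint operator that preserves \<open>B\<close> commutes with the projection
  onto \<open>B\<close>.\<close>

lemma U_P:
  assumes z: "z \<in> \<Omega>" and g: "g \<in> H"
  shows "U z (P g) = P (U z g)"
  by (rule P_eqI[symmetric])
     (use z g in \<open>auto simp: U_ip P_ip U_isometry U_in P_in P_L2 Bsp_L2\<close>)

lemma adj_U:
  assumes z: "z \<in> \<Omega>" and g: "g \<in> B"
  shows "adj \<Omega> \<sigma> (U z) g = U z g"
  unfolding adj_def
proof (rule the_equality)
  show "U z g \<in> B \<and> (\<forall>f\<in>B. ip \<sigma> (U z f) g = ip \<sigma> f (U z g))"
    using z g by (auto simp: U_in U_ip Bsp_L2)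
  fix h assume h: "h \<in> B \<and> (\<forall>f\<in>B. ip \<sigma> (U z f) g = ip \<sigma> f h)"
  show "h = U z g"
  proof (rule B_ip_eqI)
    show "ip \<sigma> h f = ip \<sigma> (U z g) f" if f: "f \<in> B" for f
    proof -
      have "ip \<sigma> f h = ip \<sigma> f (U z g)" using h f U_ip[OF z Bsp_L2[OF f] Bsp_L2[OF g]] by simp
      then show ?thesis by (metis ip_commute)
    qed
  qed (use h z g U_in in auto)
qed

lemma transl_eq: "z \<in> \<Omega> \<Longrightarrow> f \<in> B \<Longrightarrow> transl \<Omega> \<phi> \<sigma> K T z f = U z (T (U z f))"
  by (simp add: transl_def adj_U)

text \<open>Pair with \<open>f\<close>: moving \<open>U z\<close> to the other side gives the value
  of \<open>U z f\<close> at \<open>w\<close>, which is the value of \<open>f\<close> at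
  \<open>\<phi> z w\<close> times a factor.\<close>

lemma U_K:
  assumes z: "z \<in> \<Omega>" and w: "w \<in> \<Omega>"
  shows "U z (K w) = (\<lambda>v. cnj (nkern \<sigma> K z w) * K (\<phi> z w) v)"
proof (rule B_ip_eqI)
  fix f assume f: "f \<in> B"
  have "ip \<sigma> f (U z (K w)) = ip \<sigma> (U z f) (K w)"
    using U_ip[OF z Bsp_L2[OF f] K_L2[OF w]] by simp
  also have "\<dots> = U z f w" using reproducing[OF U_in[OF z f] w] by simp
  also have "\<dots> = nkern \<sigma> K z w * ip \<sigma> f (K (\<phi> z w))"
    using z w reproducing[OF f, of "\<phi> z w"] by (simp add: U_apply)
  also have "\<dots> = ip \<sigma> f (\<lambda>v. cnj (nkern \<sigma> K z w) * K (\<phi> z w) v)"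
    by (simp add: ip_cmult_right)
  finally show "ip \<sigma> (U z (K w)) f = ip \<sigma> (\<lambda>v. cnj (nkern \<sigma> K z w) * K (\<phi> z w) v) f"
    by (metis ip_commute)
qed (use z w in \<open>auto intro!: U_in K_in Bsp_cmult\<close>)

end

subsection \<open>Toeplitz operators and strong convergence of their translates\<close>

lemma eq_zero_if_le_epsilon:
  fixes x c :: real
  assumes "0 \<le> x" "\<And>e. e > 0 \<Longrightarrow> x \<le> e * c"
  shows "x = 0"
proof (rule ccontr)
  assume "x \<noteq> 0"
  then have x: "x > 0" using assms(1) by simp
  have "x \<le> x / (2 * (\<bar>c\<bar> + 1)) * c" using x by (intro assms(2)) simp
  also have "\<dots> \<le> x / (2 * (\<bar>c\<bar> + 1)) * (\<bar>c\<bar> + 1)" using x by (intro mult_left_mono) auto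
  also have "\<dots> = x / 2" using abs_ge_zero[of c] by (simp add: field_simps del: abs_ge_zero)
  finally show False using x by simp
qed

context bergman
begin

section \<open>Bounded linear operators on the Bergman space\<close>

text \<open>Operators act on arbitrary functions, but their values are meaningful only on
  \<open>B\<close>; hence linearity and the bound are relative to \<open>B\<close>. The bound is a
  parameter because it must be shared by all translates and their limit.\<close>

definition bop :: "'n op \<Rightarrow> real \<Rightarrow> bool" where
  "bop S C \<longleftrightarrow> C \<ge> 0 \<and> (\<forall>f\<in>B. S f \<in> B) \<and>
     (\<forall>f\<in>B. \<forall>g\<in>B. S (\<lambda>w. f w + g w) = (\<lambda>w. S f w + S g w)) \<and>
     (\<forall>c. \<forall>f\<in>B. S (\<lambda>w. c * f w) = (\<lambda>w. c * S f w)) \<and>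
     (\<forall>f\<in>B. nm (S f) \<le> C * nm f)"

lemma bopD:
  assumes "bop S C"
  shows "C \<ge> 0" "f \<in> B \<Longrightarrow> S f \<in> B"
    "f \<in> B \<Longrightarrow> g \<in> B \<Longrightarrow> S (\<lambda>w. f w + g w) = (\<lambda>w. S f w + S g w)"
    "f \<in> B \<Longrightarrow> S (\<lambda>w. c * f w) = (\<lambda>w. c * S f w)"
    "f \<in> B \<Longrightarrow> nm (S f) \<le> C * nm f"
  using assms by (auto simp: bop_def)

lemma bop_diff:
  assumes "bop S C" "f \<in> B" "g \<in> B"
  shows "S (\<lambda>w. f w - g w) = (\<lambda>w. S f w - S g w)"
  using bopD(3)[OF assms(1,2) Bsp_cmult[OF assms(3), of "- 1"]] bopD(4)[OF assms(1,3), of "- 1"] by simp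

lemma BUC_mult:
  assumes "u \<in> BUC \<Omega> d"
  obtains M where "M \<ge> 0" "\<And>w. w \<in> \<Omega> \<Longrightarrow> cmod (u w) \<le> M"
    "\<And>f. f \<in> H \<Longrightarrow> (\<lambda>w. u w * f w) \<in> H" "\<And>f. f \<in> H \<Longrightarrow> nm (\<lambda>w. u w * f w) \<le> M * nm f"
proof -
  obtain M where M: "\<And>w. w \<in> \<Omega> \<Longrightarrow> cmod (u w) \<le> M" using assms unfolding BUC_def by blast
  have M0: "0 \<le> M" using M[OF zero_in] norm_ge_zero order_trans by blast
  have u: "u \<in> borel_measurable \<sigma>"
    using assms measurable_cong_sets[OF sets_sigma refl, of borel] by (auto simp: BUC_def)
  show ?thesis
    using that[OF M0 M] L2_bounded_mult[OF _ u M M0] by blast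
qed

lemma toeplitz_bop: "u \<in> BUC \<Omega> d \<Longrightarrow> \<exists>C. bop (toeplitz \<Omega> \<sigma> u) C"
proof -
  assume "u \<in> BUC \<Omega> d"
  then obtain M where M: "M \<ge> 0" "\<And>f. f \<in> H \<Longrightarrow> (\<lambda>w. u w * f w) \<in> H"
     "\<And>f. f \<in> H \<Longrightarrow> nm (\<lambda>w. u w * f w) \<le> M * nm f"
    using BUC_mult by metis
  have "bop (toeplitz \<Omega> \<sigma> u) M"
    unfolding bop_def toeplitz_def
  proof (intro conjI ballI allI)
    fix f assume f: "f \<in> B"
    note uf = M(2)[OF Bsp_L2[OF f]]
    show "P (\<lambda>w. u w * f w) \<in> B" by (rule P_in[OF uf])
    show "nm (P (\<lambda>w. u w * f w)) \<le> M * nm f"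
      using P_nrm[OF uf] M(3)[OF Bsp_L2[OF f]] by linarith
    show "P (\<lambda>w. u w * (c * f w)) = (\<lambda>w. c * P (\<lambda>w. u w * f w) w)" for c
      using P_cmult[OF uf, of c] by (simp add: mult.left_commute)
    fix g assume g: "g \<in> B"
    show "P (\<lambda>w. u w * (f w + g w)) = (\<lambda>w. P (\<lambda>w. u w * f w) w + P (\<lambda>w. u w * g w) w)"
      using P_add[OF uf M(2)[OF Bsp_L2[OF g]]] by (simp add: distrib_left)
  qed (rule M(1))
  then show ?thesis ..
qed

lemma bop_add: "bop S C \<Longrightarrow> bop S' C' \<Longrightarrow> bop (\<lambda>f w. S f w + S' f w) (C + C')"
  unfolding bop_def[of "\<lambda>f w. S f w + S' f w"]
  using nrm_triangle[OF Bsp_L2 Bsp_L2, of "S _" \<Omega> \<sigma> "S' _"]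
  by (auto simp: bopD Bsp_add algebra_simps fun_eq_iff) (meson add_mono bopD(2) bopD(5) order_trans)

lemma bop_mult: "bop S C \<Longrightarrow> bop S' C' \<Longrightarrow> bop (\<lambda>f. S (S' f)) (C * C')"
  unfolding bop_def[of "\<lambda>f. S (S' f)"]
proof (intro conjI ballI allI)
  assume S: "bop S C" and S': "bop S' C'"
  fix f assume f: "f \<in> B"
  have "nm (S (S' f)) \<le> C * nm (S' f)" using bopD(2,5)[OF S] bopD(2)[OF S' f] by blast
  also have "\<dots> \<le> C * (C' * nm f)" by (intro mult_left_mono bopD(5)[OF S' f] bopD(1)[OF S])
  finally show "nm (S (S' f)) \<le> C * C' * nm f" by (simp add: mult.assoc)
qed (auto simp: bopD)

lemma toep_alg_bop: "S \<in> toep_alg \<Omega> \<sigma> d \<Longrightarrow> \<exists>C. bop S C"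
  by (induction rule: toep_alg.induct) (auto intro: toeplitz_bop dest: bop_add bop_mult)

lemma T_BUC_approx:
  assumes "T \<in> T_BUC \<Omega> \<sigma> d" "e > 0"
  obtains S C where "S \<in> toep_alg \<Omega> \<sigma> d" "bop S C" "\<And>f. f \<in> B \<Longrightarrow> nm (\<lambda>w. T f w - S f w) \<le> e * nm f"
  using assms toep_alg_bop unfolding T_BUC_def by blast

text \<open>\<open>T_BUC\<close> does not state linearity of \<open>T\<close>. It is inherited from
  the approximants: each linearity defect of \<open>T\<close> is at most \<open>e\<close> times a
  fixed number for every positive \<open>e\<close>, hence zero.\<close>

lemma T_BUC_bop: assumes T: "T \<in> T_BUC \<Omega> \<sigma> d" shows "\<exists>C. bop T C"
proof -
  have TB: "T f \<in> B" if "f \<in> B" for f using T that by (simp add: T_BUC_def)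
  obtain S1 C1 where S1: "bop S1 C1" "\<And>f. f \<in> B \<Longrightarrow> nm (\<lambda>w. T f w - S1 f w) \<le> 1 * nm f"
    using T_BUC_approx[OF T zero_less_one] by metis
  have "bop T (C1 + 1)"
    unfolding bop_def
  proof (intro conjI ballI allI)
    show "0 \<le> C1 + 1" using bopD(1)[OF S1(1)] by simp
    fix f assume f: "f \<in> B"
    show "T f \<in> B" by (rule TB[OF f])
    show "nm (T f) \<le> (C1 + 1) * nm f"
      using nrm_le_add_diff[OF Bsp_L2[OF TB[OF f]] Bsp_L2[OF bopD(2)[OF S1(1) f]]] S1(2)[OF f] bopD(5)[OF S1(1) f]
      by (simp add: algebra_simps)
    show "T (\<lambda>w. c * f w) = (\<lambda>w. c * T f w)" for c
    proof (rule B_eqI)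
      let ?D = "\<lambda>w. T (\<lambda>w. c * f w) w - c * T f w"
      show "nm ?D = 0"
      proof (rule eq_zero_if_le_epsilon[where c = "2 * cmod c * nm f"])
        fix e :: real assume "e > 0"
        then obtain S C where S: "bop S C" "\<And>f. f \<in> B \<Longrightarrow> nm (\<lambda>w. T f w - S f w) \<le> e * nm f"
          using T_BUC_approx[OF T] by metis
        let ?a = "\<lambda>w. T (\<lambda>w. c * f w) w - S (\<lambda>w. c * f w) w" and ?b = "\<lambda>w. c * (T f w - S f w)"
        have a: "?a \<in> B" by (intro Bsp_diff TB bopD(2)[OF S(1)] Bsp_cmult f)
        have b: "?b \<in> B" by (intro Bsp_cmult Bsp_diff TB bopD(2)[OF S(1)] f)
        have "?D = (\<lambda>w. ?a w - ?b w)" by (simp add: bopD(4)[OF S(1) f] algebra_simps)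
        then have "nm ?D \<le> nm ?a + nm ?b"
          using nrm_triangle_diff[OF Bsp_L2[OF a] Bsp_L2[OF b]] by simp
        also have "\<dots> \<le> e * nm (\<lambda>w. c * f w) + cmod c * (e * nm f)"
          using S(2)[OF f] S(2)[OF Bsp_cmult[OF f, of c]] nrm_cmult[of \<sigma> c "\<lambda>w. T f w - S f w"]
          by (intro add_mono) (auto intro: mult_left_mono)
        finally show "nm ?D \<le> e * (2 * cmod c * nm f)" by (simp add: nrm_cmult algebra_simps)
      qed simp
    qed (intro TB Bsp_cmult f)+
    fix g assume g: "g \<in> B"
    show "T (\<lambda>w. f w + g w) = (\<lambda>w. T f w + T g w)"
    proof (rule B_eqI)
      let ?D = "\<lambda>w. T (\<lambda>w. f w + g w) w - (T f w + T g w)"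
      show "nm ?D = 0"
      proof (rule eq_zero_if_le_epsilon[where c = "2 * (nm f + nm g)"])
        fix e :: real assume e: "e > 0"
        then obtain S C where S: "bop S C" "\<And>f. f \<in> B \<Longrightarrow> nm (\<lambda>w. T f w - S f w) \<le> e * nm f"
          using T_BUC_approx[OF T] by metis
        let ?a = "\<lambda>w. T (\<lambda>w. f w + g w) w - S (\<lambda>w. f w + g w) w"
        let ?b = "\<lambda>w. T f w - S f w" and ?c = "\<lambda>w. T g w - S g w"
        have a: "?a \<in> B" by (intro Bsp_diff TB bopD(2)[OF S(1)] Bsp_add f g)
        have b: "?b \<in> B" by (intro Bsp_diff TB bopD(2)[OF S(1)] f)
        have c: "?c \<in> B" by (intro Bsp_diff TB bopD(2)[OF S(1)] g)
        have "?D = (\<lambda>w. ?a w - (?b w + ?c w))" by (simp add: bopD(3)[OF S(1) f g] algebra_simps)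
        then have "nm ?D \<le> nm ?a + (nm ?b + nm ?c)"
          using nrm_triangle_diff[OF Bsp_L2[OF a] Bsp_L2[OF Bsp_add[OF b c]]] nrm_triangle[OF Bsp_L2[OF b] Bsp_L2[OF c]] by simp
        also have "\<dots> \<le> e * nm (\<lambda>w. f w + g w) + (e * nm f + e * nm g)"
          using S(2)[OF f] S(2)[OF g] S(2)[OF Bsp_add[OF f g]] by (intro add_mono) auto
        also have "\<dots> \<le> e * (nm f + nm g) + (e * nm f + e * nm g)"
          using nrm_triangle[OF Bsp_L2[OF f] Bsp_L2[OF g]] e by (intro add_right_mono mult_left_mono) auto
        finally show "nm ?D \<le> e * (2 * (nm f + nm g))" by (simp add: algebra_simps)
      qed simp
    qed (intro TB Bsp_add f g)+
  qed
  then show ?thesis ..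
qed

text \<open>The translate \<open>S\<^sup>z\<close>, with \<open>U\<^sub>z\<close> in place of its adjoint, which is the same operator.\<close>

definition V :: "'n op \<Rightarrow> 'n pt \<Rightarrow> 'n op" where
  "V S z f = U z (S (U z f))"

lemma V_in: "bop S C \<Longrightarrow> z \<in> \<Omega> \<Longrightarrow> f \<in> B \<Longrightarrow> V S z f \<in> B"
  by (simp add: V_def U_in bopD)

lemma V_nrm: "bop S C \<Longrightarrow> z \<in> \<Omega> \<Longrightarrow> f \<in> B \<Longrightarrow> nm (V S z f) \<le> C * nm f"
  using bopD(5)[of S C "U z f"] by (simp add: V_def U_isometry(2) Bsp_L2 bopD U_in)

lemma V_bop: "bop S C \<Longrightarrow> z \<in> \<Omega> \<Longrightarrow> bop (V S z) C"
  unfolding bop_def[of "V S z"]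
  by (auto simp: V_in V_nrm bopD(1)) (auto simp: V_def U_add U_cmult bopD U_in)

lemma V_comp: "bop S' C' \<Longrightarrow> z \<in> \<Omega> \<Longrightarrow> f \<in> B \<Longrightarrow> V (\<lambda>f. S (S' f)) z f = V S z (V S' z f)"
  by (simp add: V_def U_U Bsp_L2 bopD U_in)

lemma V_add: "V (\<lambda>f w. S f w + S' f w) z f = (\<lambda>w. V S z f w + V S' z f w)"
  by (simp add: V_def U_add)

lemma V_diff_nrm:
  assumes "\<And>f. f \<in> B \<Longrightarrow> T f \<in> B" "bop S C" "z \<in> \<Omega>" "f \<in> B"
    and "\<And>f. f \<in> B \<Longrightarrow> nm (\<lambda>w. T f w - S f w) \<le> e * nm f"
  shows "nm (\<lambda>w. V T z f w - V S z f w) \<le> e * nm f"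
proof -
  have "nm (\<lambda>w. V T z f w - V S z f w) = nm (U z (\<lambda>w. T (U z f) w - S (U z f) w))"
    by (simp add: V_def U_diff)
  also have "\<dots> = nm (\<lambda>w. T (U z f) w - S (U z f) w)"
    by (rule U_isometry(2)[OF assms(3) Bsp_L2[OF Bsp_diff[OF assms(1) bopD(2)[OF assms(2)]]]])
       (rule U_in[OF assms(3,4)])+
  also have "\<dots> \<le> e * nm (U z f)" by (rule assms(5)[OF U_in[OF assms(3,4)]])
  also have "\<dots> = e * nm f" using assms by (simp add: U_isometry Bsp_L2)
  finally show ?thesis .
qed

section \<open>Strong convergence of translates\<close>

text \<open>Only a limit for each single \<open>f\<close> is requested; the limits are assembled
  into an operator in \<open>V_tendsto_zero\<close>.\<close>

definition sot_cvg :: "'n op \<Rightarrow> (nat \<Rightarrow> 'n pt) \<Rightarrow> bool" where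
  "sot_cvg S z \<longleftrightarrow> (\<forall>f\<in>B. \<exists>g\<in>B. (\<lambda>n. nm (\<lambda>w. V S (z n) f w - g w)) \<longlonglongrightarrow> 0)"

definition sot_precompact :: "'n op \<Rightarrow> bool" where
  "sot_precompact S \<longleftrightarrow> (\<forall>z. (\<forall>n. z n \<in> \<Omega>) \<longrightarrow> (\<exists>r::nat \<Rightarrow> nat. strict_mono r \<and> sot_cvg S (z \<circ> r)))"

lemma sot_cvg_subseq: "sot_cvg S z \<Longrightarrow> strict_mono r \<Longrightarrow> sot_cvg S (z \<circ> r)"
  unfolding sot_cvg_def
proof
  fix f assume "\<forall>f\<in>B. \<exists>g\<in>B. (\<lambda>n. nm (\<lambda>w. V S (z n) f w - g w)) \<longlonglongrightarrow> 0" "f \<in> B" and r: "strict_mono r"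
  then obtain g where g: "g \<in> B" "(\<lambda>n. nm (\<lambda>w. V S (z n) f w - g w)) \<longlonglongrightarrow> 0" by blast
  from LIMSEQ_subseq_LIMSEQ[OF g(2) r] g(1)
  show "\<exists>g\<in>B. (\<lambda>n. nm (\<lambda>w. V S ((z \<circ> r) n) f w - g w)) \<longlonglongrightarrow> 0"
    unfolding o_def by blast
qed

lemma V_toeplitz:
  assumes u: "u \<in> BUC \<Omega> d" and z: "z \<in> \<Omega>" and f: "f \<in> B"
  shows "V (toeplitz \<Omega> \<sigma> u) z f = P (\<lambda>w. (if w \<in> \<Omega> then u (\<phi> z w) else 0) * f w)"
proof -
  have "(\<lambda>w. u w * U z f w) \<in> H" using BUC_mult[OF u] U_isometry(1)[OF z Bsp_L2[OF f]] by metis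
  then have "V (toeplitz \<Omega> \<sigma> u) z f = P (U z (\<lambda>w. u w * U z f w))"
    by (simp add: V_def toeplitz_def U_P[OF z])
  also have "U z (\<lambda>w. u w * U z f w) = (\<lambda>w. (if w \<in> \<Omega> then u (\<phi> z w) else 0) * U z (U z f) w)"
    by (auto simp: Uop_def fun_eq_iff)
  finally show ?thesis using U_U[OF z Bsp_L2[OF f]] by simp
qed

text \<open>A diagonal subsequence makes the translated symbols converge on a countable
  \<open>d\<close>-dense set. Since each \<open>\<phi> z\<close> is a \<open>d\<close>-isometry the
  symbols share a modulus of continuity, and convergence spreads to all points. Bounded pointwise
  convergence of symbols gives norm convergence on each \<open>f\<close> by dominated
  convergence.\<close>

lemma toeplitz_sot_precompact:
  assumes u: "u \<in> BUC \<Omega> d"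
  shows "sot_precompact (toeplitz \<Omega> \<sigma> u)"
  unfolding sot_precompact_def
proof (intro allI impI)
  fix z :: "nat \<Rightarrow> 'n pt" assume z: "\<forall>n. z n \<in> \<Omega>"
  obtain M where M: "M \<ge> 0" "\<And>w. w \<in> \<Omega> \<Longrightarrow> cmod (u w) \<le> M" using BUC_mult[OF u] by metis
  have um: "u \<in> borel_measurable borel" using u by (simp add: BUC_def)
  obtain Q where Q: "countable Q" "Q \<subseteq> \<Omega>" "\<And>x e. x \<in> \<Omega> \<Longrightarrow> e > 0 \<Longrightarrow> \<exists>q\<in>Q. d x q < e"
    using dense_countable by blast
  have bd: "\<And>n x. x \<in> Q \<Longrightarrow> norm (u (\<phi> (z n) x)) \<le> M" using M(2) z Q(2) by auto
  have "\<exists>k::nat \<Rightarrow> nat. strict_mono k \<and> (\<forall>x\<in>Q. \<exists>l. (\<lambda>n. u (\<phi> (z (k n)) x)) \<longlonglongrightarrow> l)"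
    by (rule function_convergent_subsequence[where f = "\<lambda>n x. u (\<phi> (z n) x)", OF Q(1) bd]) blast+
  then obtain k :: "nat \<Rightarrow> nat" where k: "strict_mono k" "\<And>x. x \<in> Q \<Longrightarrow> \<exists>l. (\<lambda>n. u (\<phi> (z (k n)) x)) \<longlonglongrightarrow> l"
    by blast
  \<comment> \<open>The value 0 off \<Omega> makes the symbols measurable and convergent everywhere;
    products with \<open>f\<close> are unchanged, since \<open>f\<close> vanishes there.\<close>
  define un where "un = (\<lambda>n w. if w \<in> \<Omega> then u (\<phi> (z (k n)) w) else 0)"
  have "\<exists>l. (\<lambda>n. un n x) \<longlonglongrightarrow> l" for x
  proof (cases "x \<in> \<Omega>")
    case True
    show ?thesis unfolding convergent_eq_Cauchy
    proof (rule CauchyI)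
      fix e :: real assume "e > 0"
      then obtain \<delta> where \<delta>: "\<delta> > 0" "\<And>x y. x \<in> \<Omega> \<Longrightarrow> y \<in> \<Omega> \<Longrightarrow> d x y < \<delta> \<Longrightarrow> cmod (u x - u y) < e/3"
      proof -
        have "e/3 > 0" using \<open>e > 0\<close> by simp
        then have "\<exists>\<delta>>0. \<forall>x\<in>\<Omega>. \<forall>y\<in>\<Omega>. d x y < \<delta> \<longrightarrow> cmod (u x - u y) < e/3"
          using u unfolding BUC_def by blast
        then show ?thesis using that by blast
      qed
      obtain q where q: "q \<in> Q" "d x q < \<delta>" using Q(3)[OF True \<delta>(1)] by blast
      have "q \<in> \<Omega>" using q Q by auto
      have close: "cmod (u (\<phi> (z (k n)) x) - u (\<phi> (z (k n)) q)) < e/3" for n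
        using z True \<open>q \<in> \<Omega>\<close> q by (intro \<delta>(2)) (auto simp: d_phi)
      have "Cauchy (\<lambda>n. u (\<phi> (z (k n)) q))" using k(2)[OF q(1)] convergent_eq_Cauchy by blast
      then obtain n0 where n0: "\<And>m n. m \<ge> n0 \<Longrightarrow> n \<ge> n0 \<Longrightarrow> cmod (u (\<phi> (z (k m)) q) - u (\<phi> (z (k n)) q)) < e/3"
        using CauchyD[of "\<lambda>n. u (\<phi> (z (k n)) q)" "e/3"] \<open>e > 0\<close> by auto
      have "cmod (un m x - un n x) < e" if "m \<ge> n0" "n \<ge> n0" for m n
      proof -
        define a b c' c where "a = u (\<phi> (z (k m)) x)" and "b = u (\<phi> (z (k m)) q)"
          and "c' = u (\<phi> (z (k n)) q)" and "c = u (\<phi> (z (k n)) x)"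
        have "cmod (a - b) < e/3" "cmod (b - c') < e/3" "cmod (c' - c) < e/3"
          using close[of m] close[of n] n0[OF that] by (auto simp: a_def b_def c'_def c_def norm_minus_commute)
        moreover have "cmod (a - c) \<le> cmod (a - b) + cmod (b - c') + cmod (c' - c)"
          using norm_triangle_ineq[of "a - b" "b - c'"] norm_triangle_ineq[of "a - c'" "c' - c"] by simp
        ultimately show ?thesis using True by (simp add: un_def a_def c_def)
      qed
      then show "\<exists>M. \<forall>m\<ge>M. \<forall>n\<ge>M. norm (un m x - un n x) < e" by blast
    qed
  qed (auto simp: un_def intro!: exI[of _ 0])
  then obtain v where v: "\<And>x. (\<lambda>n. un n x) \<longlonglongrightarrow> v x" by metis
  have un_bd: "cmod (un n x) \<le> M" for n x using M z by (auto simp: un_def)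
  have v_bd: "cmod (v x) \<le> M" for x
    by (rule tendsto_upperbound[OF tendsto_norm[OF v]]) (auto simp: un_bd)
  have un_m: "un n \<in> borel_measurable \<sigma>" for n
  proof -
    have [measurable]: "phix (z (k n)) \<in> borel_measurable borel" using z by simp
    have "un n = (\<lambda>w. if w \<in> \<Omega> then u (phix (z (k n)) w) else 0)" by (auto simp: un_def phix_def)
    also have "\<dots> \<in> borel_measurable \<sigma>" using um by measurable
    finally show ?thesis .
  qed
  have v_m: "v \<in> borel_measurable \<sigma>" by (rule borel_measurable_LIMSEQ_metric[OF un_m v])
  have "sot_cvg (toeplitz \<Omega> \<sigma> u) (z \<circ> k)"
    unfolding sot_cvg_def
  proof
    fix f assume f: "f \<in> B"
    note fH = Bsp_L2[OF f]
    have uf: "(\<lambda>w. un n w * f w) \<in> H" for n by (rule L2_bounded_mult(1)[OF fH un_m un_bd M(1)])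
    have vf: "(\<lambda>w. v w * f w) \<in> H" by (rule L2_bounded_mult(1)[OF fH v_m v_bd M(1)])
    have eq: "V (toeplitz \<Omega> \<sigma> u) ((z \<circ> k) n) f = P (\<lambda>w. un n w * f w)" for n
      using V_toeplitz[OF u _ f, of "z (k n)"] z by (simp add: un_def)
    have lim: "(\<lambda>n. nm (\<lambda>w. un n w * f w - v w * f w)) \<longlonglongrightarrow> 0"
    proof (rule nrm_dominated_convergence[where G = "\<lambda>w. 2 * M * cmod (f w)"])
      show "integrable \<sigma> (\<lambda>w. (2 * M * cmod (f w))\<^sup>2)"
        using L2D(2)[OF fH] by (simp add: power_mult_distrib)
      show "(\<lambda>n. un n w * f w - v w * f w) \<longlonglongrightarrow> 0" for w
        using tendsto_diff[OF tendsto_mult[OF v tendsto_const] tendsto_const, of w "f w" "v w * f w"] by simp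
      show "cmod (un n w * f w - v w * f w) \<le> 2 * M * cmod (f w)" for n w
      proof -
        have "cmod (un n w * f w - v w * f w) = cmod (un n w - v w) * cmod (f w)"
          by (simp add: norm_mult[symmetric] algebra_simps)
        also have "\<dots> \<le> (M + M) * cmod (f w)"
          using norm_triangle_ineq4[of "un n w" "v w"] un_bd[of n w] v_bd[of w] by (intro mult_right_mono) auto
        finally show ?thesis by simp
      qed
    qed (rule L2_diff[OF uf vf])
    have "(\<lambda>n. nm (\<lambda>w. V (toeplitz \<Omega> \<sigma> u) ((z \<circ> k) n) f w - P (\<lambda>w. v w * f w) w)) \<longlonglongrightarrow> 0"
    proof (rule tendsto_sandwich[OF _ _ tendsto_const lim])
      show "\<forall>\<^sub>F n in sequentially. nm (\<lambda>w. V (toeplitz \<Omega> \<sigma> u) ((z \<circ> k) n) f w - P (\<lambda>w. v w * f w) w)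
          \<le> nm (\<lambda>w. un n w * f w - v w * f w)"
        unfolding eq P_diff[OF uf vf, symmetric] using P_nrm[OF L2_diff[OF uf vf]] by simp
    qed simp
    then show "\<exists>g\<in>B. (\<lambda>n. nm (\<lambda>w. V (toeplitz \<Omega> \<sigma> u) ((z \<circ> k) n) f w - g w)) \<longlonglongrightarrow> 0"
      using P_in[OF vf] by blast
  qed
  with k(1) show "\<exists>r::nat \<Rightarrow> nat. strict_mono r \<and> sot_cvg (toeplitz \<Omega> \<sigma> u) (z \<circ> r)" by blast
qed

lemma sot_precompact_two:
  assumes "sot_precompact S" "sot_precompact S'" "\<forall>n. z n \<in> \<Omega>"
  obtains r :: "nat \<Rightarrow> nat" where "strict_mono r" "sot_cvg S (z \<circ> r)" "sot_cvg S' (z \<circ> r)"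
proof -
  obtain r :: "nat \<Rightarrow> nat" where r: "strict_mono r" "sot_cvg S (z \<circ> r)"
    using assms(1,3) unfolding sot_precompact_def by blast
  have "\<forall>n. (z \<circ> r) n \<in> \<Omega>" using assms(3) by simp
  then obtain r' :: "nat \<Rightarrow> nat" where r': "strict_mono r'" "sot_cvg S' (z \<circ> r \<circ> r')"
    using assms(2) unfolding sot_precompact_def by blast
  show ?thesis
    by (rule that[of "r \<circ> r'"])
       (use r r' sot_cvg_subseq[OF r(2) r'(1)] in \<open>auto simp: o_assoc strict_mono_o\<close>)
qed

lemma sot_precompact_add:
  assumes S: "bop S C" "sot_precompact S" and S': "bop S' C'" "sot_precompact S'"
  shows "sot_precompact (\<lambda>f w. S f w + S' f w)"
  unfolding sot_precompact_def
proof (intro allI impI)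
  fix z :: "nat \<Rightarrow> 'n pt" assume z: "\<forall>n. z n \<in> \<Omega>"
  obtain r :: "nat \<Rightarrow> nat" where r: "strict_mono r" "sot_cvg S (z \<circ> r)" "sot_cvg S' (z \<circ> r)"
    using sot_precompact_two[OF S(2) S'(2) z] by blast
  have zr: "(z \<circ> r) n \<in> \<Omega>" for n using z by simp
  have "sot_cvg (\<lambda>f w. S f w + S' f w) (z \<circ> r)"
    unfolding sot_cvg_def
  proof
    fix f assume f: "f \<in> B"
    obtain g g' where g: "g \<in> B" "(\<lambda>n. nm (\<lambda>w. V S ((z \<circ> r) n) f w - g w)) \<longlonglongrightarrow> 0"
       and g': "g' \<in> B" "(\<lambda>n. nm (\<lambda>w. V S' ((z \<circ> r) n) f w - g' w)) \<longlonglongrightarrow> 0"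
      using r f unfolding sot_cvg_def by blast
    have "(\<lambda>n. nm (\<lambda>w. V (\<lambda>f w. S f w + S' f w) ((z \<circ> r) n) f w - (g w + g' w))) \<longlonglongrightarrow> 0"
    proof (rule tendsto_sandwich[OF _ _ tendsto_const])
      show "(\<lambda>n. nm (\<lambda>w. V S ((z \<circ> r) n) f w - g w) + nm (\<lambda>w. V S' ((z \<circ> r) n) f w - g' w)) \<longlonglongrightarrow> 0"
        using tendsto_add[OF g(2) g'(2)] by simp
      have "nm (\<lambda>w. V (\<lambda>f w. S f w + S' f w) ((z \<circ> r) n) f w - (g w + g' w))
          \<le> nm (\<lambda>w. V S ((z \<circ> r) n) f w - g w) + nm (\<lambda>w. V S' ((z \<circ> r) n) f w - g' w)" for n
        using nrm_triangle[OF L2_diff[OF Bsp_L2[OF V_in[OF S(1) zr f]] Bsp_L2[OF g(1)]]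
            L2_diff[OF Bsp_L2[OF V_in[OF S'(1) zr f]] Bsp_L2[OF g'(1)]], of n n]
        by (simp add: V_add algebra_simps)
      then show "\<forall>\<^sub>F n in sequentially. nm (\<lambda>w. V (\<lambda>f w. S f w + S' f w) ((z \<circ> r) n) f w - (g w + g' w))
          \<le> nm (\<lambda>w. V S ((z \<circ> r) n) f w - g w) + nm (\<lambda>w. V S' ((z \<circ> r) n) f w - g' w)" by simp
    qed simp
    then show "\<exists>g\<in>B. (\<lambda>n. nm (\<lambda>w. V (\<lambda>f w. S f w + S' f w) ((z \<circ> r) n) f w - g w)) \<longlonglongrightarrow> 0"
      using Bsp_add[OF g(1) g'(1)] by (intro bexI[of _ "\<lambda>w. g w + g' w"])
  qed
  with r(1) show "\<exists>r::nat \<Rightarrow> nat. strict_mono r \<and> sot_cvg (\<lambda>f w. S f w + S' f w) (z \<circ> r)" by blast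
qed

text \<open>Strong convergence passes to products because the translates of \<open>S\<close> all
  have the bound \<open>C\<close>: the error is at most \<open>C\<close> times the error of
  \<open>S'\<close> on \<open>f\<close>, plus the error of \<open>S\<close> on the fixed limit
  \<open>g'\<close>.\<close>

lemma sot_precompact_mult:
  assumes S: "bop S C" "sot_precompact S" and S': "bop S' C'" "sot_precompact S'"
  shows "sot_precompact (\<lambda>f. S (S' f))"
  unfolding sot_precompact_def
proof (intro allI impI)
  fix z :: "nat \<Rightarrow> 'n pt" assume z: "\<forall>n. z n \<in> \<Omega>"
  obtain r :: "nat \<Rightarrow> nat" where r: "strict_mono r" "sot_cvg S (z \<circ> r)" "sot_cvg S' (z \<circ> r)"
    using sot_precompact_two[OF S(2) S'(2) z] by blast
  have zr: "(z \<circ> r) n \<in> \<Omega>" for n using z by simp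
  have "sot_cvg (\<lambda>f. S (S' f)) (z \<circ> r)"
    unfolding sot_cvg_def
  proof
    fix f assume f: "f \<in> B"
    obtain g' where g': "g' \<in> B" "(\<lambda>n. nm (\<lambda>w. V S' ((z \<circ> r) n) f w - g' w)) \<longlonglongrightarrow> 0"
      using r(3) f unfolding sot_cvg_def by blast
    obtain g where g: "g \<in> B" "(\<lambda>n. nm (\<lambda>w. V S ((z \<circ> r) n) g' w - g w)) \<longlonglongrightarrow> 0"
      using r(2) g'(1) unfolding sot_cvg_def by blast
    have "(\<lambda>n. nm (\<lambda>w. V (\<lambda>f. S (S' f)) ((z \<circ> r) n) f w - g w)) \<longlonglongrightarrow> 0"
    proof (rule tendsto_sandwich[OF _ _ tendsto_const])
      show "(\<lambda>n. C * nm (\<lambda>w. V S' ((z \<circ> r) n) f w - g' w) + nm (\<lambda>w. V S ((z \<circ> r) n) g' w - g w)) \<longlonglongrightarrow> 0"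
        using tendsto_add[OF tendsto_mult_right_zero[OF g'(2), of C] g(2)] by simp
      have "nm (\<lambda>w. V (\<lambda>f. S (S' f)) ((z \<circ> r) n) f w - g w)
          \<le> C * nm (\<lambda>w. V S' ((z \<circ> r) n) f w - g' w) + nm (\<lambda>w. V S ((z \<circ> r) n) g' w - g w)" for n
      proof -
        let ?z = "(z \<circ> r) n"
        note bV = V_bop[OF S(1) zr[of n]] and V'f = V_in[OF S'(1) zr[of n] f]
        have "nm (\<lambda>w. V S ?z (V S' ?z f) w - g w)
           \<le> nm (\<lambda>w. V S ?z (V S' ?z f) w - V S ?z g' w) + nm (\<lambda>w. V S ?z g' w - g w)"
          by (intro nrm_diff_triangle[of _ \<Omega>] Bsp_L2 bopD(2)[OF bV] V'f g' g)
        also have "(\<lambda>w. V S ?z (V S' ?z f) w - V S ?z g' w) = V S ?z (\<lambda>w. V S' ?z f w - g' w)"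
          by (rule bop_diff[OF bV V'f g'(1), symmetric])
        also have "nm \<dots> \<le> C * nm (\<lambda>w. V S' ?z f w - g' w)"
          by (rule bopD(5)[OF bV Bsp_diff[OF V'f g'(1)]])
        finally show ?thesis using V_comp[OF S'(1) zr[of n] f, of S] by simp
      qed
      then show "\<forall>\<^sub>F n in sequentially. nm (\<lambda>w. V (\<lambda>f. S (S' f)) ((z \<circ> r) n) f w - g w)
          \<le> C * nm (\<lambda>w. V S' ((z \<circ> r) n) f w - g' w) + nm (\<lambda>w. V S ((z \<circ> r) n) g' w - g w)" by simp
    qed simp
    then show "\<exists>g\<in>B. (\<lambda>n. nm (\<lambda>w. V (\<lambda>f. S (S' f)) ((z \<circ> r) n) f w - g w)) \<longlonglongrightarrow> 0"
      using g(1) by blast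
  qed
  with r(1) show "\<exists>r::nat \<Rightarrow> nat. strict_mono r \<and> sot_cvg (\<lambda>f. S (S' f)) (z \<circ> r)" by blast
qed

lemma toep_alg_sot_precompact: "S \<in> toep_alg \<Omega> \<sigma> d \<Longrightarrow> sot_precompact S"
proof (induction rule: toep_alg.induct)
  case (base u) then show ?case by (rule toeplitz_sot_precompact)
next
  case (add S T)
  then show ?case using toep_alg_bop sot_precompact_add by meson
next
  case (mult S T)
  then show ?case using toep_alg_bop sot_precompact_mult by meson
qed

text \<open>One diagonal subsequence serves all members of a sequence of approximants. The
  translates of \<open>T\<close> are uniformly close to theirs, so \<open>T\<close> gives Cauchy
  sequences along it, and \<open>B\<close> is complete.\<close>

lemma T_BUC_sot_precompact:
  assumes T: "T \<in> T_BUC \<Omega> \<sigma> d"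
  shows "sot_precompact T"
  unfolding sot_precompact_def
proof (intro allI impI)
  fix z :: "nat \<Rightarrow> 'n pt" assume z: "\<forall>n. z n \<in> \<Omega>"
  obtain CT where CT: "bop T CT" using T_BUC_bop[OF T] by blast
  have "\<forall>i. \<exists>S C. S \<in> toep_alg \<Omega> \<sigma> d \<and> bop S C \<and> (\<forall>f\<in>B. nm (\<lambda>w. T f w - S f w) \<le> inverse (real (Suc i)) * nm f)"
  proof
    fix i
    have "inverse (real (Suc i)) > 0" by simp
    from T_BUC_approx[OF T this] show "\<exists>S C. S \<in> toep_alg \<Omega> \<sigma> d \<and> bop S C \<and>
        (\<forall>f\<in>B. nm (\<lambda>w. T f w - S f w) \<le> inverse (real (Suc i)) * nm f)" by metis
  qed
  then obtain S C where S: "\<And>i. S i \<in> toep_alg \<Omega> \<sigma> d" "\<And>i. bop (S i) (C i)"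
     "\<And>i f. f \<in> B \<Longrightarrow> nm (\<lambda>w. T f w - S i f w) \<le> inverse (real (Suc i)) * nm f"
    by metis
  obtain k :: "nat \<Rightarrow> nat" where k: "strict_mono k" "\<And>i. sot_cvg (S i) (z \<circ> (id \<circ> k))"
  proof (rule subsequence_diagonalization_lemma[of "\<lambda>i r. sot_cvg (S i) (z \<circ> r)" id])
    fix i and r :: "nat \<Rightarrow> nat"
    have "\<forall>n. (z \<circ> r) n \<in> \<Omega>" using z by simp
    then show "\<exists>k::nat \<Rightarrow> nat. strict_mono k \<and> sot_cvg (S i) (z \<circ> (r \<circ> k))"
      using toep_alg_sot_precompact[OF S(1)[of i]] unfolding sot_precompact_def by (metis comp_assoc)
  next
    \<comment> \<open>The diagonal argument requires convergence to be a property of tails: from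
      \<open>M\<close> on, \<open>k2\<close> only picks terms of \<open>k1\<close> with indices that
      are no smaller.\<close>
    fix i M and r k1 k2 :: "nat \<Rightarrow> nat"
    assume c: "sot_cvg (S i) (z \<circ> (r \<circ> k1))" and k2: "\<And>j. M \<le> j \<Longrightarrow> \<exists>j'\<ge>j. k2 j = k1 j'"
    show "sot_cvg (S i) (z \<circ> (r \<circ> k2))"
      unfolding sot_cvg_def
    proof
      fix f assume "f \<in> B"
      then obtain g where g: "g \<in> B" "(\<lambda>n. nm (\<lambda>w. V (S i) ((z \<circ> (r \<circ> k1)) n) f w - g w)) \<longlonglongrightarrow> 0"
        using c unfolding sot_cvg_def by blast
      have "(\<lambda>n. nm (\<lambda>w. V (S i) ((z \<circ> (r \<circ> k2)) n) f w - g w)) \<longlonglongrightarrow> 0"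
      proof (rule LIMSEQ_I)
        fix e :: real assume "e > 0"
        then obtain n0 where n0: "\<And>n. n \<ge> n0 \<Longrightarrow> norm (nm (\<lambda>w. V (S i) ((z \<circ> (r \<circ> k1)) n) f w - g w) - 0) < e"
          using LIMSEQ_D[OF g(2)] by blast
        show "\<exists>n0. \<forall>n\<ge>n0. norm (nm (\<lambda>w. V (S i) ((z \<circ> (r \<circ> k2)) n) f w - g w) - 0) < e"
        proof (intro exI[of _ "max n0 M"] allI impI)
          fix n assume n: "n \<ge> max n0 M"
          then obtain j' where "j' \<ge> n" "k2 n = k1 j'" using k2[of n] by auto
          then show "norm (nm (\<lambda>w. V (S i) ((z \<circ> (r \<circ> k2)) n) f w - g w) - 0) < e"
            using n0[of j'] n by simp
        qed
      qed
      with g(1) show "\<exists>g\<in>B. (\<lambda>n. nm (\<lambda>w. V (S i) ((z \<circ> (r \<circ> k2)) n) f w - g w)) \<longlonglongrightarrow> 0" by blast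
    qed
  qed blast
  have zk: "z (k n) \<in> \<Omega>" for n using z by simp
  have "sot_cvg T (z \<circ> k)"
    unfolding sot_cvg_def
  proof
    fix f assume f: "f \<in> B"
    define F where "F = (\<lambda>n. V T (z (k n)) f)"
    have FB: "F n \<in> B" for n unfolding F_def by (rule V_in[OF CT zk f])
    obtain g where "g \<in> B" "(\<lambda>n. nm (\<lambda>w. F n w - g w)) \<longlonglongrightarrow> 0"
    proof (rule B_complete[OF FB])
      fix e :: real assume e: "e > 0"
      \<comment> \<open>A quarter of \<open>e\<close> is reserved for the approximation;
        \<open>nm f + 1\<close> replaces \<open>nm f\<close> to allow \<open>f = 0\<close>.\<close>
      have pos: "e / (4 * (nm f + 1)) > 0" using e nrm_nonneg[of \<sigma> f] by (simp add: add_nonneg_pos)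
      then obtain i where i: "inverse (real (Suc i)) < e / (4 * (nm f + 1))"
        using reals_Archimedean by blast
      note pos' = less_imp_le[OF pos]
      have small: "inverse (real (Suc i)) * nm f \<le> e / 4"
      proof -
        have "inverse (real (Suc i)) * nm f \<le> e / (4 * (nm f + 1)) * (nm f + 1)"
          by (intro mult_mono less_imp_le[OF i] pos') auto
        also have "\<dots> = e / 4" using nrm_nonneg[of \<sigma> f] by (simp add: add_nonneg_eq_0_iff field_simps)
        finally show ?thesis .
      qed
      obtain g where g: "g \<in> B" "(\<lambda>n. nm (\<lambda>w. V (S i) (z (k n)) f w - g w)) \<longlonglongrightarrow> 0"
        using k(2)[of i] f unfolding sot_cvg_def by auto
      obtain n0 where n0: "\<And>n. n \<ge> n0 \<Longrightarrow> nm (\<lambda>w. V (S i) (z (k n)) f w - g w) < e/4"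
        using LIMSEQ_D[OF g(2), of "e/4"] e by auto
      have Fg: "nm (\<lambda>w. F n w - g w) \<le> e / 2" if "n \<ge> n0" for n
      proof -
        have "nm (\<lambda>w. F n w - g w) \<le> nm (\<lambda>w. F n w - V (S i) (z (k n)) f w) + nm (\<lambda>w. V (S i) (z (k n)) f w - g w)"
          by (intro nrm_diff_triangle[of _ \<Omega>] Bsp_L2 FB g V_in[OF S(2)] zk f)
        moreover have "nm (\<lambda>w. F n w - V (S i) (z (k n)) f w) \<le> inverse (real (Suc i)) * nm f"
          unfolding F_def by (rule V_diff_nrm[OF bopD(2)[OF CT] S(2) zk f S(3)])
        ultimately show ?thesis using n0[OF that] small by linarith
      qed
      have "nm (\<lambda>w. F m w - F n w) \<le> e" if "m \<ge> n0" "n \<ge> n0" for m n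
        using nrm_diff_triangle[OF Bsp_L2[OF FB] Bsp_L2[OF g(1)] Bsp_L2[OF FB], of m n] Fg[OF that(1)] Fg[OF that(2)]
          nrm_minus_commute[of \<sigma> g "F n"] by linarith
      then show "\<exists>M. \<forall>m\<ge>M. \<forall>n\<ge>M. nm (\<lambda>w. F m w - F n w) \<le> e" by blast
    qed blast
    then show "\<exists>g\<in>B. (\<lambda>n. nm (\<lambda>w. V T ((z \<circ> k) n) f w - g w)) \<longlonglongrightarrow> 0"
      unfolding F_def by auto
  qed
  with k(1) show "\<exists>r::nat \<Rightarrow> nat. strict_mono r \<and> sot_cvg T (z \<circ> r)" by blast
qed

end

subsection \<open>Injectivity of the Berezin transform\<close>

context bergman
begin

text \<open>The last conclusion is the point: a bounded functional evaluated on kernels is the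
  conjugate of a function in \<open>B\<close>. So its dependence on \<open>z\<close> is
  antiholomorphic.\<close>

lemma bounded_functional_kernel:
  fixes \<Lambda> :: "'n fn \<Rightarrow> complex"
  assumes "\<And>f g. f \<in> B \<Longrightarrow> g \<in> B \<Longrightarrow> \<Lambda> (\<lambda>w. f w + g w) = \<Lambda> f + \<Lambda> g"
    and "\<And>c f. f \<in> B \<Longrightarrow> \<Lambda> (\<lambda>w. c * f w) = c * \<Lambda> f"
    and "\<And>f. f \<in> B \<Longrightarrow> cmod (\<Lambda> f) \<le> C * nm f"
  obtains h where "h \<in> B" "\<And>f. f \<in> B \<Longrightarrow> \<Lambda> f = ip \<sigma> f h" "\<And>z. z \<in> \<Omega> \<Longrightarrow> \<Lambda> (K z) = cnj (h z)"
proof -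
  obtain h where h: "h \<in> B" "\<And>f. f \<in> B \<Longrightarrow> \<Lambda> f = ip \<sigma> f h"
    by (rule Riesz[of \<Lambda> C]) (use assms in blast)+
  have "\<Lambda> (K z) = cnj (h z)" if "z \<in> \<Omega>" for z
    using h(2)[OF K_in[OF that]] reproducing[OF h(1) that] by (metis ip_commute)
  with h that show ?thesis by blast
qed

text \<open>On the complex line through \<open>a\<close> and \<open>y\<close> this becomes a
  statement in two complex variables, to which \<open>sesquiholomorphic_zero\<close> applies. The
  desired value is found at \<open>s = 0\<close> and \<open>t = 1\<close>; the latter lies in the
  half disc since \<open>y\<close> lies in the half ball.\<close>

lemma sesquiholomorphic_kernel_zero:
  assumes S: "bop S C" and diag: "\<And>w. w \<in> \<Omega> \<Longrightarrow> S (K w) w = 0"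
    and R: "R > 0" "ball a R \<subseteq> \<Omega>" "\<And>w. w \<in> ball a R \<Longrightarrow> N w \<le> M"
    and y: "y \<in> ball a (R/2)"
  shows "S (K y) a = 0"
proof (cases "y = a")
  case True
  have "a \<in> \<Omega>" using R by auto
  then show ?thesis using True diag by simp
next
  case False
  define v where "v = y - a"
  have v: "norm v > 0" using False by (simp add: v_def)
  define r where "r = R / norm v"
  have r: "r > 0" using v R by (simp add: r_def)
  have in_ball: "a + s *s v \<in> ball a R" if "cmod s < r" for s
    using that v by (simp add: dist_norm norm_smult_complex r_def field_simps)
  have in_dom: "a + s *s v \<in> \<Omega>" if "cmod s < r" for s using in_ball[OF that] R by auto
  have M0: "0 \<le> M" using R(3)[of a] R(1) nrm_nonneg order_trans by (metis centre_in_ball)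
  have line: "(\<lambda>s. f (a + s *s v)) holomorphic_on ball 0 r" if "f \<in> B" for f
    by (rule holo_on_line[OF Bsp_holo[OF that]]) (auto intro: in_dom)
  have Sbd: "cmod (S f (a + s *s v)) \<le> C * M * nm f" if f: "f \<in> B" and s: "cmod s < r" for f s
  proof -
    have "cmod (S f (a + s *s v)) \<le> nm (S f) * N (a + s *s v)"
      by (rule point_bound[OF bopD(2)[OF S f] in_dom[OF s]])
    also have "\<dots> \<le> (C * nm f) * M"
      using bopD(1)[OF S] by (intro mult_mono bopD(5)[OF S f] R(3) in_ball s) auto
    finally show ?thesis by (simp add: mult_ac)
  qed
  \<comment> \<open>Conjugating \<open>t\<close> makes \<open>h\<close> holomorphic in both
    variables and moves the diagonal to \<open>t = cnj s\<close>.\<close>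
  define h where "h = (\<lambda>s t. S (K (a + cnj t *s v)) (a + s *s v))"
  have "h 0 1 = 0"
  proof (rule sesquiholomorphic_zero[where h = h and R = r and M = "C * M * M" and s = 0 and t = 1])
    fix t :: complex assume "t \<in> ball 0 r"
    then have t: "a + cnj t *s v \<in> \<Omega>" "a + cnj t *s v \<in> ball a R"
      using in_dom[of "cnj t"] in_ball[of "cnj t"] by auto
    show "(\<lambda>s. h s t) holomorphic_on ball 0 r"
      unfolding h_def by (rule line[OF bopD(2)[OF S K_in[OF t(1)]]])
    show "cmod (h s t) \<le> C * M * M" if "s \<in> ball 0 r" for s
    proof -
      have "cmod (h s t) \<le> C * M * N (a + cnj t *s v)"
        unfolding h_def using that by (intro Sbd K_in t) auto
      also have "\<dots> \<le> C * M * M" using bopD(1)[OF S] M0 R(3)[OF t(2)] by (intro mult_left_mono) auto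
      finally show ?thesis .
    qed
  next
    fix n
    \<comment> \<open>A Taylor coefficient in \<open>s\<close> is a functional of the function fed
      to \<open>S\<close>, bounded by Cauchy's inequality. On kernels it therefore depends
      holomorphically on \<open>t\<close>.\<close>
    define \<Lambda> where "\<Lambda> = (\<lambda>f. (deriv ^^ n) (\<lambda>s. S f (a + s *s v)) 0)"
    obtain g where g: "g \<in> B" "\<And>z. z \<in> \<Omega> \<Longrightarrow> \<Lambda> (K z) = cnj (g z)"
    proof (rule bounded_functional_kernel[of \<Lambda> "fact n * (C * M) / (r/2) ^ n"])
      fix f assume f: "f \<in> B"
      note hf = line[OF bopD(2)[OF S f]]
      show "\<Lambda> (\<lambda>w. f w + f' w) = \<Lambda> f + \<Lambda> f'" if "f' \<in> B" for f'
        using higher_deriv_add[OF hf line[OF bopD(2)[OF S that]] open_ball, of 0 n] r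
        by (simp add: \<Lambda>_def bopD(3)[OF S f that])
      show "\<Lambda> (\<lambda>w. c * f w) = c * \<Lambda> f" for c
        using higher_deriv_cmult[OF hf _ open_ball, of 0 n c] r by (simp add: \<Lambda>_def bopD(4)[OF S f])
      have "cmod (\<Lambda> f) \<le> fact n * (C * M * nm f) / (r/2) ^ n"
        unfolding \<Lambda>_def
      proof (rule Cauchy_inequality)
        show "(\<lambda>s. S f (a + s *s v)) holomorphic_on ball 0 (r/2)"
          by (rule holomorphic_on_subset[OF hf]) (use r in auto)
        show "continuous_on (cball 0 (r/2)) (\<lambda>s. S f (a + s *s v))"
          by (rule holomorphic_on_imp_continuous_on, rule holomorphic_on_subset[OF hf]) (use r in auto)
      qed (use r in \<open>auto intro!: Sbd f\<close>)
      then show "cmod (\<Lambda> f) \<le> fact n * (C * M) / (r/2) ^ n * nm f" by (simp add: mult_ac)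
    qed blast
    have img: "cnj ` ball 0 r = ball 0 r"
    proof (intro subset_antisym subsetI)
      fix x :: complex assume "x \<in> ball 0 r"
      then show "x \<in> cnj ` ball 0 r" by (intro image_eqI[of x cnj "cnj x"]) auto
    qed auto
    have hol: "(cnj \<circ> (\<lambda>s. g (a + s *s v)) \<circ> cnj) holomorphic_on ball 0 r"
      by (rule holomorphic_on_compose_cnj_cnj) (use line[OF g(1)] in \<open>simp_all add: img\<close>)
    have eq: "(deriv ^^ n) (\<lambda>s. h s t) 0 = (cnj \<circ> (\<lambda>s. g (a + s *s v)) \<circ> cnj) t" if "t \<in> ball 0 r" for t
      using g(2)[of "a + cnj t *s v"] in_dom[of "cnj t"] that by (simp add: \<Lambda>_def h_def)
    show "(\<lambda>t. (deriv ^^ n) (\<lambda>s. h s t) 0) holomorphic_on ball 0 r"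
      by (rule holomorphic_transform[OF hol]) (rule eq[symmetric])
  next
    fix s :: complex assume "s \<in> ball 0 r"
    then show "h s (cnj s) = 0" using diag[OF in_dom[of s]] by (simp add: h_def)
  next
    show "(0::complex) \<in> ball 0 (r/2)" using r by simp
    have "norm v < R / 2" using y by (simp add: v_def dist_norm norm_minus_commute)
    then show "(1::complex) \<in> ball 0 (r/2)" using v by (simp add: r_def field_simps)
  qed
  then show ?thesis by (simp add: h_def v_def)
qed

text \<open>Evaluation of \<open>S f\<close> at \<open>a\<close> is represented by some
  \<open>h\<close> in \<open>B\<close> whose values are the conjugates of \<open>S (K y) a\<close>.
  These vanish near \<open>a\<close>, hence everywhere by the identity theorem.\<close>

lemma berezin_injective:
  assumes S: "bop S C" and diag: "\<And>w. w \<in> \<Omega> \<Longrightarrow> S (K w) w = 0" and f: "f \<in> B"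
  shows "S f = (\<lambda>w. 0)"
proof
  fix a show "S f a = 0"
  proof (cases "a \<in> \<Omega>")
    case True
    obtain R M where R: "R > 0" "ball a R \<subseteq> \<Omega>" "\<And>w. w \<in> ball a R \<Longrightarrow> N w \<le> M"
      using N_locally_bounded[OF True] by blast
    obtain h where h: "h \<in> B" "\<And>f. f \<in> B \<Longrightarrow> S f a = ip \<sigma> f h" "\<And>z. z \<in> \<Omega> \<Longrightarrow> S (K z) a = cnj (h z)"
    proof (rule bounded_functional_kernel[of "\<lambda>f. S f a" "C * N a"])
      fix f assume f: "f \<in> B"
      have "cmod (S f a) \<le> nm (S f) * N a" by (rule point_bound[OF bopD(2)[OF S f] True])
      also have "\<dots> \<le> (C * nm f) * N a" by (intro mult_right_mono bopD(5)[OF S f]) auto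
      finally show "cmod (S f a) \<le> C * N a * nm f" by (simp add: mult_ac)
    qed (use bopD(3,4)[OF S] in auto)
    have "h y = 0" if "y \<in> \<Omega>" for y
    proof (rule holo_on_identity[OF Bsp_holo[OF h(1)] connected_dom True _ _ that])
      show "0 < R/2" using R by simp
      fix u assume u: "u \<in> ball a (R/2)"
      then have "u \<in> ball a R" using R(1) by auto
      then have "u \<in> \<Omega>" using R(2) by auto
      then show "h u = 0" using sesquiholomorphic_kernel_zero[OF S diag R u] h(3)[of u] by simp
    qed
    then have "h = (\<lambda>w. 0)" using B_outside[OF h(1)] by (metis ext)
    then show ?thesis using h(2)[OF f] by simp
  next
    case False then show ?thesis using B_outside[OF bopD(2)[OF S f]] by simp
  qed
qed

section \<open>Translates and the Berezin transform\<close>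

text \<open>\<open>U z\<close> sends \<open>K w\<close> to a multiple of the kernel at
  \<open>\<phi> z w\<close>, so translating the operator translates its Berezin transform. The
  factor \<open>(N w)\<^sup>2\<close> appears because \<open>K w\<close> is not normalised.\<close>

lemma berezin_phi:
  assumes T: "bop T C" and z: "z \<in> \<Omega>" and w: "w \<in> \<Omega>"
  shows "V T z (K w) w = of_real ((N w)\<^sup>2) * berezin \<sigma> K T (\<phi> z w)"
proof -
  let ?y = "\<phi> z w" and ?c = "cnj (nkern \<sigma> K z w)"
  have y: "?y \<in> \<Omega>" using z w by simp
  have cc: "of_real ((cmod ?c)\<^sup>2) = ?c * cnj ?c" by (rule complex_norm_square)
  have "berezin \<sigma> K T ?y = ip \<sigma> (T (K ?y)) (K ?y) / of_real ((N ?y)\<^sup>2)"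
  proof -
    have nk: "nkern \<sigma> K ?y = (\<lambda>v. inverse (of_real (N ?y)) * K ?y v)"
      by (simp add: nkern_def divide_inverse mult.commute)
    show ?thesis
      unfolding berezin_def nk bopD(4)[OF T K_in[OF y]] ip_cmult_left ip_cmult_right
      by (simp add: divide_inverse power2_eq_square)
  qed
  moreover have "V T z (K w) w = ip \<sigma> (V T z (K w)) (K w)"
    by (rule reproducing[OF V_in[OF T z K_in[OF w]] w])
  moreover have "\<dots> = ip \<sigma> (T (U z (K w))) (U z (K w))"
    unfolding V_def using z w by (intro U_ip Bsp_L2 bopD(2)[OF T] U_in K_in)
  moreover have "\<dots> = of_real ((cmod ?c)\<^sup>2) * ip \<sigma> (T (K ?y)) (K ?y)"
    unfolding U_K[OF z w] bopD(4)[OF T K_in[OF y]] ip_cmult_left ip_cmult_right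
    unfolding cc by (simp add: mult_ac)
  ultimately show ?thesis using y z w by (simp add: nkern_modulus power_divide)
qed

lemma berezin_eq_V:
  assumes T: "bop T C" and z: "z \<in> \<Omega>"
  shows "berezin \<sigma> K T z = V T z (K 0) 0"
  using berezin_phi[OF T z zero_in] z by simp

lemma V_tendsto_zero:
  assumes T: "T \<in> T_BUC \<Omega> \<sigma> d" and van: "vanishes_at_inf \<Omega> d (\<lambda>z. cmod (berezin \<sigma> K T z))"
    and f: "f \<in> B"
  shows "vanishes_at_inf \<Omega> d (\<lambda>z. nm (V T z f))"
proof (rule ccontr)
  assume "\<not> ?thesis"
  then obtain e where e: "e > 0" "\<And>R. \<exists>z\<in>\<Omega>. d z 0 > R \<and> nm (V T z f) \<ge> e"
    unfolding vanishes_at_inf_def by (force simp: not_less)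
  then have "\<forall>n::nat. \<exists>z. z \<in> \<Omega> \<and> d z 0 > real n \<and> nm (V T z f) \<ge> e" by blast
  then obtain z where z: "\<And>n. z n \<in> \<Omega>" "\<And>n. d (z n) 0 > real n" "\<And>n. nm (V T (z n) f) \<ge> e" by metis
  obtain C where C: "bop T C" using T_BUC_bop[OF T] by blast
  obtain r :: "nat \<Rightarrow> nat" where r: "strict_mono r" "sot_cvg T (z \<circ> r)"
    using T_BUC_sot_precompact[OF T] z(1) unfolding sot_precompact_def by blast
  define y where "y = z \<circ> r"
  have y: "y n \<in> \<Omega>" for n using z by (simp add: y_def)
  have yinf: "d (y n) 0 > real n" for n
    using z(2)[of "r n"] seq_suble[OF r(1), of n] by (simp add: y_def)
  obtain S where S: "\<And>f. f \<in> B \<Longrightarrow> S f \<in> B"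
      "\<And>f. f \<in> B \<Longrightarrow> (\<lambda>n. nm (\<lambda>w. V T (y n) f w - S f w)) \<longlonglongrightarrow> 0"
  proof -
    have "\<forall>f. \<exists>g. f \<in> B \<longrightarrow> g \<in> B \<and> (\<lambda>n. nm (\<lambda>w. V T (y n) f w - g w)) \<longlonglongrightarrow> 0"
      using r(2) unfolding sot_cvg_def y_def by blast
    from choice[OF this] show ?thesis using that by blast
  qed
  have pt: "(\<lambda>n. V T (y n) f w) \<longlonglongrightarrow> S f w" if f: "f \<in> B" for f w
  proof (cases "w \<in> \<Omega>")
    case True
    show ?thesis
    proof (rule LIM_zero_cancel, rule tendsto_norm_zero_cancel, rule tendsto_sandwich[OF _ _ tendsto_const])
      show "\<forall>\<^sub>F n in sequentially. cmod (V T (y n) f w - S f w) \<le> nm (\<lambda>w. V T (y n) f w - S f w) * N w"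
        using point_bound[OF Bsp_diff[OF V_in[OF C y f] S(1)[OF f]] True] by simp
      show "(\<lambda>n. nm (\<lambda>w. V T (y n) f w - S f w) * N w) \<longlonglongrightarrow> 0"
        using tendsto_mult_left_zero[OF S(2)[OF f]] .
    qed simp
  next
    case False
    then show ?thesis using B_outside[OF V_in[OF C y f]] B_outside[OF S(1)[OF f]] by simp
  qed
  \<comment> \<open>Linearity follows from pointwise convergence, which the kernel bound provides;
    the norm bound is Fatou, as all translates share \<open>C\<close>.\<close>
  have "bop S C"
    unfolding bop_def
  proof (intro conjI ballI allI)
    fix f assume f: "f \<in> B"
    show "S (\<lambda>w. c * f w) = (\<lambda>w. c * S f w)" for c
    proof
      fix w
      have "(\<lambda>n. V T (y n) (\<lambda>w. c * f w) w) \<longlonglongrightarrow> c * S f w"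
        unfolding bopD(4)[OF V_bop[OF C y] f] by (intro tendsto_intros pt f)
      then show "S (\<lambda>w. c * f w) w = c * S f w"
        using LIMSEQ_unique pt[OF Bsp_cmult[OF f]] by blast
    qed
    show "S (\<lambda>w. f w + g w) = (\<lambda>w. S f w + S g w)" if g: "g \<in> B" for g
    proof
      fix w
      have "(\<lambda>n. V T (y n) (\<lambda>w. f w + g w) w) \<longlonglongrightarrow> S f w + S g w"
        unfolding bopD(3)[OF V_bop[OF C y] f g] by (intro tendsto_intros pt f g)
      then show "S (\<lambda>w. f w + g w) w = S f w + S g w"
        using LIMSEQ_unique pt[OF Bsp_add[OF f g]] by blast
    qed
    show "nm (S f) \<le> C * nm f"
      by (rule L2_Fatou(2)[of "\<lambda>n. V T (y n) f" \<Omega>, OF Bsp_L2[OF V_in[OF C y f]] pt[OF f]])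
         (use V_nrm[OF C y f] bopD(1)[OF C] in auto)
  qed (use S bopD(1)[OF C] in auto)
  moreover have "S (K w) w = 0" if w: "w \<in> \<Omega>" for w
  proof (rule LIMSEQ_unique[OF pt[OF K_in[OF w]]])
    have "(\<lambda>n. cmod (berezin \<sigma> K T (\<phi> (y n) w))) \<longlonglongrightarrow> 0"
    proof (rule LIMSEQ_I)
      fix e :: real assume "e > 0"
      then obtain R where R: "\<And>z. z \<in> \<Omega> \<Longrightarrow> d z 0 > R \<Longrightarrow> cmod (berezin \<sigma> K T z) < e"
        using van unfolding vanishes_at_inf_def by (metis abs_norm_cancel)
      obtain n0 :: nat where n0: "real n0 \<ge> R + d w 0" using real_arch_simple by blast
      have "cmod (berezin \<sigma> K T (\<phi> (y n) w)) < e" if "n \<ge> n0" for n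
      proof (rule R)
        show "\<phi> (y n) w \<in> \<Omega>" using y w by simp
        \<comment> \<open>By invariance \<open>\<phi> (y n) w\<close> is as far from 0 as
          \<open>w\<close> is from \<open>y n\<close>, so it escapes to infinity together with
          \<open>y n\<close>.\<close>
        have "d (y n) 0 \<le> d (y n) w + d w 0" by (rule Met.triangle) (use y w in auto)
        then show "d (\<phi> (y n) w) 0 > R"
          using d_phi_zero[OF y w, of n] yinf[of n] n0 that Met.commute[of w "y n"] by simp
      qed
      then show "\<exists>n0. \<forall>n\<ge>n0. norm (cmod (berezin \<sigma> K T (\<phi> (y n) w)) - 0) < e" by auto
    qed
    then have "(\<lambda>n. of_real ((N w)\<^sup>2) * berezin \<sigma> K T (\<phi> (y n) w)) \<longlonglongrightarrow> of_real ((N w)\<^sup>2) * 0"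
      by (intro tendsto_intros) (rule tendsto_norm_zero_cancel)
    then show "(\<lambda>n. V T (y n) (K w) w) \<longlonglongrightarrow> 0"
      unfolding berezin_phi[OF C y w] by simp
  qed
  ultimately have "S f = (\<lambda>w. 0)" by (rule berezin_injective[OF _ _ f])
  then have "(\<lambda>n. nm (V T (y n) f)) \<longlonglongrightarrow> 0" using S(2)[OF f] by simp
  then obtain n where "nm (V T (y n) f) < e" using LIMSEQ_D[of _ 0 e] e(1) by fastforce
  then show False using z(3)[of "r n"] by (simp add: y_def)
qed

text \<open>For the converse the single function \<open>K 0\<close>, the constant 1 on \<Omega>,
  suffices: the Berezin transform is the value at 0 of the translate applied to it, and point
  evaluation at 0 has norm one.\<close>

lemma vanishes_berezin_iff:
  assumes T: "T \<in> T_BUC \<Omega> \<sigma> d"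
  shows "vanishes_at_inf \<Omega> d (\<lambda>z. cmod (berezin \<sigma> K T z)) \<longleftrightarrow>
           (\<forall>f\<in>B. vanishes_at_inf \<Omega> d (\<lambda>z. nm (transl \<Omega> \<phi> \<sigma> K T z f)))"
proof -
  obtain C where C: "bop T C" using T_BUC_bop[OF T] by blast
  have tr: "vanishes_at_inf \<Omega> d (\<lambda>z. nm (transl \<Omega> \<phi> \<sigma> K T z f)) \<longleftrightarrow> vanishes_at_inf \<Omega> d (\<lambda>z. nm (V T z f))"
    if "f \<in> B" for f
    unfolding vanishes_at_inf_def using that by (simp add: transl_eq V_def)
  have "vanishes_at_inf \<Omega> d (\<lambda>z. cmod (berezin \<sigma> K T z))"
    if v: "vanishes_at_inf \<Omega> d (\<lambda>z. nm (V T z (K 0)))"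
    unfolding vanishes_at_inf_def
  proof (intro allI impI)
    fix e :: real assume "e > 0"
    then obtain R where R: "\<And>z. z \<in> \<Omega> \<Longrightarrow> d z 0 > R \<Longrightarrow> nm (V T z (K 0)) < e"
      using v unfolding vanishes_at_inf_def by (metis abs_of_nonneg nrm_nonneg)
    have "cmod (berezin \<sigma> K T z) \<le> nm (V T z (K 0))" if "z \<in> \<Omega>" for z
      using point_bound[OF V_in[OF C that K_in[OF zero_in]] zero_in] berezin_eq_V[OF C that] by simp
    with R show "\<exists>R. \<forall>z\<in>\<Omega>. R < d z 0 \<longrightarrow> \<bar>cmod (berezin \<sigma> K T z)\<bar> < e"
      by (metis abs_norm_cancel order_le_less_trans)
  qed
  then show ?thesis using V_tendsto_zero[OF T] tr K_in[OF zero_in] by blast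
qed

end

subsection \<open>Normal families\<close>

text \<open>Local bounds give a common Lipschitz constant, and a finite net of points then upgrades
  pointwise to locally uniform convergence.\<close>

lemma holo_on_bounded_pointwise_limit:
  fixes f :: "nat \<Rightarrow> ('n::finite) fn"
  assumes hol: "\<And>n. holo_on \<Omega> (f n)" and op: "open \<Omega>"
    and bd: "\<And>z. z \<in> \<Omega> \<Longrightarrow> \<exists>r>0. \<exists>M. ball z r \<subseteq> \<Omega> \<and> (\<forall>n. \<forall>w\<in>ball z r. cmod (f n w) \<le> M)"
    and lim: "\<And>z. z \<in> \<Omega> \<Longrightarrow> (\<lambda>n. f n z) \<longlonglongrightarrow> g z"
  shows "holo_on \<Omega> g"
proof (rule holo_on_locally_uniform_limit[OF hol op])
  fix z assume "z \<in> \<Omega>"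
  then obtain r M where r: "r > 0" "ball z r \<subseteq> \<Omega>" "\<And>n w. w \<in> ball z r \<Longrightarrow> cmod (f n w) \<le> M"
    using bd by blast
  have M: "0 \<le> M" using r(3)[of z] r(1) norm_ge_zero order_trans by (metis centre_in_ball)
  \<comment> \<open>The summand 1 keeps \<open>L\<close> positive when \<open>M = 0\<close>, since
    \<open>L\<close> is divided by below.\<close>
  define L where "L = 2 * M / (r/2) + 1"
  have L: "L > 0" using M r(1) by (simp add: L_def add_nonneg_pos)
  have lip: "cmod (f n x - f n y) \<le> L * norm (x - y)" if "x \<in> ball z (r/2)" "y \<in> ball z (r/2)" for n x y
  proof -
    have "cmod (f n x - f n y) \<le> 2 * M / (r/2) * norm (x - y)"
      by (rule holo_on_lipschitz[OF hol _ _ _ that]) (use r in auto)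
    also have "\<dots> \<le> L * norm (x - y)" by (intro mult_right_mono) (auto simp: L_def)
    finally show ?thesis .
  qed
  have ball_sub: "ball z (r/2) \<subseteq> \<Omega>" using r(1,2) by (auto simp: subset_iff)
  have lipg: "cmod (g x - g y) \<le> L * norm (x - y)" if "x \<in> ball z (r/2)" "y \<in> ball z (r/2)" for x y
  proof (rule tendsto_upperbound)
    show "(\<lambda>n. cmod (f n x - f n y)) \<longlonglongrightarrow> cmod (g x - g y)"
      using that ball_sub by (intro tendsto_intros lim) auto
  qed (use lip that in auto)
  \<comment> \<open>The closed ball of radius \<open>r/4\<close> is compact and lies inside the ball
    of radius \<open>r/2\<close> where the Lipschitz estimate holds.\<close>
  have "uniform_limit (ball z (r/4)) f g sequentially"
    unfolding uniform_limit_sequentially_iff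
  proof (intro allI impI)
    fix e :: real assume e: "e > 0"
    define \<eta> where "\<eta> = e / (4 * L)"
    have \<eta>: "\<eta> > 0" using e L by (simp add: \<eta>_def)
    have sub: "cball z (r/4) \<subseteq> ball z (r/2)" using r(1) by auto
    obtain k where k: "k \<subseteq> cball z (r/4)" "finite k" "cball z (r/4) \<subseteq> (\<Union>x\<in>k. ball x \<eta>)"
    proof (rule compactE_image[of "cball z (r/4)" "cball z (r/4)" "\<lambda>x. ball x \<eta>"])
      show "cball z (r/4) \<subseteq> (\<Union>x\<in>cball z (r/4). ball x \<eta>)" using \<eta> by force
    qed auto
    have "\<forall>x\<in>k. \<exists>n0. \<forall>n\<ge>n0. cmod (f n x - g x) < e/4"
      using LIMSEQ_D[OF lim, of _ "e/4"] e k(1) sub ball_sub by (meson subsetD divide_pos_pos zero_less_numeral)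
    then obtain n0 where n0: "\<And>x n. x \<in> k \<Longrightarrow> n \<ge> n0 x \<Longrightarrow> cmod (f n x - g x) < e/4" by metis
    have "dist (f n y) (g y) < e" if n: "n \<ge> Max (n0 ` k)" and y: "y \<in> ball z (r/4)" for n y
    proof -
      have "y \<in> cball z (r/4)" using y by simp
      then obtain x where x: "x \<in> k" "dist x y < \<eta>" using k(3) by auto
      have "x \<in> ball z (r/2)" "y \<in> ball z (r/2)" using x(1) k(1) sub \<open>y \<in> cball z (r/4)\<close> by blast+
      note b = lip[OF this, of n] lipg[OF this]
      have "L * norm (x - y) \<le> L * \<eta>" using x(2) L by (intro mult_left_mono) (auto simp: dist_norm)
      also have "\<dots> = e/4" using L by (simp add: \<eta>_def)
      finally have lt: "L * norm (x - y) \<le> e/4" .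
      have "n \<ge> n0 x" using n Max_ge[OF finite_imageI[OF k(2)] imageI[OF x(1)], of n0] by linarith
      then have "cmod (f n x - g x) < e/4" using n0 x(1) by blast
      moreover have "cmod (f n y - g y) \<le> cmod (f n x - f n y) + cmod (f n x - g x) + cmod (g x - g y)"
        using norm_triangle_ineq4[of "f n x - g x" "f n x - f n y"] norm_triangle_ineq[of "(f n x - g x) - (f n x - f n y)" "g x - g y"]
        by simp
      ultimately show ?thesis using b lt e by (simp add: dist_norm)
    qed
    then show "\<exists>n0. \<forall>n\<ge>n0. \<forall>x\<in>ball z (r/4). dist (f n x) (g x) < e" by blast
  qed
  moreover have "ball z (r/4) \<subseteq> \<Omega>" using r(1,2) by (auto simp: subset_iff)
  ultimately show "\<exists>r>0. ball z r \<subseteq> \<Omega> \<and> uniform_limit (ball z r) f g sequentially"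
    using r(1) by (intro exI[of _ "r/4"]) auto
qed

context bergman
begin

text \<open>The kernel bound and the Euclidean local bound on \<open>N\<close> make a norm-bounded
  sequence locally equi-Lipschitz, so a subsequence that converges on a countable dense set
  converges everywhere. Fatou and the previous lemma place the limit in \<open>B\<close>.\<close>

lemma B_Montel:
  assumes f: "\<And>n. f n \<in> B" and b: "\<And>n. nm (f n) \<le> b"
  obtains k :: "nat \<Rightarrow> nat" and g where "strict_mono k" "g \<in> B" "nm g \<le> b" "\<And>w. (\<lambda>n. f (k n) w) \<longlonglongrightarrow> g w"
proof -
  have b0: "0 \<le> b" using b[of 0] nrm_nonneg order_trans by blast
  have fbd: "cmod (f n w) \<le> b * N w" if "w \<in> \<Omega>" for n w
    using point_bound[OF f that, of n] mult_right_mono[OF b[of n], of "N w"] by simp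
  obtain D :: "'n pt set" where D: "countable D" "\<And>X. open X \<Longrightarrow> X \<noteq> {} \<Longrightarrow> \<exists>d\<in>D. d \<in> X"
    using countable_dense_setE by metis
  have cD: "countable (D \<inter> \<Omega>)" using D(1) by simp
  \<comment> \<open>Dividing by \<open>N w\<close> yields one bound for all points, as the diagonal
    subsequence lemma demands.\<close>
  have bd: "norm (f n w / of_real (N w)) \<le> b" if "w \<in> D \<inter> \<Omega>" for n w
    using fbd[of w n] that by (simp add: norm_divide field_simps)
  have "\<exists>k::nat \<Rightarrow> nat. strict_mono k \<and> (\<forall>w\<in>D \<inter> \<Omega>. \<exists>l. (\<lambda>n. f (k n) w / of_real (N w)) \<longlonglongrightarrow> l)"
    by (rule function_convergent_subsequence[where f = "\<lambda>n w. f n w / of_real (N w)", OF cD bd]) blast+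
  then obtain k :: "nat \<Rightarrow> nat" where k: "strict_mono k"
      "\<And>w. w \<in> D \<inter> \<Omega> \<Longrightarrow> \<exists>l. (\<lambda>n. f (k n) w / of_real (N w)) \<longlonglongrightarrow> l" by blast
  have kD: "\<exists>l. (\<lambda>n. f (k n) w) \<longlonglongrightarrow> l" if w: "w \<in> D \<inter> \<Omega>" for w
  proof -
    obtain l where "(\<lambda>n. f (k n) w / of_real (N w)) \<longlonglongrightarrow> l" using k(2)[OF w] by blast
    from tendsto_mult[OF this tendsto_const[of "of_real (N w)"]]
    have "(\<lambda>n. f (k n) w) \<longlonglongrightarrow> l * of_real (N w)" using w by simp
    then show ?thesis by blast
  qed
  have "\<exists>l. (\<lambda>n. f (k n) w) \<longlonglongrightarrow> l" for w
  proof (cases "w \<in> \<Omega>")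
    case True
    obtain r M where r: "r > 0" "ball w r \<subseteq> \<Omega>" "\<And>u. u \<in> ball w r \<Longrightarrow> N u \<le> M"
      using N_locally_bounded[OF True] by blast
    have M: "0 \<le> M" using r(3)[of w] r(1) nrm_nonneg order_trans by (metis centre_in_ball)
    define L where "L = 2 * (b * M) / (r/2) + 1"
    have L: "L > 0" using M r(1) b0 by (simp add: L_def add_nonneg_pos)
    have lip: "cmod (f n w - f n y) \<le> L * norm (w - y)" if "y \<in> ball w (r/2)" for n y
    proof -
      have "cmod (f n w - f n y) \<le> 2 * (b * M) / (r/2) * norm (w - y)"
      proof (rule holo_on_lipschitz[OF Bsp_holo[OF f] _ _ _ _ that])
        show "cmod (f n x) \<le> b * M" if "x \<in> ball w (2 * (r/2))" for x
        proof -
          have x: "x \<in> ball w r" "x \<in> \<Omega>" using that r(2) by auto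
          show ?thesis using fbd[OF x(2), of n] mult_left_mono[OF r(3)[OF x(1)] b0] by linarith
        qed
      qed (use r in auto)
      also have "\<dots> \<le> L * norm (w - y)" by (intro mult_right_mono) (auto simp: L_def)
      finally show ?thesis .
    qed
    show ?thesis unfolding convergent_eq_Cauchy
    proof (rule CauchyI)
      fix e :: real assume e: "e > 0"
      define \<eta> where "\<eta> = min (r/2) (e / (3 * L))"
      have \<eta>: "\<eta> > 0" using e L r(1) by (simp add: \<eta>_def)
      then have "ball w \<eta> \<noteq> {}" by simp
      from D(2)[OF open_ball this] obtain q where q: "q \<in> D" "q \<in> ball w \<eta>" by blast
      have qr: "q \<in> ball w (r/2)" "q \<in> \<Omega>" using q(2) r(1,2) by (auto simp: \<eta>_def subset_iff)
      have "L * norm (w - q) < L * (e / (3 * L))"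
        using q(2) L by (intro mult_strict_left_mono) (auto simp: \<eta>_def dist_norm)
      then have close: "cmod (f n w - f n q) < e/3" for n using lip[OF qr(1), of n] L by simp
      have "Cauchy (\<lambda>n. f (k n) q)" using kD[of q] q(1) qr(2) convergent_eq_Cauchy by blast
      then obtain n0 where n0: "\<And>m n. m \<ge> n0 \<Longrightarrow> n \<ge> n0 \<Longrightarrow> cmod (f (k m) q - f (k n) q) < e/3"
        using CauchyD[of "\<lambda>n. f (k n) q" "e/3"] e by auto
      have "cmod (f (k m) w - f (k n) w) < e" if "m \<ge> n0" "n \<ge> n0" for m n
      proof -
        have "cmod (f (k m) w - f (k n) w) \<le> cmod (f (k m) w - f (k m) q) + cmod (f (k m) q - f (k n) q) + cmod (f (k n) w - f (k n) q)"
          using norm_triangle_ineq[of "f (k m) w - f (k m) q" "f (k m) q - f (k n) q"]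
            norm_triangle_ineq4[of "f (k m) w - f (k n) q" "f (k n) w - f (k n) q"] by simp
        then show ?thesis using close[of "k m"] close[of "k n"] n0[OF that] by linarith
      qed
      then show "\<exists>M. \<forall>m\<ge>M. \<forall>n\<ge>M. norm (f (k m) w - f (k n) w) < e" by blast
    qed
  qed (use B_outside[OF f] in \<open>auto intro!: exI[of _ 0]\<close>)
  then obtain g where g: "\<And>w. (\<lambda>n. f (k n) w) \<longlonglongrightarrow> g w" by metis
  have gH: "g \<in> H" "nm g \<le> b"
    using L2_Fatou[of "\<lambda>n. f (k n)", OF Bsp_L2[OF f] g, of b] b b0 by auto
  have "holo_on \<Omega> g"
  proof (rule holo_on_bounded_pointwise_limit[where f = "\<lambda>n. f (k n)", OF Bsp_holo[OF f] open_dom _ g])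
    fix z assume "z \<in> \<Omega>"
    then obtain r M where r: "r > 0" "ball z r \<subseteq> \<Omega>" "\<And>u. u \<in> ball z r \<Longrightarrow> N u \<le> M"
      using N_locally_bounded by blast
    have "cmod (f (k n) w) \<le> b * M" if "w \<in> ball z r" for n w
    proof -
      have "w \<in> \<Omega>" using r(2) that by blast
      show ?thesis using fbd[OF \<open>w \<in> \<Omega>\<close>, of "k n"] mult_left_mono[OF r(3)[OF that] b0] by linarith
    qed
    then show "\<exists>r>0. \<exists>M. ball z r \<subseteq> \<Omega> \<and> (\<forall>n. \<forall>w\<in>ball z r. cmod (f (k n) w) \<le> M)"
      using r by blast
  qed
  with gH have "g \<in> B" by (simp add: Bsp_def)
  with k(1) gH g that show ?thesis by blast
qed

section \<open>Truncation to \<open>d\<close>-balls\<close>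

abbreviation D :: "real \<Rightarrow> 'n pt set" where "D r \<equiv> Met.mball 0 r"

lemma D_borel [measurable]: "D r \<in> sets borel"
  by (rule mball_borel) simp

lemma D_iff: "w \<in> D r \<longleftrightarrow> w \<in> \<Omega> \<and> d w 0 < r"
  by (auto simp: Met.commute)

text \<open>Closed \<open>d\<close>-balls are compact and \<open>N\<close> is continuous for
  \<open>d\<close>, so its image is a compact set of reals.\<close>

lemma N_bounded_D: obtains M where "M \<ge> 0" "\<And>w. w \<in> D r \<Longrightarrow> N w \<le> M"
proof -
  have "compactin Met.mtopology (Met.mcball 0 r)" "continuous_map Met.mtopology euclideanreal N"
    using SB by (auto simp: strong_bergman_type_def)
  then have "compact (N ` Met.mcball 0 r)" using image_compactin by fastforce
  then obtain M where M: "\<And>x. x \<in> N ` Met.mcball 0 r \<Longrightarrow> norm x \<le> M"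
    using compact_imp_bounded bounded_iff by metis
  have "N w \<le> max 0 M" if "w \<in> D r" for w
  proof -
    have "w \<in> Met.mcball 0 r" using that by auto
    then show ?thesis using M[of "N w"] by auto
  qed
  then show ?thesis using that[of "max 0 M"] by simp
qed

definition cut :: "real \<Rightarrow> 'n fn \<Rightarrow> 'n fn" where
  "cut r f = (\<lambda>w. indicator (D r) w * f w)"

lemma cut_in: "f \<in> H \<Longrightarrow> cut r f \<in> H" and cut_nrm: "f \<in> H \<Longrightarrow> nm (cut r f) \<le> nm f"
proof -
  have m: "indicator (D r) \<in> borel_measurable \<sigma>" by measurable
  show "f \<in> H \<Longrightarrow> cut r f \<in> H" "f \<in> H \<Longrightarrow> nm (cut r f) \<le> nm f"
    unfolding cut_def using L2_bounded_mult[of f \<Omega> \<sigma> "indicator (D r)" 1, OF _ m] by (auto simp: indicator_def)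
qed

text \<open>On a \<open>d\<close>-ball the kernel bound dominates the sequence by a constant, which
  is square integrable because \<open>\<sigma>\<close> is finite.\<close>

lemma cut_tendsto_zero:
  assumes f: "\<And>n. f n \<in> B" and b: "\<And>n. nm (f n) \<le> b" and lim: "\<And>w. (\<lambda>n. f n w) \<longlonglongrightarrow> 0"
  shows "(\<lambda>n. nm (cut r (f n))) \<longlonglongrightarrow> 0"
proof -
  obtain M where M: "M \<ge> 0" "\<And>w. w \<in> D r \<Longrightarrow> N w \<le> M" using N_bounded_D by blast
  have b0: "0 \<le> b" using b[of 0] nrm_nonneg order_trans by blast
  show ?thesis
  proof (rule nrm_dominated_convergence[where G = "\<lambda>w. b * M"])
    show "cut r (f n) \<in> H" for n by (rule cut_in[OF Bsp_L2[OF f]])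
    show "(\<lambda>n. cut r (f n) w) \<longlonglongrightarrow> 0" for w
      unfolding cut_def using tendsto_mult_right_zero[OF lim] by blast
    show "cmod (cut r (f n) w) \<le> b * M" for n w
    proof (cases "w \<in> D r")
      case True
      then have w: "w \<in> \<Omega>" by auto
      have "cmod (f n w) \<le> nm (f n) * N w" by (rule point_bound[OF f w])
      also have "\<dots> \<le> b * M" by (intro mult_mono b M(2) True b0) auto
      finally show ?thesis using True by (simp add: cut_def)
    qed (use b0 M(1) in \<open>auto simp: cut_def\<close>)
  qed simp
qed

text \<open>The operators \<open>V T z\<close> tend to zero strongly and are uniformly bounded, and
  \<open>P\<close> after truncation is compact; the product therefore tends to zero in norm. The
  argument is by contradiction along unit vectors.\<close>

lemma V_P_cut_tendsto_zero:
  assumes T: "bop T C" and van: "\<And>f. f \<in> B \<Longrightarrow> vanishes_at_inf \<Omega> d (\<lambda>z. nm (V T z f))" and "\<delta> > 0"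
  shows "\<exists>R. \<forall>z\<in>\<Omega>. d z 0 > R \<longrightarrow> (\<forall>g\<in>H. nm (V T z (P (cut r g))) \<le> \<delta> * nm g)"
proof (rule ccontr)
  assume "\<not> ?thesis"
  then have "\<forall>n::nat. \<exists>z g. z \<in> \<Omega> \<and> d z 0 > real n \<and> g \<in> H \<and> nm (V T z (P (cut r g))) > \<delta> * nm g"
    by (force simp: not_le)
  then obtain z g where z: "\<And>n. z n \<in> \<Omega>" "\<And>n. d (z n) 0 > real n" and g: "\<And>n. g n \<in> H"
      and big: "\<And>n. nm (V T (z n) (P (cut r (g n)))) > \<delta> * nm (g n)" by metis
  have cutH: "cut r (g n) \<in> H" for n by (rule cut_in[OF g])
  have pos: "nm (g n) > 0" for n
  proof (rule ccontr)
    assume "\<not> nm (g n) > 0"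
    then have 0: "nm (g n) = 0" using nrm_nonneg[of \<sigma> "g n"] by linarith
    have "nm (V T (z n) (P (cut r (g n)))) \<le> C * nm (P (cut r (g n)))" by (rule V_nrm[OF T z(1) P_in[OF cutH]])
    also have "\<dots> \<le> C * nm (g n)"
      using P_nrm[OF cutH[of n]] cut_nrm[OF g[of n], of r] by (intro mult_left_mono bopD(1)[OF T]) linarith
    finally show False using big[of n] 0 by simp
  qed
  define e where "e = (\<lambda>n w. of_real (1 / nm (g n)) * g n w)"
  have e: "e n \<in> H" "nm (e n) = 1" for n
  proof -
    show "e n \<in> H" unfolding e_def by (rule L2_cmult[OF g])
    show "nm (e n) = 1" unfolding e_def nrm_cmult norm_of_real using pos[of n] by simp
  qed
  have ecut: "cut r (e n) \<in> H" for n by (rule cut_in[OF e(1)])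
  define p where "p = (\<lambda>n. P (cut r (e n)))"
  have p: "p n \<in> B" "nm (p n) \<le> 1" for n
    using P_in[OF ecut] P_nrm[OF ecut[of n]] cut_nrm[OF e(1)[of n], of r] e(2)[of n] by (auto simp: p_def)
  have big': "nm (V T (z n) (p n)) > \<delta>" for n
  proof -
    have "cut r (e n) = (\<lambda>w. of_real (1 / nm (g n)) * cut r (g n) w)" by (auto simp: cut_def e_def)
    then have "p n = (\<lambda>w. of_real (1 / nm (g n)) * P (cut r (g n)) w)" by (simp only: p_def P_cmult[OF cutH])
    then have "V T (z n) (p n) = (\<lambda>w. of_real (1 / nm (g n)) * V T (z n) (P (cut r (g n))) w)"
      by (simp only: bopD(4)[OF V_bop[OF T z(1)] P_in[OF cutH]])
    then have "nm (V T (z n) (p n)) = nm (V T (z n) (P (cut r (g n)))) / nm (g n)"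
      using pos[of n] by (simp only: nrm_cmult norm_of_real) simp
    then show ?thesis using big[of n] pos[of n] by (simp only: pos_less_divide_eq)
  qed
  obtain k :: "nat \<Rightarrow> nat" and q where k: "strict_mono k" and q: "q \<in> B" "nm q \<le> 1" "\<And>w. (\<lambda>n. p (k n) w) \<longlonglongrightarrow> q w"
    by (rule B_Montel[OF p]) (rule that)
  define s where "s = (\<lambda>n w. p (k n) w - q w)"
  have s: "s n \<in> B" "nm (s n) \<le> 2" for n
    using Bsp_diff[OF p(1) q(1)] nrm_triangle_diff[OF Bsp_L2[OF p(1)] Bsp_L2[OF q(1)], of "k n"] p(2)[of "k n"] q(2)
    by (auto simp: s_def)
  have cut0: "(\<lambda>n. nm (cut r (s n))) \<longlonglongrightarrow> 0"
  proof (rule cut_tendsto_zero[OF s])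
    show "(\<lambda>n. s n w) \<longlonglongrightarrow> 0" for w
      unfolding s_def using tendsto_diff[OF q(3) tendsto_const, of w "q w"] by simp
  qed
  \<comment> \<open>Write the difference \<open>x\<close> of two images as \<open>P y\<close>. Then
    its squared norm is the pairing of \<open>y\<close> with \<open>x\<close>, and the truncation
    can be moved onto \<open>x\<close>, where it makes pointwise null sequences small in
    norm.\<close>
  have key: "(nm (\<lambda>w. p (k n) w - p (k m) w))\<^sup>2 \<le> 2 * (nm (cut r (s n)) + nm (cut r (s m)))" for n m
  proof -
    let ?x = "\<lambda>w. p (k n) w - p (k m) w" and ?y = "\<lambda>w. cut r (e (k n)) w - cut r (e (k m)) w"
    have x: "?x \<in> B" by (intro Bsp_diff p)
    have y: "?y \<in> H" by (intro L2_diff ecut)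
    have "?x = P ?y" unfolding p_def using P_diff[OF ecut ecut] by simp
    then have "ip \<sigma> ?x ?x = ip \<sigma> ?y ?x" using P_ip[OF y x] by simp
    also have "ip \<sigma> ?y ?x = ip \<sigma> (\<lambda>w. e (k n) w - e (k m) w) (cut r ?x)"
      unfolding ip_def cut_def by (intro Bochner_Integration.integral_cong) (auto simp: indicator_def)
    finally have "(nm ?x)\<^sup>2 = cmod (ip \<sigma> (\<lambda>w. e (k n) w - e (k m) w) (cut r ?x))"
      unfolding ip_self by (metis abs_of_nonneg norm_of_real zero_le_power2)
    also have "\<dots> \<le> nm (\<lambda>w. e (k n) w - e (k m) w) * nm (cut r ?x)"
      by (intro ip_Cauchy_Schwarz[of _ \<Omega>] L2_diff e cut_in Bsp_L2[OF x])
    also have "\<dots> \<le> 2 * (nm (cut r (s n)) + nm (cut r (s m)))"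
    proof (rule mult_mono)
      show "nm (\<lambda>w. e (k n) w - e (k m) w) \<le> 2"
        using nrm_triangle_diff[OF e(1) e(1), of "k n" "k m"] e(2) by simp
      have "cut r ?x = (\<lambda>w. cut r (s n) w - cut r (s m) w)" by (auto simp: cut_def s_def algebra_simps)
      then show "nm (cut r ?x) \<le> nm (cut r (s n)) + nm (cut r (s m))"
        using nrm_triangle_diff[OF cut_in[OF Bsp_L2[OF s(1)]] cut_in[OF Bsp_L2[OF s(1)]], of r n r m] by simp
    qed auto
    finally show ?thesis .
  qed
  have s0: "(\<lambda>n. nm (s n)) \<longlonglongrightarrow> 0"
  proof (rule LIMSEQ_I)
    fix t :: real assume t: "t > 0"
    have "t\<^sup>2 / 16 > 0" using t by simp
    then obtain n0 where n0: "\<And>n. n \<ge> n0 \<Longrightarrow> nm (cut r (s n)) < t\<^sup>2 / 16"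
      using LIMSEQ_D[OF cut0] by (metis abs_of_nonneg diff_zero nrm_nonneg real_norm_def)
    \<comment> \<open>\<open>key\<close> bounds the squared distance of two late terms by
      \<open>2 * (t\<^sup>2 / 16 + t\<^sup>2 / 16)\<close>, a quarter of \<open>t\<^sup>2\<close>;
      letting \<open>m\<close> tend to infinity replaces \<open>p (k m)\<close> by
      \<open>q\<close>.\<close>
    have "nm (s n) \<le> t/2" if n: "n \<ge> n0" for n
      unfolding s_def
    proof (rule L2_Fatou(2)[where f = "\<lambda>m w. p (k n) w - p (k m) w"])
      show "(\<lambda>w. p (k n) w - p (k m) w) \<in> H" for m by (intro L2_diff Bsp_L2 p)
      show "(\<lambda>m. p (k n) w - p (k m) w) \<longlonglongrightarrow> p (k n) w - q w" for w by (intro tendsto_intros q)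
      have "nm (\<lambda>w. p (k n) w - p (k m) w) \<le> t/2" if "m \<ge> n0" for m
        by (rule power2_le_imp_le) (use key[of n m] n0[OF n] n0[OF that] t in \<open>auto simp: power_divide\<close>)
      then show "\<forall>\<^sub>F m in sequentially. nm (\<lambda>w. p (k n) w - p (k m) w) \<le> t/2"
        by (auto simp: eventually_sequentially)
    qed (use t in simp)
    then show "\<exists>n0. \<forall>n\<ge>n0. norm (nm (s n) - 0) < t"
      using t by (intro exI[of _ n0]) force
  qed
  obtain R where R: "\<And>z. z \<in> \<Omega> \<Longrightarrow> d z 0 > R \<Longrightarrow> nm (V T z q) < \<delta>/2"
    using van[OF q(1)] \<open>\<delta> > 0\<close> unfolding vanishes_at_inf_def by (metis abs_of_nonneg half_gt_zero nrm_nonneg)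
  have Cs: "(\<lambda>n. C * nm (s n)) \<longlonglongrightarrow> 0" by (rule tendsto_mult_right_zero[OF s0])
  have d2: "\<delta>/2 > 0" using \<open>\<delta> > 0\<close> by simp
  obtain n1 where n1: "\<And>n. n \<ge> n1 \<Longrightarrow> norm (C * nm (s n) - 0) < \<delta>/2"
    using LIMSEQ_D[OF Cs d2] by blast
  obtain n2 :: nat where n2: "real n2 \<ge> R" using real_arch_simple by blast
  define n where "n = max n1 n2"
  have zk: "z (k n) \<in> \<Omega>" "d (z (k n)) 0 > R"
    using z(1) z(2)[of "k n"] seq_suble[OF k, of n] n2 by (auto simp: n_def)
  have "nm (V T (z (k n)) (p (k n))) \<le> nm (V T (z (k n)) q) + nm (\<lambda>w. V T (z (k n)) (p (k n)) w - V T (z (k n)) q w)"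
    by (intro nrm_le_add_diff[of _ \<Omega>] Bsp_L2 V_in[OF T zk(1)] p q)
  also have "(\<lambda>w. V T (z (k n)) (p (k n)) w - V T (z (k n)) q w) = V T (z (k n)) (s n)"
    unfolding s_def by (rule bop_diff[OF V_bop[OF T zk(1)] p(1) q(1), symmetric])
  also have "nm \<dots> \<le> C * nm (s n)" by (rule V_nrm[OF T zk(1) s(1)])
  finally have "nm (V T (z (k n)) (p (k n))) < \<delta>"
    using R[OF zk] n1[of n] abs_ge_self[of "C * nm (s n)"] by (simp add: n_def)
  then show False using big'[of "k n"] by simp
qed

end

subsection \<open>Slowly varying partitions and the Schur weight\<close>

text \<open>In the Schur test the second integral may be infinite. Positivity of \<open>A\<close>
  makes the right side infinite then.\<close>

lemma nn_integral_Cauchy_Schwarz_power2: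
  fixes f g :: "'a \<Rightarrow> real"
  assumes [measurable]: "f \<in> borel_measurable M" "g \<in> borel_measurable M"
    and nonneg: "\<And>x. f x \<ge> 0" "\<And>x. g x \<ge> 0"
    and A: "(\<integral>\<^sup>+x. ennreal ((f x)\<^sup>2) \<partial>M) \<le> ennreal A" "A > 0"
  shows "(\<integral>\<^sup>+x. ennreal (f x * g x) \<partial>M)\<^sup>2 \<le> ennreal A * (\<integral>\<^sup>+x. ennreal ((g x)\<^sup>2) \<partial>M)"
proof (cases "(\<integral>\<^sup>+x. ennreal ((g x)\<^sup>2) \<partial>M) = \<infinity>")
  case True
  then show ?thesis using A(2) by (simp add: ennreal_mult_top)
next
  case False
  then obtain b where b: "(\<integral>\<^sup>+x. ennreal ((g x)\<^sup>2) \<partial>M) = ennreal b" "b \<ge> 0"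
    by (cases "\<integral>\<^sup>+x. ennreal ((g x)\<^sup>2) \<partial>M") auto
  have "(\<integral>\<^sup>+x. ennreal (f x * g x) \<partial>M) \<le> ennreal (sqrt (A * b))"
    by (rule nn_integral_Cauchy_Schwarz) (use assms b in auto)
  then have "(\<integral>\<^sup>+x. ennreal (f x * g x) \<partial>M)\<^sup>2 \<le> (ennreal (sqrt (A * b)))\<^sup>2"
    by (rule power_mono) simp
  also have "\<dots> = ennreal A * ennreal b"
    using A(2) b(2) by (simp add: ennreal_power ennreal_mult)
  finally show ?thesis using b by simp
qed

text \<open>To be read with \<open>a\<close> the modulus of the kernel at \<open>z\<close> and
  \<open>w\<close>, \<open>b = N z\<close> and \<open>c = N w\<close>, so that
  \<open>a / (b * c)\<close> is \<open>1 / N (\<phi> z w)\<close>. The left side is the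
  Rudin-Forelli integrand with its density, times a weight and the spare factor with exponent
  \<delta>.\<close>

lemma powr_schur_identity:
  fixes a b c s \<delta> :: real
  assumes "a > 0" "b > 0" "c > 0"
  shows "c\<^sup>2 * (a powr (1 - \<delta>) / (b powr (s - \<delta>) * c powr (2 - s - \<delta>))) * (b powr s * (a / (b * c)) powr \<delta>) = a * c powr s"
proof -
  obtain x y z where abc: "a = exp x" "b = exp y" "c = exp z"
    using assms by (metis exp_ln)
  have "c\<^sup>2 = exp (2 * z)" by (simp add: abc exp_double)
  moreover have "a / (b * c) = exp (x - y - z)" by (simp add: abc exp_diff)
  ultimately show ?thesis
    by (simp add: abc powr_def flip: exp_add exp_diff) (simp add: algebra_simps)
qed

context bergman
begin

section \<open>Tent functions and their normalisation\<close>

definition G :: "real \<Rightarrow> 'n pt \<Rightarrow> 'n pt \<Rightarrow> real" where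
  "G \<rho> y z = (if y \<in> \<Omega> \<and> z \<in> \<Omega> then max 0 (1 - dx y z / \<rho>) else 0)"

lemma G_measurable [measurable (raw)]:
  assumes [measurable]: "f \<in> borel_measurable M" "g \<in> borel_measurable M"
  shows "(\<lambda>x. G \<rho> (f x) (g x)) \<in> borel_measurable M"
  unfolding G_def by measurable

lemma G_nonneg [simp]: "0 \<le> G \<rho> y z"
  by (simp add: G_def)

lemma G_le_1: "\<rho> > 0 \<Longrightarrow> G \<rho> y z \<le> 1"
  by (simp add: G_def dx_def)

lemma G_support: "\<rho> > 0 \<Longrightarrow> G \<rho> y z \<noteq> 0 \<Longrightarrow> y \<in> \<Omega> \<and> z \<in> \<Omega> \<and> d y z < \<rho>"
  by (auto simp: G_def dx_def max_def field_simps split: if_splits)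

lemma G_commute: "G \<rho> y z = G \<rho> z y"
  by (auto simp: G_def dx_def Met.commute)

lemma G_lipschitz:
  assumes "\<rho> > 0" and z: "z \<in> \<Omega>" and w: "w \<in> \<Omega>"
  shows "\<bar>G \<rho> y z - G \<rho> y w\<bar> \<le> d z w / \<rho>"
proof (cases "y \<in> \<Omega>")
  case True
  have "d y z \<le> d y w + d z w" "d y w \<le> d y z + d z w"
    using Met.triangle[OF True w z] Met.triangle[OF True z w] Met.commute[of w z] by auto
  then have "\<bar>d y z - d y w\<bar> / \<rho> \<le> d z w / \<rho>"
    using assms(1) by (intro divide_right_mono) auto
  moreover have "\<bar>max 0 (1 - d y z / \<rho>) - max 0 (1 - d y w / \<rho>)\<bar> \<le> \<bar>d y z / \<rho> - d y w / \<rho>\<bar>" by auto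
  moreover have "\<bar>d y z / \<rho> - d y w / \<rho>\<bar> = \<bar>d y z - d y w\<bar> / \<rho>"
    using assms(1) by (simp add: diff_divide_distrib[symmetric] abs_divide)
  ultimately show ?thesis using True z w by (simp add: G_def dx_def)
next
  case False
  then show ?thesis using assms by (simp add: G_def)
qed

lemma G_phix: "z \<in> \<Omega> \<Longrightarrow> G \<rho> (phix z y) 0 = G \<rho> y z"
  by (auto simp: G_def dx_def phix_def d_phi_zero)

definition Ig :: "real \<Rightarrow> ennreal" where
  "Ig \<rho> = (\<integral>\<^sup>+y. ennreal ((G \<rho> y 0)\<^sup>2) \<partial>lm)"

text \<open>\<open>\<phi> z\<close> carries the tent at \<open>z\<close> to the tent at 0 and
  preserves the measure.\<close>

lemma G_integral: "z \<in> \<Omega> \<Longrightarrow> (\<integral>\<^sup>+y. ennreal ((G \<rho> y z)\<^sup>2) \<partial>lm) = Ig \<rho>"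
  using nn_integral_phi[of z "\<lambda>y. ennreal ((G \<rho> y 0)\<^sup>2)"] by (simp add: Ig_def G_phix)

lemma lm_ball: assumes z: "z \<in> \<Omega>" shows "emeasure lm (Met.mball z r) = emeasure lm (D r)"
proof -
  have [measurable]: "Met.mball z r \<in> sets borel" by (rule mball_borel[OF z])
  have "phix z y \<in> D r \<longleftrightarrow> y \<in> Met.mball z r" for y
  proof -
    have "y \<in> Met.mball z r \<longleftrightarrow> y \<in> \<Omega> \<and> d y z < r" using z by (auto simp: Met.commute)
    then show ?thesis
      unfolding D_iff[of "phix z y"] using z by (cases "y \<in> \<Omega>") (simp_all add: phix_def d_phi_zero)
  qed
  then have "indicator (D r) (phix z y) = (indicator (Met.mball z r) y :: ennreal)" for y
    unfolding indicator_def by presburger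
  then show ?thesis
    using nn_integral_phi[OF z, of "indicator (D r)"] by simp
qed

lemma lm_D_finite: "emeasure lm (D r) < \<infinity>"
proof -
  obtain M where M: "M \<ge> 0" "\<And>w. w \<in> D r \<Longrightarrow> N w \<le> M" using N_bounded_D by blast
  have "emeasure lm (D r) = (\<integral>\<^sup>+w. ennreal ((Nx w)\<^sup>2) * indicator (D r) w \<partial>\<sigma>)"
    using nn_integral_lm[of "indicator (D r)"] by simp
  also have "\<dots> \<le> (\<integral>\<^sup>+w. ennreal (M\<^sup>2) \<partial>\<sigma>)"
    using M by (intro nn_integral_mono) (auto simp: indicator_def Nx_def intro!: ennreal_leI power_mono)
  also have "\<dots> < \<infinity>" 
  proof -
    have "emeasure \<sigma> UNIV < top" by (metis emeasure_finite infinity_ennreal_def top.not_eq_extremum)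
    then show ?thesis by (simp add: ennreal_mult_less_top)
  qed
  finally show ?thesis .
qed

lemma doubling:
  obtains C where "C \<ge> 0" "\<And>r. r > 0 \<Longrightarrow> emeasure lm (D (2 * r)) \<le> ennreal C * emeasure lm (D r)"
proof -
  have "\<exists>C. \<forall>z\<in>\<Omega>. \<forall>r>0. emeasure lm (Met.mball z (2 * r)) \<le> ennreal C * emeasure lm (Met.mball z r)"
    using SB by (simp add: strong_bergman_type_def)
  then obtain C where C: "\<forall>z\<in>\<Omega>. \<forall>r>0. emeasure lm (Met.mball z (2 * r)) \<le> ennreal C * emeasure lm (Met.mball z r)" ..
  have "emeasure lm (D (2 * r)) \<le> ennreal (max 0 C) * emeasure lm (D r)" if "r > 0" for r
  proof -
    have "emeasure lm (D (2 * r)) \<le> ennreal C * emeasure lm (D r)" using C that by auto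
    also have "\<dots> \<le> ennreal (max 0 C) * emeasure lm (D r)" by (intro mult_right_mono ennreal_leI) auto
    finally show ?thesis .
  qed
  then show ?thesis using that[of "max 0 C"] by simp
qed

text \<open>If one ball were null, doubling would make all its dilates null, hence \<Omega> itself.
  But \<open>N\<close> is at least 1, so \<Omega> has measure at least the squared norm of
  \<open>K 0\<close>, which is 1.\<close>

lemma lm_D_pos: assumes "r > 0" shows "emeasure lm (D r) > 0"
proof (rule ccontr)
  assume "\<not> ?thesis"
  then have 0: "emeasure lm (D r) = 0" by simp
  obtain C where C: "C \<ge> 0" "\<And>r. r > 0 \<Longrightarrow> emeasure lm (D (2 * r)) \<le> ennreal C * emeasure lm (D r)"
    using doubling by blast
  have all0: "emeasure lm (D (2 ^ n * r)) = 0" for n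
  proof (induction n)
    case (Suc n)
    have "emeasure lm (D (2 * (2 ^ n * r))) \<le> 0" using C(2)[of "2 ^ n * r"] Suc assms by simp
    then show ?case by (simp add: mult.assoc)
  qed (use 0 in simp)
  have "emeasure lm (\<Union>n. D (2 ^ n * r)) = 0" by (rule emeasure_UN_eq_0) (auto simp: all0)
  moreover have "\<Omega> \<subseteq> (\<Union>n. D (2 ^ n * r))"
  proof
    fix w assume w: "w \<in> \<Omega>"
    obtain n where "d w 0 / r < 2 ^ n" using real_arch_pow[of 2 "d w 0 / r"] by auto
    then have "w \<in> D (2 ^ n * r)" unfolding D_iff using w assms by (simp add: field_simps)
    then show "w \<in> (\<Union>n. D (2 ^ n * r))" by blast
  qed
  ultimately have z: "emeasure lm \<Omega> = 0" 
    using emeasure_mono[of \<Omega> "\<Union>n. D (2 ^ n * r)" lm] by simp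
  have "ennreal ((N 0)\<^sup>2) = (\<integral>\<^sup>+w. ennreal ((cmod (K 0 w))\<^sup>2) \<partial>\<sigma>)"
    using nn_integral_L2[OF K_L2[OF zero_in]] by simp
  also have "\<dots> \<le> (\<integral>\<^sup>+w. ennreal ((Nx w)\<^sup>2) * indicator \<Omega> w \<partial>\<sigma>)"
  proof (rule nn_integral_mono)
    fix w show "ennreal ((cmod (K 0 w))\<^sup>2) \<le> ennreal ((Nx w)\<^sup>2) * indicator \<Omega> w"
    proof (cases "w \<in> \<Omega>")
      case True
      have "1 \<le> (N w)\<^sup>2" using N_ge_1[OF True] by (rule one_le_power)
      from ennreal_leI[OF this] show ?thesis using True by (simp add: Nx_def)
    qed (use B_outside[OF K_in[OF zero_in], of w] in simp)
  qed
  also have "\<dots> = emeasure lm \<Omega>" using nn_integral_lm[of "indicator \<Omega>"] by simp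
  finally show False using z by simp
qed

text \<open>The tent is at least 1/2 on the half ball. Combined with doubling this compares the
  normalising constant with the measure of the full support.\<close>

lemma Ig_lower: assumes "\<rho> > 0" shows "emeasure lm (D (\<rho>/2)) \<le> 4 * Ig \<rho>"
proof -
  have "ennreal (1/4) * emeasure lm (D (\<rho>/2)) = (\<integral>\<^sup>+y. ennreal (1/4) * indicator (D (\<rho>/2)) y \<partial>lm)"
    by (simp add: nn_integral_cmult)
  also have "\<dots> \<le> Ig \<rho>"
    unfolding Ig_def
  proof (rule nn_integral_mono)
    fix y
    have "1/4 \<le> (G \<rho> y 0)\<^sup>2" if "y \<in> D (\<rho>/2)"
    proof -
      have y: "y \<in> \<Omega>" "d y 0 < \<rho>/2" using that unfolding D_iff by auto
      have "1/2 \<le> G \<rho> y 0" using y assms by (simp add: G_def dx_def max_def field_simps)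
      from power_mono[OF this, of 2] show ?thesis by (simp add: power_divide)
    qed
    then show "ennreal (1/4) * indicator (D (\<rho>/2)) y \<le> ennreal ((G \<rho> y 0)\<^sup>2)"
      by (auto simp: indicator_def intro!: ennreal_leI)
  qed
  finally have "ennreal 4 * (ennreal (1/4) * emeasure lm (D (\<rho>/2))) \<le> ennreal 4 * Ig \<rho>"
    by (rule mult_left_mono) simp
  moreover have four: "ennreal 4 * ennreal (1/4) = 1" by (subst ennreal_mult[symmetric]) auto
  ultimately show ?thesis unfolding mult.assoc[symmetric] four by simp
qed

lemma Ig_pos: "\<rho> > 0 \<Longrightarrow> Ig \<rho> > 0"
  using Ig_lower[of \<rho>] lm_D_pos[of "\<rho>/2"] by (metis half_gt_zero mult_zero_right not_gr_zero not_less zero_le)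

lemma Ig_finite: "\<rho> > 0 \<Longrightarrow> Ig \<rho> < \<infinity>"
proof -
  assume \<rho>: "\<rho> > 0"
  have "Ig \<rho> \<le> (\<integral>\<^sup>+y. indicator (D \<rho>) y \<partial>lm)"
    unfolding Ig_def
  proof (rule nn_integral_mono)
    fix y
    have "G \<rho> y 0 \<le> 1" "y \<notin> D \<rho> \<Longrightarrow> G \<rho> y 0 = 0" using G_le_1[OF \<rho>] G_support[OF \<rho>, of y 0] D_iff by blast+
    then show "ennreal ((G \<rho> y 0)\<^sup>2) \<le> indicator (D \<rho>) y"
      by (auto simp: indicator_def power_le_one simp flip: ennreal_1 intro!: ennreal_leI)
  qed
  also have "\<dots> < \<infinity>" using lm_D_finite by simp
  finally show ?thesis .
qed

definition ig :: "real \<Rightarrow> real" where "ig \<rho> = enn2real (Ig \<rho>)"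

lemma ig: assumes "\<rho> > 0" shows "ennreal (ig \<rho>) = Ig \<rho>" "ig \<rho> > 0"
  using Ig_pos[OF assms] Ig_finite[OF assms] by (auto simp: ig_def enn2real_positive_iff)

text \<open>By invariance of \<open>\<lambda>\<close> the normalising constant \<open>ig \<rho>\<close> does not depend on \<open>z\<close>.\<close>

definition hh :: "real \<Rightarrow> 'n pt \<Rightarrow> 'n pt \<Rightarrow> real" where
  "hh \<rho> y z = G \<rho> y z / sqrt (ig \<rho>)"

lemma hh_measurable [measurable (raw)]:
  assumes [measurable]: "f \<in> borel_measurable M" "g \<in> borel_measurable M"
  shows "(\<lambda>x. hh \<rho> (f x) (g x)) \<in> borel_measurable M"
  unfolding hh_def by measurable

lemma hh_nonneg: "\<rho> > 0 \<Longrightarrow> 0 \<le> hh \<rho> y z"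
  using ig(2)[of \<rho>] by (simp add: hh_def)

lemma hh_le: "\<rho> > 0 \<Longrightarrow> hh \<rho> y z \<le> 1 / sqrt (ig \<rho>)"
  using ig(2)[of \<rho>] G_le_1[of \<rho>] by (simp add: hh_def divide_right_mono)

lemma hh_support: "\<rho> > 0 \<Longrightarrow> hh \<rho> y z \<noteq> 0 \<Longrightarrow> y \<in> \<Omega> \<and> z \<in> \<Omega> \<and> d y z < \<rho>"
  using G_support[of \<rho> y z] by (auto simp: hh_def)

lemma hh_square_integral:
  assumes "\<rho> > 0" "z \<in> \<Omega>"
  shows "(\<integral>\<^sup>+y. ennreal ((hh \<rho> y z)\<^sup>2) \<partial>lm) = 1"
proof -
  have i: "ig \<rho> > 0" by (rule ig(2)[OF assms(1)])
  have "(\<integral>\<^sup>+y. ennreal ((hh \<rho> y z)\<^sup>2) \<partial>lm) = (\<integral>\<^sup>+y. ennreal (1 / ig \<rho>) * ennreal ((G \<rho> y z)\<^sup>2) \<partial>lm)"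
    using i by (intro nn_integral_cong) (simp add: hh_def power_divide ennreal_mult[symmetric])
  also have "\<dots> = ennreal (1 / ig \<rho>) * ennreal (ig \<rho>)"
    by (simp add: nn_integral_cmult G_integral[OF assms(2)] ig(1)[OF assms(1)])
  also have "\<dots> = 1" using i by (simp add: ennreal_mult[symmetric])
  finally show ?thesis .
qed

text \<open>The bound for distant pairs; the mixed term has a favourable sign because the tents are
  nonnegative.\<close>

lemma hh_diff_integral_le_2:
  assumes "\<rho> > 0" "z \<in> \<Omega>" "w \<in> \<Omega>"
  shows "(\<integral>\<^sup>+y. ennreal ((hh \<rho> y z - hh \<rho> y w)\<^sup>2) \<partial>lm) \<le> 2"
proof -
  have "(\<integral>\<^sup>+y. ennreal ((hh \<rho> y z - hh \<rho> y w)\<^sup>2) \<partial>lm)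
      \<le> (\<integral>\<^sup>+y. ennreal ((hh \<rho> y z)\<^sup>2) + ennreal ((hh \<rho> y w)\<^sup>2) \<partial>lm)"
  proof (rule nn_integral_mono)
    fix y
    have "0 \<le> hh \<rho> y z * hh \<rho> y w" using hh_nonneg[OF assms(1)] by simp
    then have "(hh \<rho> y z - hh \<rho> y w)\<^sup>2 \<le> (hh \<rho> y z)\<^sup>2 + (hh \<rho> y w)\<^sup>2" by (simp add: power2_diff mult.commute)
    then show "ennreal ((hh \<rho> y z - hh \<rho> y w)\<^sup>2) \<le> ennreal ((hh \<rho> y z)\<^sup>2) + ennreal ((hh \<rho> y w)\<^sup>2)"
      by (simp add: ennreal_plus[symmetric] ennreal_leI del: ennreal_plus)
  qed
  also have "\<dots> = 1 + 1"
    by (simp add: nn_integral_add hh_square_integral[OF assms(1,2)] hh_square_integral[OF assms(1,3)])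
  finally show ?thesis by simp
qed

text \<open>The bound for nearby pairs. The difference is at most \<open>d z w / \<rho>\<close>
  before normalisation and lives on two balls of radius \<rho>, whose measure doubling bounds by a
  multiple of \<open>ig \<rho>\<close>. Hence the constant is the same for all \<rho>.\<close>

lemma hh_diff_integral_le:
  obtains C where "C \<ge> 0" "\<And>\<rho> z w. \<rho> > 0 \<Longrightarrow> z \<in> \<Omega> \<Longrightarrow> w \<in> \<Omega> \<Longrightarrow>
    (\<integral>\<^sup>+y. ennreal ((hh \<rho> y z - hh \<rho> y w)\<^sup>2) \<partial>lm) \<le> ennreal (C * (d z w / \<rho>)\<^sup>2)"
proof -
  obtain C where C: "C \<ge> 0" "\<And>r. r > 0 \<Longrightarrow> emeasure lm (D (2 * r)) \<le> ennreal C * emeasure lm (D r)"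
    using doubling by blast
  have "(\<integral>\<^sup>+y. ennreal ((hh \<rho> y z - hh \<rho> y w)\<^sup>2) \<partial>lm) \<le> ennreal (8 * C * (d z w / \<rho>)\<^sup>2)"
    if \<rho>: "\<rho> > 0" and z: "z \<in> \<Omega>" and w: "w \<in> \<Omega>" for \<rho> z w
  proof -
    have i: "ig \<rho> > 0" by (rule ig(2)[OF \<rho>])
    have [measurable]: "Met.mball z \<rho> \<in> sets borel" "Met.mball w \<rho> \<in> sets borel" using z w mball_borel by auto
    define c where "c = (d z w / \<rho>)\<^sup>2 / ig \<rho>"
    have c: "c \<ge> 0" using i by (simp add: c_def)
    have "emeasure lm (D \<rho>) \<le> ennreal C * emeasure lm (D (\<rho>/2))" using C(2)[of "\<rho>/2"] \<rho> by simp
    also have "\<dots> \<le> ennreal C * (4 * Ig \<rho>)" by (intro mult_left_mono Ig_lower \<rho>) simp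
    also have "\<dots> = ennreal (4 * C * ig \<rho>)"
      unfolding ig(1)[OF \<rho>, symmetric] using C(1) i by (simp add: ennreal_mult mult_ac)
    finally have DC: "emeasure lm (D \<rho>) \<le> ennreal (4 * C * ig \<rho>)" .
    have "(\<integral>\<^sup>+y. ennreal ((hh \<rho> y z - hh \<rho> y w)\<^sup>2) \<partial>lm)
       \<le> (\<integral>\<^sup>+y. ennreal c * (indicator (Met.mball z \<rho>) y + indicator (Met.mball w \<rho>) y) \<partial>lm)"
    proof (rule nn_integral_mono)
      fix y
      have eq: "(hh \<rho> y z - hh \<rho> y w)\<^sup>2 = (G \<rho> y z - G \<rho> y w)\<^sup>2 / ig \<rho>"
        using i by (simp add: hh_def diff_divide_distrib[symmetric] power_divide)
      have "(G \<rho> y z - G \<rho> y w)\<^sup>2 \<le> (d z w / \<rho>)\<^sup>2"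
        using G_lipschitz[OF \<rho> z w, of y] by (metis abs_ge_zero power2_abs power_mono)
      then have le: "(hh \<rho> y z - hh \<rho> y w)\<^sup>2 \<le> c" unfolding eq c_def using i by (intro divide_right_mono) auto
      show "ennreal ((hh \<rho> y z - hh \<rho> y w)\<^sup>2) \<le> ennreal c * (indicator (Met.mball z \<rho>) y + indicator (Met.mball w \<rho>) y)"
      proof (cases "y \<in> Met.mball z \<rho> \<or> y \<in> Met.mball w \<rho>")
        case True
        have "ennreal ((hh \<rho> y z - hh \<rho> y w)\<^sup>2) \<le> ennreal c * 1" using le by (simp add: ennreal_leI)
        also have "\<dots> \<le> ennreal c * (indicator (Met.mball z \<rho>) y + indicator (Met.mball w \<rho>) y)"
          using True by (intro mult_left_mono) (auto simp: indicator_def)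
        finally show ?thesis .
      next
        case False
        then have "hh \<rho> y z = 0" "hh \<rho> y w = 0"
          using hh_support[OF \<rho>, of y z] hh_support[OF \<rho>, of y w] z w Met.commute[of y] by auto
        then show ?thesis by simp
      qed
    qed
    also have "\<dots> = ennreal c * (emeasure lm (D \<rho>) + emeasure lm (D \<rho>))"
      by (simp add: nn_integral_cmult nn_integral_add lm_ball[OF z] lm_ball[OF w])
    also have "\<dots> \<le> ennreal c * (ennreal (4 * C * ig \<rho>) + ennreal (4 * C * ig \<rho>))"
      by (intro mult_left_mono add_mono DC) simp
    also have "\<dots> = ennreal (c * (8 * C * ig \<rho>))"
      using c C(1) i by (simp add: ennreal_mult[symmetric] ennreal_plus[symmetric] del: ennreal_plus)
    also have "c * (8 * C * ig \<rho>) = 8 * C * (d z w / \<rho>)\<^sup>2" using i by (simp add: c_def)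
    finally show ?thesis .
  qed
  then show ?thesis using that[of "8 * C"] C(1) by simp
qed

section \<open>The Schur weight\<close>

text \<open>The kernel times the weight \<open>N powr s\<close> equals a Rudin-Forelli integrand
  times \<open>N z powr s\<close> and \<open>(1 / N (\<phi> z w)) powr \<delta>\<close>. The last
  factor is at most 1 everywhere and small for distant \<open>z\<close> and \<open>w\<close> by
  (A.7), which gives the two estimates.\<close>

lemma Schur_weight:
  assumes "\<kappa> > 0"
  obtains s M where "M > 0"
    "\<And>z. z \<in> \<Omega> \<Longrightarrow> (\<integral>\<^sup>+w. ennreal (cmod (Kx z w) * Nx w powr s) \<partial>\<sigma>) \<le> ennreal (M * N z powr s)"
    "\<And>\<epsilon>. \<epsilon> > 0 \<Longrightarrow> \<exists>t>0. \<forall>z\<in>\<Omega>.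
       (\<integral>\<^sup>+w. ennreal (cmod (Kx z w) * Nx w powr s) * indicator {w. dx z w > t} w \<partial>\<sigma>) \<le> ennreal (\<epsilon> * N z powr s)"
proof -
  have \<kappa>: "\<kappa> < 2" using SB by (simp add: strong_bergman_type_def)
  \<comment> \<open>With \<delta> half of \<open>s\<close>, the exponents
    \<open>s - \<delta>\<close> and \<open>2 - s - \<delta>\<close> lie strictly on the two sides of
    \<kappa>, and their mean is \<open>1 - \<delta>\<close>.\<close>
  define s where "s = min \<kappa> (2 - \<kappa>) / 2"
  define \<delta> where "\<delta> = s / 2"
  have s: "s > 0" "s < \<kappa>" "3 / 2 * s < 2 - \<kappa>" using assms \<kappa> by (auto simp: s_def min_def)
  have \<delta>: "\<delta> > 0" using s by (simp add: \<delta>_def)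
  have rs: "2 - s - \<delta> > \<kappa> \<and> \<kappa> > s - \<delta> \<and> s - \<delta> > 0" using s by (simp add: \<delta>_def)
  have "\<exists>M::real. \<forall>z\<in>\<Omega>. (\<integral>\<^sup>+ w. ennreal (cmod (ip \<sigma> (K z) (K w)) powr (((2 - s - \<delta>) + (s - \<delta>)) / 2)
                     / (N z powr (s - \<delta>) * N w powr (2 - s - \<delta>))) \<partial>lm) \<le> ennreal M"
    using SB assms rs unfolding strong_bergman_type_def Let_def by blast
  then obtain M' where M': "\<forall>z\<in>\<Omega>. (\<integral>\<^sup>+ w. ennreal (cmod (ip \<sigma> (K z) (K w)) powr (((2 - s - \<delta>) + (s - \<delta>)) / 2)
                     / (N z powr (s - \<delta>) * N w powr (2 - s - \<delta>))) \<partial>lm) \<le> ennreal M'" by blast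
  define M where "M = max 1 M'"
  have M: "M \<ge> 1" by (simp add: M_def)
  define J where "J = (\<lambda>z w. cmod (Kx z w) powr (1 - \<delta>) / (N z powr (s - \<delta>) * Nx w powr (2 - s - \<delta>)))"
  have Jm [measurable]: "J z \<in> borel_measurable borel" for z
    unfolding J_def by measurable
  have J_nonneg: "0 \<le> J z w" for z w by (simp add: J_def)
  have JM: "(\<integral>\<^sup>+w. ennreal ((Nx w)\<^sup>2) * ennreal (J z w) \<partial>\<sigma>) \<le> ennreal M" if z: "z \<in> \<Omega>" for z
  proof -
    have ex: "((2 - s - \<delta>) + (s - \<delta>)) / 2 = 1 - \<delta>" by simp
    have "(\<integral>\<^sup>+w. ennreal ((Nx w)\<^sup>2) * ennreal (J z w) \<partial>\<sigma>) = (\<integral>\<^sup>+w. ennreal (J z w) \<partial>lm)"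
      by (rule nn_integral_lm[symmetric]) measurable
    also have "\<dots> = (\<integral>\<^sup>+ w. ennreal (cmod (ip \<sigma> (K z) (K w)) powr (((2 - s - \<delta>) + (s - \<delta>)) / 2)
                     / (N z powr (s - \<delta>) * N w powr (2 - s - \<delta>))) \<partial>lm)"
      unfolding ex
    proof (rule nn_integral_cong_AE)
      show "AE w in lm. ennreal (J z w) = ennreal (cmod (ip \<sigma> (K z) (K w)) powr (1 - \<delta>)
                     / (N z powr (s - \<delta>) * N w powr (2 - s - \<delta>)))"
        using AE_lm_dom by eventually_elim (simp add: J_def Kx_def Nx_def K_ip[OF z] z)
    qed
    also have "\<dots> \<le> ennreal M'" using M' z by blast
    also have "\<dots> \<le> ennreal M" by (intro ennreal_leI) (simp add: M_def)
    finally show ?thesis .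
  qed
  have id: "cmod (Kx z w) * Nx w powr s = (Nx w)\<^sup>2 * J z w * (N z powr s * (1 / N (\<phi> z w)) powr \<delta>)"
    if z: "z \<in> \<Omega>" and w: "w \<in> \<Omega>" for z w
  proof -
    have "cmod (K z w) / (N z * N w) = 1 / N (\<phi> z w)" by (rule kernel_modulus_aux[OF z w])
    then show ?thesis
      using powr_schur_identity[of "cmod (K z w)" "N z" "N w" \<delta> s] z w K_nonzero[OF z w]
      by (simp add: J_def Kx_def Nx_def)
  qed
  \<comment> \<open>Serves both claims: \<open>c = 1\<close> on the whole space, and
    \<open>c = \<epsilon> / M\<close> far from \<open>z\<close>.\<close>
  have bound: "(\<integral>\<^sup>+w. ennreal (cmod (Kx z w) * Nx w powr s) * indicator A w \<partial>\<sigma>) \<le> ennreal (c * M * N z powr s)"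
    if z: "z \<in> \<Omega>" and c: "c \<ge> 0" "\<And>w. w \<in> \<Omega> \<Longrightarrow> w \<in> A \<Longrightarrow> (1 / N (\<phi> z w)) powr \<delta> \<le> c" for z c A
  proof -
    have "(\<integral>\<^sup>+w. ennreal (cmod (Kx z w) * Nx w powr s) * indicator A w \<partial>\<sigma>)
        \<le> (\<integral>\<^sup>+w. ennreal (c * N z powr s) * (ennreal ((Nx w)\<^sup>2) * ennreal (J z w)) \<partial>\<sigma>)"
    proof (rule nn_integral_mono)
      fix w
      show "ennreal (cmod (Kx z w) * Nx w powr s) * indicator A w
         \<le> ennreal (c * N z powr s) * (ennreal ((Nx w)\<^sup>2) * ennreal (J z w))"
      proof (cases "w \<in> \<Omega> \<and> w \<in> A")
        case True
        have "cmod (Kx z w) * Nx w powr s \<le> (Nx w)\<^sup>2 * J z w * (N z powr s * c)"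
          unfolding id[OF z conjunct1[OF True]] using True c(2)[of w] J_nonneg
          by (intro mult_left_mono) auto
        also have "\<dots> = c * N z powr s * ((Nx w)\<^sup>2 * J z w)" by simp
        finally show ?thesis
          using True c(1) J_nonneg by (simp add: ennreal_mult'[symmetric] ennreal_mult[symmetric] ennreal_leI)
      next
        case False
        then show ?thesis by (auto simp: Kx_def indicator_def)
      qed
    qed
    also have "\<dots> = ennreal (c * N z powr s) * (\<integral>\<^sup>+w. ennreal ((Nx w)\<^sup>2) * ennreal (J z w) \<partial>\<sigma>)"
      by (rule nn_integral_cmult) measurable
    also have "\<dots> \<le> ennreal (c * N z powr s) * ennreal M" by (intro mult_left_mono JM z) simp
    also have "\<dots> = ennreal (c * M * N z powr s)" using c(1) M by (simp add: ennreal_mult[symmetric] mult_ac)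
    finally show ?thesis .
  qed
  show ?thesis
  proof (rule that[of M s])
    show "M > 0" using M by simp
    fix z assume z: "z \<in> \<Omega>"
    have "(1 / N (\<phi> z w)) powr \<delta> \<le> 1" if "w \<in> \<Omega>" for w
      using N_ge_1[of "\<phi> z w"] z that \<delta> by (intro powr_le1) auto
    then show "(\<integral>\<^sup>+w. ennreal (cmod (Kx z w) * Nx w powr s) \<partial>\<sigma>) \<le> ennreal (M * N z powr s)"
      using bound[OF z, of 1 UNIV] by simp
  next
    fix \<epsilon> :: real assume \<epsilon>: "\<epsilon> > 0"
    \<comment> \<open>Chosen so that \<open>(1 / m) powr \<delta>\<close> is exactly
      \<open>\<epsilon> / M\<close>.\<close>
    define m where "m = (M / \<epsilon>) powr (1 / \<delta>)"
    have m: "m > 0" using M \<epsilon> by (simp add: m_def)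
    have md: "(1 / m) powr \<delta> = \<epsilon> / M"
      using M \<epsilon> \<delta> m by (simp add: powr_divide m_def powr_powr)
    have "\<exists>R. \<forall>z\<in>\<Omega>. d z 0 > R \<longrightarrow> N z > m"
      using SB by (simp add: strong_bergman_type_def)
    then obtain R where R: "\<forall>z\<in>\<Omega>. d z 0 > R \<longrightarrow> N z > m" ..
    have "(\<integral>\<^sup>+w. ennreal (cmod (Kx z w) * Nx w powr s) * indicator {w. dx z w > max R 1} w \<partial>\<sigma>) \<le> ennreal (\<epsilon> * N z powr s)"
      if z: "z \<in> \<Omega>" for z
    proof -
      have "(1 / N (\<phi> z w)) powr \<delta> \<le> \<epsilon> / M" if w: "w \<in> \<Omega>" "w \<in> {w. dx z w > max R 1}" for w
      proof -
        have "d (\<phi> z w) 0 > R" using w z by (simp add: d_phi_zero dx_def Met.commute[of w z])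
        then have "N (\<phi> z w) > m" using R z w by auto
        then have "(1 / N (\<phi> z w)) powr \<delta> \<le> (1 / m) powr \<delta>"
          using m \<delta> by (intro powr_mono2 divide_left_mono) auto
        then show ?thesis using md by simp
      qed
      note le = this
      have "(\<integral>\<^sup>+w. ennreal (cmod (Kx z w) * Nx w powr s) * indicator {w. dx z w > max R 1} w \<partial>\<sigma>)
          \<le> ennreal (\<epsilon> / M * M * N z powr s)"
        by (rule bound[OF z _ le]) (use \<epsilon> M in auto)
      then show ?thesis using M by simp
    qed
    \<comment> \<open>The maximum with 1 makes the threshold positive, whatever the sign of
      \<open>R\<close>.\<close>
    then show "\<exists>t>0. \<forall>z\<in>\<Omega>. (\<integral>\<^sup>+w. ennreal (cmod (Kx z w) * Nx w powr s) * indicator {w. dx z w > t} w \<partial>\<sigma>) \<le> ennreal (\<epsilon> * N z powr s)"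
      by (intro exI[of _ "max R 1"]) auto
  qed
qed

end

subsection \<open>Commutators with slowly varying multipliers\<close>

lemma nn_integral_le_combination:
  fixes F G1 G2 G3 :: "'a \<Rightarrow> real"
  assumes [measurable]: "G1 \<in> borel_measurable M" "G2 \<in> borel_measurable M" "G3 \<in> borel_measurable M"
    and nonneg: "\<And>y. G1 y \<ge> 0" "\<And>y. G2 y \<ge> 0" "\<And>y. G3 y \<ge> 0" "c1 \<ge> 0" "c2 \<ge> 0" "c3 \<ge> 0" "x1 \<ge> 0" "x2 \<ge> 0" "x3 \<ge> 0"
    and le: "\<And>y. F y \<le> c1 * G1 y + c2 * G2 y + c3 * G3 y"
    and x: "(\<integral>\<^sup>+y. ennreal (G1 y) \<partial>M) \<le> ennreal x1" "(\<integral>\<^sup>+y. ennreal (G2 y) \<partial>M) \<le> ennreal x2"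
      "(\<integral>\<^sup>+y. ennreal (G3 y) \<partial>M) \<le> ennreal x3"
  shows "(\<integral>\<^sup>+y. ennreal (F y) \<partial>M) \<le> ennreal (c1 * x1 + c2 * x2 + c3 * x3)"
proof -
  have "(\<integral>\<^sup>+y. ennreal (F y) \<partial>M) \<le> (\<integral>\<^sup>+y. ennreal c1 * ennreal (G1 y) + ennreal c2 * ennreal (G2 y) + ennreal c3 * ennreal (G3 y) \<partial>M)"
    using le nonneg
    by (intro nn_integral_mono) (simp add: ennreal_mult[symmetric] ennreal_plus[symmetric] ennreal_leI del: ennreal_plus)
  also have "\<dots> = ennreal c1 * (\<integral>\<^sup>+y. ennreal (G1 y) \<partial>M) + ennreal c2 * (\<integral>\<^sup>+y. ennreal (G2 y) \<partial>M)
      + ennreal c3 * (\<integral>\<^sup>+y. ennreal (G3 y) \<partial>M)"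
    by (simp add: nn_integral_add nn_integral_cmult)
  also have "\<dots> \<le> ennreal c1 * ennreal x1 + ennreal c2 * ennreal x2 + ennreal c3 * ennreal x3"
    by (intro add_mono mult_left_mono x) auto
  also have "\<dots> = ennreal (c1 * x1 + c2 * x2 + c3 * x3)"
    using nonneg by (simp add: ennreal_mult[symmetric] ennreal_plus[symmetric] del: ennreal_plus)
  finally show ?thesis .
qed

lemma square_sum3_le:
  fixes x a b c :: real
  assumes "0 \<le> x" "x \<le> a + b + c"
  shows "x\<^sup>2 \<le> 3 * a\<^sup>2 + 3 * b\<^sup>2 + 3 * c\<^sup>2"
proof -
  have "x\<^sup>2 \<le> (a + b + c)\<^sup>2" using assms by (rule power_mono[rotated])
  also have "\<dots> \<le> 3 * a\<^sup>2 + 3 * b\<^sup>2 + 3 * c\<^sup>2"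
    using zero_le_power2[of "a - b"] zero_le_power2[of "b - c"] zero_le_power2[of "a - c"]
    by (simp add: power2_eq_square algebra_simps)
  finally show ?thesis .
qed

context bergman
begin

section \<open>Multiplication by the tents\<close>

definition hm :: "real \<Rightarrow> 'n pt \<Rightarrow> 'n op" where
  "hm \<rho> y f = (\<lambda>w. of_real (hh \<rho> y w) * f w)"

lemma hm_in: assumes "\<rho> > 0" "f \<in> H" shows "hm \<rho> y f \<in> H"
  unfolding hm_def
  by (rule L2_bounded_mult(1)[where B = "1 / sqrt (ig \<rho>)"])
     (use assms hh_nonneg[OF assms(1)] hh_le[OF assms(1)] ig(2)[OF assms(1)] in \<open>auto simp: abs_of_nonneg\<close>)

lemma hm_outside: "y \<notin> \<Omega> \<Longrightarrow> hm \<rho> y f = (\<lambda>w. 0)"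
  by (simp add: hm_def hh_def G_def)

text \<open>Tonelli and the normalisation of \<open>hh\<close>: the average over \<open>y\<close>
  recovers the norm of \<open>f\<close> exactly. This is how estimates of the pieces are put
  together again.\<close>

lemma hm_integral:
  assumes \<rho>: "\<rho> > 0" and f: "f \<in> H"
  shows "(\<lambda>y. (nm (hm \<rho> y f))\<^sup>2) \<in> borel_measurable borel"
    "(\<integral>\<^sup>+y. ennreal ((nm (hm \<rho> y f))\<^sup>2) \<partial>lm) = ennreal ((nm f)\<^sup>2)"
proof -
  have fm [measurable]: "f \<in> borel_measurable borel"
    using L2D(1)[OF f] measurable_cong_sets[OF sets_sigma refl, of borel] by blast
  have eq: "ennreal ((nm (hm \<rho> y f))\<^sup>2) = (\<integral>\<^sup>+w. ennreal ((hh \<rho> y w)\<^sup>2 * (cmod (f w))\<^sup>2) \<partial>\<sigma>)" for y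
    unfolding nn_integral_L2[OF hm_in[OF \<rho> f], symmetric]
    by (intro nn_integral_cong) (simp add: hm_def norm_mult power_mult_distrib)
  have "(\<lambda>y. \<integral>\<^sup>+w. ennreal ((hh \<rho> y w)\<^sup>2 * (cmod (f w))\<^sup>2) \<partial>\<sigma>) \<in> borel_measurable borel"
    by measurable
  then have m: "(\<lambda>y. ennreal ((nm (hm \<rho> y f))\<^sup>2)) \<in> borel_measurable borel" by (simp add: eq)
  have "(\<lambda>y. enn2real (ennreal ((nm (hm \<rho> y f))\<^sup>2))) \<in> borel_measurable borel"
    using m by measurable
  then show "(\<lambda>y. (nm (hm \<rho> y f))\<^sup>2) \<in> borel_measurable borel" by simp
  interpret pair_sigma_finite \<sigma> lm
    by (intro pair_sigma_finite.intro sigma_finite_measure_axioms lm.sigma_finite_measure_axioms)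
  have "(\<integral>\<^sup>+y. ennreal ((nm (hm \<rho> y f))\<^sup>2) \<partial>lm) = (\<integral>\<^sup>+y. \<integral>\<^sup>+w. ennreal ((hh \<rho> y w)\<^sup>2 * (cmod (f w))\<^sup>2) \<partial>\<sigma> \<partial>lm)"
    by (simp add: eq)
  also have "\<dots> = (\<integral>\<^sup>+w. \<integral>\<^sup>+y. ennreal ((hh \<rho> y w)\<^sup>2 * (cmod (f w))\<^sup>2) \<partial>lm \<partial>\<sigma>)"
    by (rule Fubini') measurable
  also have "\<dots> = (\<integral>\<^sup>+w. ennreal ((cmod (f w))\<^sup>2) \<partial>\<sigma>)"
  proof (rule nn_integral_cong)
    fix w
    have "(\<integral>\<^sup>+y. ennreal ((hh \<rho> y w)\<^sup>2 * (cmod (f w))\<^sup>2) \<partial>lm) = (\<integral>\<^sup>+y. ennreal ((hh \<rho> y w)\<^sup>2) \<partial>lm) * ennreal ((cmod (f w))\<^sup>2)"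
      by (simp add: ennreal_mult nn_integral_multc)
    then show "(\<integral>\<^sup>+y. ennreal ((hh \<rho> y w)\<^sup>2 * (cmod (f w))\<^sup>2) \<partial>lm) = ennreal ((cmod (f w))\<^sup>2)"
      using hh_square_integral[OF \<rho>, of w] L2D(3)[OF f, of w] by (cases "w \<in> \<Omega>") auto
  qed
  also have "\<dots> = ennreal ((nm f)\<^sup>2)" by (rule nn_integral_L2[OF f])
  finally show "(\<integral>\<^sup>+y. ennreal ((nm (hm \<rho> y f))\<^sup>2) \<partial>lm) = ennreal ((nm f)\<^sup>2)" .
qed

section \<open>Averaged commutators\<close>

text \<open>Multiplication by a tent leaves \<open>B\<close>, so commutators need operators on all
  of L2; operators on \<open>B\<close> enter after composition with \<open>P\<close>. Respecting
  differences is the part of linearity that the commutator identities use.\<close>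

definition hop :: "'n op \<Rightarrow> real \<Rightarrow> bool" where
  "hop A C \<longleftrightarrow> C \<ge> 0 \<and> (\<forall>f\<in>H. A f \<in> H \<and> nm (A f) \<le> C * nm f) \<and>
     (\<forall>f\<in>H. \<forall>g\<in>H. A (\<lambda>w. f w - g w) = (\<lambda>w. A f w - A g w))"

lemma hopD:
  assumes "hop A C"
  shows "C \<ge> 0" "f \<in> H \<Longrightarrow> A f \<in> H" "f \<in> H \<Longrightarrow> nm (A f) \<le> C * nm f"
    "f \<in> H \<Longrightarrow> g \<in> H \<Longrightarrow> A (\<lambda>w. f w - g w) = (\<lambda>w. A f w - A g w)"
  using assms by (auto simp: hop_def)

lemma hop_zero: "hop A C \<Longrightarrow> A (\<lambda>w. 0) = (\<lambda>w. 0)"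
  using hopD(4)[of A C "\<lambda>w. 0" "\<lambda>w. 0"] by simp

lemma hop_comp: assumes A: "hop A C" and A': "hop A' C'" shows "hop (\<lambda>f. A (A' f)) (C * C')"
  unfolding hop_def
proof (intro conjI ballI)
  fix f assume f: "f \<in> H"
  show "A (A' f) \<in> H" by (intro hopD(2)[OF A] hopD(2)[OF A'] f)
  have "nm (A (A' f)) \<le> C * nm (A' f)" by (intro hopD(3)[OF A] hopD(2)[OF A'] f)
  also have "\<dots> \<le> C * (C' * nm f)" by (intro mult_left_mono hopD(3)[OF A'] hopD(1)[OF A] f)
  finally show "nm (A (A' f)) \<le> C * C' * nm f" by (simp add: mult.assoc)
  show "A (A' (\<lambda>w. f w - g w)) = (\<lambda>w. A (A' f) w - A (A' g) w)" if "g \<in> H" for g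
    by (simp only: hopD(4)[OF A' f that] hopD(4)[OF A hopD(2)[OF A' f] hopD(2)[OF A' that]])
qed (use hopD(1)[OF A] hopD(1)[OF A'] in simp)

lemma hop_bop_P: assumes "bop S C" shows "hop (\<lambda>f. S (P f)) C"
  unfolding hop_def
proof (intro conjI ballI)
  fix f assume f: "f \<in> H"
  show "S (P f) \<in> H" by (intro Bsp_L2 bopD(2)[OF assms] P_in f)
  have "nm (S (P f)) \<le> C * nm (P f)" by (intro bopD(5)[OF assms] P_in f)
  also have "\<dots> \<le> C * nm f" by (intro mult_left_mono P_nrm f bopD(1)[OF assms])
  finally show "nm (S (P f)) \<le> C * nm f" .
  show "S (P (\<lambda>w. f w - g w)) = (\<lambda>w. S (P f) w - S (P g) w)" if "g \<in> H" for g
    by (simp only: P_diff[OF f that] bop_diff[OF assms P_in[OF f] P_in[OF that]])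
qed (rule bopD(1)[OF assms])

lemma hop_P: "hop P 1"
  unfolding hop_def by (auto simp: P_L2 P_nrm P_diff)

text \<open>The commutator of multiplication by \<open>hh \<rho> y\<close> with \<open>A\<close>,
  applied to \<open>f\<close>.\<close>

definition E :: "real \<Rightarrow> 'n op \<Rightarrow> 'n pt \<Rightarrow> 'n op" where
  "E \<rho> A y f = (\<lambda>w. hm \<rho> y (A f) w - A (hm \<rho> y f) w)"

abbreviation comm :: "real \<Rightarrow> 'n op \<Rightarrow> 'n fn \<Rightarrow> ennreal" where
  "comm \<rho> A f \<equiv> (\<integral>\<^sup>+y. ennreal ((nm (E \<rho> A y f))\<^sup>2) \<partial>lm)"

lemma E_in: "\<rho> > 0 \<Longrightarrow> hop A C \<Longrightarrow> f \<in> H \<Longrightarrow> E \<rho> A y f \<in> H"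
  unfolding E_def by (intro L2_diff hm_in hopD(2)[of A C]) auto

text \<open>The Lipschitz condition refers to \<open>d\<close>, so Euclidean continuity is not at
  hand; the sublevel sets are countable unions of \<open>d\<close>-balls around a dense set of
  centres.\<close>

lemma lipschitz_borel_measurable:
  fixes F :: "'n pt \<Rightarrow> real"
  assumes out: "\<And>y. y \<notin> \<Omega> \<Longrightarrow> F y = 0"
    and lip: "\<And>y y'. y \<in> \<Omega> \<Longrightarrow> y' \<in> \<Omega> \<Longrightarrow> \<bar>F y - F y'\<bar> \<le> L * d y y'" and "L > 0"
  shows "F \<in> borel_measurable borel"
  unfolding borel_measurable_iff_less
proof
  fix a :: real
  obtain Q where Q: "countable Q" "Q \<subseteq> \<Omega>" "\<And>x e. x \<in> \<Omega> \<Longrightarrow> e > 0 \<Longrightarrow> \<exists>q\<in>Q. d x q < e"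
    using dense_countable by blast
  have eq: "{y \<in> \<Omega>. F y < a} = (\<Union>q\<in>Q. Met.mball q ((a - F q) / L))"
  proof (intro subset_antisym subsetI)
    fix y assume "y \<in> {y \<in> \<Omega>. F y < a}"
    then have y: "y \<in> \<Omega>" "F y < a" by auto
    have "(a - F y) / (2 * L) > 0" using y(2) \<open>L > 0\<close> by simp
    then obtain q where q: "q \<in> Q" "d y q < (a - F y) / (2 * L)" using Q(3)[OF y(1)] by blast
    have "q \<in> \<Omega>" using q Q by auto
    have "2 * (L * d y q) < a - F y" using q(2) \<open>L > 0\<close> by (simp add: field_simps)
    moreover have "F q \<le> F y + L * d y q" using lip[OF y(1) \<open>q \<in> \<Omega>\<close>] by linarith
    ultimately have "L * d q y < a - F q" using Met.commute[of y q] by simp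
    then have "y \<in> Met.mball q ((a - F q) / L)" using y \<open>q \<in> \<Omega>\<close> \<open>L > 0\<close> by (simp add: field_simps)
    then show "y \<in> (\<Union>q\<in>Q. Met.mball q ((a - F q) / L))" using q(1) by blast
  next
    fix y assume "y \<in> (\<Union>q\<in>Q. Met.mball q ((a - F q) / L))"
    then obtain q where q: "q \<in> \<Omega>" "y \<in> \<Omega>" "d q y < (a - F q) / L" by auto
    have "L * d q y < a - F q" using q(3) \<open>L > 0\<close> by (simp add: field_simps)
    then show "y \<in> {y \<in> \<Omega>. F y < a}" using lip[OF q(1,2)] q(2) by simp
  qed
  have S: "{y \<in> \<Omega>. F y < a} \<in> sets borel"
    unfolding eq using Q by (intro sets.countable_UN'' mball_borel) auto
  have "{y. F y < a} = {y \<in> \<Omega>. F y < a} \<union> (if a > 0 then - \<Omega> else {})"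
  proof (rule set_eqI)
    fix x show "x \<in> {y. F y < a} \<longleftrightarrow> x \<in> {y \<in> \<Omega>. F y < a} \<union> (if a > 0 then - \<Omega> else {})"
      by (cases "x \<in> \<Omega>") (auto simp: out)
  qed
  then show "{y \<in> space borel. F y < a} \<in> sets borel" using S by simp
qed

text \<open>For an abstract \<open>A\<close> no formula shows how the commutator depends on
  \<open>y\<close>. But the tents are \<open>d\<close>-Lipschitz in \<open>y\<close>, and
  boundedness of \<open>A\<close> passes this on to the norm.\<close>

lemma E_measurable:
  assumes \<rho>: "\<rho> > 0" and A: "hop A C" and f: "f \<in> H"
  shows "(\<lambda>y. nm (E \<rho> A y f)) \<in> borel_measurable borel"
proof -
  define l where "l = 1 / (\<rho> * sqrt (ig \<rho>))"
  have l: "l > 0" using \<rho> ig(2)[OF \<rho>] by (simp add: l_def)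
  have hmd: "nm (\<lambda>w. hm \<rho> y g w - hm \<rho> y' g w) \<le> (l * d y y') * nm g"
    if y: "y \<in> \<Omega>" "y' \<in> \<Omega>" and g: "g \<in> H" for y y' g
  proof -
    have "\<bar>hh \<rho> y w - hh \<rho> y' w\<bar> \<le> l * d y y'" if w: "w \<in> \<Omega>" for w
    proof -
      have "\<bar>G \<rho> y w - G \<rho> y' w\<bar> \<le> d y y' / \<rho>"
        using G_lipschitz[OF \<rho> y, of w] by (simp add: G_commute[of \<rho> w])
      then have "\<bar>G \<rho> y w - G \<rho> y' w\<bar> / sqrt (ig \<rho>) \<le> d y y' / \<rho> / sqrt (ig \<rho>)"
        using ig(2)[OF \<rho>] by (intro divide_right_mono) auto
      then show ?thesis
        using ig(2)[OF \<rho>] by (simp add: hh_def l_def diff_divide_distrib[symmetric] abs_divide)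
    qed
    then have "cmod (complex_of_real (hh \<rho> y w - hh \<rho> y' w)) \<le> l * d y y'" if "w \<in> \<Omega>" for w
      unfolding norm_of_real using that by blast
    from L2_bounded_mult(2)[OF g _ this]
    have "nm (\<lambda>w. complex_of_real (hh \<rho> y w - hh \<rho> y' w) * g w) \<le> l * d y y' * nm g"
      using l by simp
    then show ?thesis by (simp add: hm_def left_diff_distrib)
  qed
  show ?thesis
  proof (rule lipschitz_borel_measurable[where L = "2 * C * nm f * l + 1"])
    show "nm (E \<rho> A y f) = 0" if "y \<notin> \<Omega>" for y
      using hop_zero[OF A] by (simp add: E_def hm_outside[OF that])
    show "0 < 2 * C * nm f * l + 1" using hopD(1)[OF A] l by (simp add: add_nonneg_pos)
    fix y y' assume y: "y \<in> \<Omega>" "y' \<in> \<Omega>"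
    let ?a = "\<lambda>w. hm \<rho> y (A f) w - hm \<rho> y' (A f) w" and ?b = "\<lambda>w. hm \<rho> y f w - hm \<rho> y' f w"
    have a: "?a \<in> H" by (intro L2_diff hm_in \<rho> hopD(2)[OF A] f)
    have b: "?b \<in> H" by (intro L2_diff hm_in \<rho> f)
    have E: "E \<rho> A y f \<in> H" "E \<rho> A y' f \<in> H" by (rule E_in[OF \<rho> A f])+
    have "(\<lambda>w. E \<rho> A y f w - E \<rho> A y' f w) = (\<lambda>w. ?a w - A ?b w)"
      by (simp add: hopD(4)[OF A hm_in[OF \<rho> f] hm_in[OF \<rho> f]] E_def algebra_simps)
    then have "nm (\<lambda>w. E \<rho> A y f w - E \<rho> A y' f w) \<le> nm ?a + nm (A ?b)"
      using nrm_triangle_diff[OF a hopD(2)[OF A b]] by simp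
    also have "\<dots> \<le> l * d y y' * (C * nm f) + C * (l * d y y' * nm f)"
    proof (rule add_mono)
      have "nm ?a \<le> (l * d y y') * nm (A f)" by (rule hmd[OF y hopD(2)[OF A f]])
      also have "\<dots> \<le> (l * d y y') * (C * nm f)" using l by (intro mult_left_mono hopD(3)[OF A f]) simp
      finally show "nm ?a \<le> l * d y y' * (C * nm f)" .
      have "nm (A ?b) \<le> C * nm ?b" by (rule hopD(3)[OF A b])
      also have "\<dots> \<le> C * (l * d y y' * nm f)" by (intro mult_left_mono hmd[OF y f] hopD(1)[OF A])
      finally show "nm (A ?b) \<le> C * (l * d y y' * nm f)" .
    qed
    also have "\<dots> \<le> (2 * C * nm f * l + 1) * d y y'" by (simp add: algebra_simps)
    finally have "nm (\<lambda>w. E \<rho> A y f w - E \<rho> A y' f w) \<le> (2 * C * nm f * l + 1) * d y y'" .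
    then show "\<bar>nm (E \<rho> A y f) - nm (E \<rho> A y' f)\<bar> \<le> (2 * C * nm f * l + 1) * d y y'"
      using nrm_le_add_diff[OF E] nrm_le_add_diff[OF E(2,1)] nrm_minus_commute[of \<sigma> "E \<rho> A y f" "E \<rho> A y' f"] by linarith
  qed
qed

text \<open>The averaged commutators become small for wide tents, uniformly on the unit ball.
  Requiring this for all large \<rho> lets two operators share a threshold.\<close>

definition Loc :: "'n op \<Rightarrow> bool" where
  "Loc A \<longleftrightarrow> (\<forall>\<epsilon>>0. \<exists>\<rho>0>0. \<forall>\<rho>\<ge>\<rho>0. \<forall>f\<in>H. comm \<rho> A f \<le> ennreal (\<epsilon> * (nm f)\<^sup>2))"

lemma LocD:
  assumes "Loc A" "\<epsilon> > 0"
  obtains \<rho>0 where "\<rho>0 > 0" "\<And>\<rho> f. \<rho> \<ge> \<rho>0 \<Longrightarrow> f \<in> H \<Longrightarrow> comm \<rho> A f \<le> ennreal (\<epsilon> * (nm f)\<^sup>2)"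
  using assms unfolding Loc_def by meson

lemma Loc_cong:
  assumes "Loc A" "\<And>f. f \<in> H \<Longrightarrow> A' f = A f"
  shows "Loc A'"
  unfolding Loc_def
proof (intro allI impI)
  fix \<epsilon> :: real assume "\<epsilon> > 0"
  then obtain \<rho>0 where \<rho>0: "\<rho>0 > 0" "\<And>\<rho> f. \<rho> \<ge> \<rho>0 \<Longrightarrow> f \<in> H \<Longrightarrow> comm \<rho> A f \<le> ennreal (\<epsilon> * (nm f)\<^sup>2)"
    using LocD[OF assms(1)] by metis
  have "E \<rho> A' y f = E \<rho> A y f" if "\<rho> \<ge> \<rho>0" "f \<in> H" for \<rho> y f
    unfolding E_def using assms(2) that hm_in[of \<rho> f y] \<rho>0(1) by simp
  with \<rho>0 show "\<exists>\<rho>0>0. \<forall>\<rho>\<ge>\<rho>0. \<forall>f\<in>H. comm \<rho> A' f \<le> ennreal (\<epsilon> * (nm f)\<^sup>2)"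
    by (intro exI[of _ \<rho>0]) auto
qed

text \<open>The commutator obeys a product rule: the commutator with \<open>A\<close> evaluated at
  \<open>A' f\<close>, plus \<open>A\<close> applied to the commutator with
  \<open>A'\<close>.\<close>

lemma Loc_comp:
  assumes A: "hop A C" "Loc A" and A': "hop A' C'" "Loc A'"
  shows "Loc (\<lambda>f. A (A' f))"
  unfolding Loc_def
proof (intro allI impI)
  fix \<epsilon> :: real assume \<epsilon>: "\<epsilon> > 0"
  \<comment> \<open>Each term is charged with the squared norm of the other factor, increased by 1
    to avoid division by zero. The 6 leaves room for the constant 3 of \<open>square_sum3_le\<close>
    on two terms.\<close>
  define \<epsilon>1 \<epsilon>2 where "\<epsilon>1 = \<epsilon> / 6 / (C'\<^sup>2 + 1)" and "\<epsilon>2 = \<epsilon> / 6 / (C\<^sup>2 + 1)"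
  have pos: "\<epsilon>1 > 0" "\<epsilon>2 > 0" using \<epsilon> by (auto simp: \<epsilon>1_def \<epsilon>2_def add_nonneg_pos)
  obtain \<rho>1 where \<rho>1: "\<rho>1 > 0" "\<And>\<rho> f. \<rho> \<ge> \<rho>1 \<Longrightarrow> f \<in> H \<Longrightarrow> comm \<rho> A f \<le> ennreal (\<epsilon>1 * (nm f)\<^sup>2)"
    using LocD[OF A(2) pos(1)] by metis
  obtain \<rho>2 where \<rho>2: "\<rho>2 > 0" "\<And>\<rho> f. \<rho> \<ge> \<rho>2 \<Longrightarrow> f \<in> H \<Longrightarrow> comm \<rho> A' f \<le> ennreal (\<epsilon>2 * (nm f)\<^sup>2)"
    using LocD[OF A'(2) pos(2)] by metis
  have "comm \<rho> (\<lambda>f. A (A' f)) f \<le> ennreal (\<epsilon> * (nm f)\<^sup>2)"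
    if r: "\<rho> \<ge> max \<rho>1 \<rho>2" and f: "f \<in> H" for \<rho> f
  proof -
    have \<rho>: "\<rho> > 0" using r \<rho>1(1) by simp
    note A'f = hopD(2)[OF A'(1) f]
    note [measurable] = E_measurable[OF \<rho> A(1) A'f] E_measurable[OF \<rho> A'(1) f]
    have le: "nm (E \<rho> (\<lambda>f. A (A' f)) y f) \<le> nm (E \<rho> A y (A' f)) + C * nm (E \<rho> A' y f) + 0" for y
    proof -
      have "E \<rho> (\<lambda>f. A (A' f)) y f = (\<lambda>w. E \<rho> A y (A' f) w + A (E \<rho> A' y f) w)"
        unfolding E_def[of \<rho> A' y f] hopD(4)[OF A(1) hm_in[OF \<rho> A'f] hopD(2)[OF A'(1) hm_in[OF \<rho> f]]]
        by (simp add: E_def)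
      then show ?thesis
        using nrm_triangle[OF E_in[OF \<rho> A(1) A'f] hopD(2)[OF A(1) E_in[OF \<rho> A'(1) f]], of y y]
          hopD(3)[OF A(1) E_in[OF \<rho> A'(1) f], of y] by simp
    qed
    have "comm \<rho> (\<lambda>f. A (A' f)) f
        \<le> ennreal (3 * (\<epsilon>1 * (C' * nm f)\<^sup>2) + 3 * C\<^sup>2 * (\<epsilon>2 * (nm f)\<^sup>2) + 0 * 0)"
    proof (rule nn_integral_le_combination[where ?G1.0 = "\<lambda>y. (nm (E \<rho> A y (A' f)))\<^sup>2"
          and ?G2.0 = "\<lambda>y. (nm (E \<rho> A' y f))\<^sup>2" and ?G3.0 = "\<lambda>y. 0"])
      show "(nm (E \<rho> (\<lambda>f. A (A' f)) y f))\<^sup>2 \<le> 3 * (nm (E \<rho> A y (A' f)))\<^sup>2 + 3 * C\<^sup>2 * (nm (E \<rho> A' y f))\<^sup>2 + 0 * 0" for y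
        using square_sum3_le[OF nrm_nonneg le[of y]] by (simp add: power_mult_distrib)
      have "comm \<rho> A (A' f) \<le> ennreal (\<epsilon>1 * (nm (A' f))\<^sup>2)"
        by (rule \<rho>1(2)[OF _ A'f]) (use r in simp)
      also have "\<dots> \<le> ennreal (\<epsilon>1 * (C' * nm f)\<^sup>2)"
        using pos hopD(3)[OF A'(1) f] by (intro ennreal_leI mult_left_mono power_mono) auto
      finally show "comm \<rho> A (A' f) \<le> ennreal (\<epsilon>1 * (C' * nm f)\<^sup>2)" .
      show "comm \<rho> A' f \<le> ennreal (\<epsilon>2 * (nm f)\<^sup>2)"
        by (rule \<rho>2(2)[OF _ f]) (use r in simp)
    qed (use pos in auto)
    also have "\<dots> \<le> ennreal (\<epsilon> * (nm f)\<^sup>2)"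
    proof (rule ennreal_leI)
      have "\<epsilon>1 * C'\<^sup>2 \<le> \<epsilon>1 * (C'\<^sup>2 + 1)" "\<epsilon>2 * C\<^sup>2 \<le> \<epsilon>2 * (C\<^sup>2 + 1)" using pos by (auto intro: mult_left_mono)
      moreover have "C'\<^sup>2 + 1 \<noteq> 0" "C\<^sup>2 + 1 \<noteq> 0" by (auto simp: add_nonneg_eq_0_iff)
      moreover have "x / a * a = x" if "a \<noteq> 0" for x a :: real using that by simp
      ultimately have "\<epsilon>1 * C'\<^sup>2 \<le> \<epsilon> / 6" "\<epsilon>2 * C\<^sup>2 \<le> \<epsilon> / 6" unfolding \<epsilon>1_def \<epsilon>2_def by metis+
      then have "(3 * (\<epsilon>1 * C'\<^sup>2) + 3 * (\<epsilon>2 * C\<^sup>2)) * (nm f)\<^sup>2 \<le> \<epsilon> * (nm f)\<^sup>2"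
        by (intro mult_right_mono) auto
      then show "3 * (\<epsilon>1 * (C' * nm f)\<^sup>2) + 3 * C\<^sup>2 * (\<epsilon>2 * (nm f)\<^sup>2) + 0 * 0 \<le> \<epsilon> * (nm f)\<^sup>2"
        by (simp add: power_mult_distrib algebra_simps)
    qed
    finally show ?thesis .
  qed
  then show "\<exists>\<rho>0>0. \<forall>\<rho>\<ge>\<rho>0. \<forall>f\<in>H. comm \<rho> (\<lambda>f. A (A' f)) f \<le> ennreal (\<epsilon> * (nm f)\<^sup>2)"
    using \<rho>1(1) by (intro exI[of _ "max \<rho>1 \<rho>2"]) auto
qed

lemma Loc_add:
  assumes A: "hop A C" "Loc A" and A': "hop A' C'" "Loc A'"
  shows "Loc (\<lambda>f w. A f w + A' f w)"
  unfolding Loc_def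
proof (intro allI impI)
  fix \<epsilon> :: real assume \<epsilon>: "\<epsilon> > 0"
  have pos: "\<epsilon>/6 > 0" using \<epsilon> by simp
  obtain \<rho>1 where \<rho>1: "\<rho>1 > 0" "\<And>\<rho> f. \<rho> \<ge> \<rho>1 \<Longrightarrow> f \<in> H \<Longrightarrow> comm \<rho> A f \<le> ennreal (\<epsilon>/6 * (nm f)\<^sup>2)"
    using LocD[OF A(2) pos] by metis
  obtain \<rho>2 where \<rho>2: "\<rho>2 > 0" "\<And>\<rho> f. \<rho> \<ge> \<rho>2 \<Longrightarrow> f \<in> H \<Longrightarrow> comm \<rho> A' f \<le> ennreal (\<epsilon>/6 * (nm f)\<^sup>2)"
    using LocD[OF A'(2) pos] by metis
  have "comm \<rho> (\<lambda>f w. A f w + A' f w) f \<le> ennreal (\<epsilon> * (nm f)\<^sup>2)"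
    if r: "\<rho> \<ge> max \<rho>1 \<rho>2" and f: "f \<in> H" for \<rho> f
  proof -
    have \<rho>: "\<rho> > 0" using r \<rho>1(1) by simp
    note [measurable] = E_measurable[OF \<rho> A(1) f] E_measurable[OF \<rho> A'(1) f]
    have le: "nm (E \<rho> (\<lambda>f w. A f w + A' f w) y f) \<le> nm (E \<rho> A y f) + nm (E \<rho> A' y f) + 0" for y
    proof -
      have "E \<rho> (\<lambda>f w. A f w + A' f w) y f = (\<lambda>w. E \<rho> A y f w + E \<rho> A' y f w)"
        by (simp add: E_def hm_def algebra_simps)
      then show ?thesis using nrm_triangle[OF E_in[OF \<rho> A(1) f] E_in[OF \<rho> A'(1) f], of y y] by simp
    qed
    have "comm \<rho> (\<lambda>f w. A f w + A' f w) f
        \<le> ennreal (3 * (\<epsilon>/6 * (nm f)\<^sup>2) + 3 * (\<epsilon>/6 * (nm f)\<^sup>2) + 0 * 0)"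
    proof (rule nn_integral_le_combination[where ?G1.0 = "\<lambda>y. (nm (E \<rho> A y f))\<^sup>2"
          and ?G2.0 = "\<lambda>y. (nm (E \<rho> A' y f))\<^sup>2" and ?G3.0 = "\<lambda>y. 0"])
      show "(nm (E \<rho> (\<lambda>f w. A f w + A' f w) y f))\<^sup>2 \<le> 3 * (nm (E \<rho> A y f))\<^sup>2 + 3 * (nm (E \<rho> A' y f))\<^sup>2 + 0 * 0" for y
        using square_sum3_le[OF nrm_nonneg le[of y]] by simp
      show "comm \<rho> A f \<le> ennreal (\<epsilon>/6 * (nm f)\<^sup>2)"
        by (rule \<rho>1(2)[OF _ f]) (use r in simp)
      show "comm \<rho> A' f \<le> ennreal (\<epsilon>/6 * (nm f)\<^sup>2)"
        by (rule \<rho>2(2)[OF _ f]) (use r in simp)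
    qed (use \<epsilon> in auto)
    then show ?thesis by simp
  qed
  then show "\<exists>\<rho>0>0. \<forall>\<rho>\<ge>\<rho>0. \<forall>f\<in>H. comm \<rho> (\<lambda>f w. A f w + A' f w) f \<le> ennreal (\<epsilon> * (nm f)\<^sup>2)"
    using \<rho>1(1) by (intro exI[of _ "max \<rho>1 \<rho>2"]) auto
qed

text \<open>The commutator with \<open>A\<close> differs from that with \<open>S\<close> by two
  terms containing \<open>A - S\<close>, one before and one after the multiplier. Each averages to
  at most \<open>e\<^sup>2\<close> times the squared norm of \<open>f\<close>.\<close>

lemma Loc_limit:
  assumes A: "hop A C"
    and approx: "\<And>e. e > 0 \<Longrightarrow> \<exists>S C'. hop S C' \<and> Loc S \<and> (\<forall>f\<in>H. nm (\<lambda>w. A f w - S f w) \<le> e * nm f)"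
  shows "Loc A"
  unfolding Loc_def
proof (intro allI impI)
  fix \<epsilon> :: real assume \<epsilon>: "\<epsilon> > 0"
  \<comment> \<open>With this choice the three contributions are a half, a quarter and a quarter of
    \<epsilon>.\<close>
  define e where "e = sqrt (\<epsilon>/12)"
  have e: "e > 0" "e\<^sup>2 = \<epsilon>/12" using \<epsilon> by (auto simp: e_def)
  obtain S C' where S: "hop S C'" "Loc S" "\<And>f. f \<in> H \<Longrightarrow> nm (\<lambda>w. A f w - S f w) \<le> e * nm f"
    using approx[OF e(1)] by blast
  have pos: "\<epsilon>/6 > 0" using \<epsilon> by simp
  obtain \<rho>1 where \<rho>1: "\<rho>1 > 0" "\<And>\<rho> f. \<rho> \<ge> \<rho>1 \<Longrightarrow> f \<in> H \<Longrightarrow> comm \<rho> S f \<le> ennreal (\<epsilon>/6 * (nm f)\<^sup>2)"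
    using LocD[OF S(2) pos] by metis
  have "comm \<rho> A f \<le> ennreal (\<epsilon> * (nm f)\<^sup>2)"
    if r: "\<rho> \<ge> \<rho>1" and f: "f \<in> H" for \<rho> f
  proof -
    have \<rho>: "\<rho> > 0" using r \<rho>1(1) by simp
    define g where "g = (\<lambda>w. A f w - S f w)"
    have g: "g \<in> H" "nm g \<le> e * nm f"
      unfolding g_def using S(3)[OF f] by (auto intro!: L2_diff hopD(2)[OF A] hopD(2)[OF S(1)] f)
    note [measurable] = E_measurable[OF \<rho> S(1) f] hm_integral(1)[OF \<rho> f] hm_integral(1)[OF \<rho> g(1)]
    have le: "nm (E \<rho> A y f) \<le> nm (E \<rho> S y f) + nm (hm \<rho> y g) + e * nm (hm \<rho> y f)" for y
    proof -
      let ?k = "\<lambda>w. A (hm \<rho> y f) w - S (hm \<rho> y f) w"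
      note hf = hm_in[OF \<rho> f, of y]
      have k: "?k \<in> H" by (intro L2_diff hopD(2)[OF A] hopD(2)[OF S(1)] hf)
      have "E \<rho> A y f = (\<lambda>w. (E \<rho> S y f w + hm \<rho> y g w) - ?k w)"
        by (simp add: E_def hm_def g_def algebra_simps)
      then show ?thesis
        using nrm_triangle_diff[OF L2_add[OF E_in[OF \<rho> S(1) f] hm_in[OF \<rho> g(1)]] k, of y y]
          nrm_triangle[OF E_in[OF \<rho> S(1) f] hm_in[OF \<rho> g(1)], of y y] S(3)[OF hf] by simp
    qed
    have "comm \<rho> A f
        \<le> ennreal (3 * (\<epsilon>/6 * (nm f)\<^sup>2) + 3 * (e * nm f)\<^sup>2 + 3 * e\<^sup>2 * (nm f)\<^sup>2)"
    proof (rule nn_integral_le_combination[where ?G1.0 = "\<lambda>y. (nm (E \<rho> S y f))\<^sup>2"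
          and ?G2.0 = "\<lambda>y. (nm (hm \<rho> y g))\<^sup>2" and ?G3.0 = "\<lambda>y. (nm (hm \<rho> y f))\<^sup>2"])
      show "(nm (E \<rho> A y f))\<^sup>2 \<le> 3 * (nm (E \<rho> S y f))\<^sup>2 + 3 * (nm (hm \<rho> y g))\<^sup>2 + 3 * e\<^sup>2 * (nm (hm \<rho> y f))\<^sup>2" for y
        using square_sum3_le[OF nrm_nonneg le[of y]] by (simp add: power_mult_distrib)
      show "comm \<rho> S f \<le> ennreal (\<epsilon>/6 * (nm f)\<^sup>2)"
        by (rule \<rho>1(2)[OF r f])
      show "(\<integral>\<^sup>+y. ennreal ((nm (hm \<rho> y g))\<^sup>2) \<partial>lm) \<le> ennreal ((e * nm f)\<^sup>2)"
        unfolding hm_integral(2)[OF \<rho> g(1)] by (intro ennreal_leI power_mono g(2)) simp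
      show "(\<integral>\<^sup>+y. ennreal ((nm (hm \<rho> y f))\<^sup>2) \<partial>lm) \<le> ennreal ((nm f)\<^sup>2)"
        unfolding hm_integral(2)[OF \<rho> f] by simp
    qed (use \<epsilon> in auto)
    also have "3 * (\<epsilon>/6 * (nm f)\<^sup>2) + 3 * (e * nm f)\<^sup>2 + 3 * e\<^sup>2 * (nm f)\<^sup>2 = \<epsilon> * (nm f)\<^sup>2"
      by (simp add: power_mult_distrib e(2))
    finally show ?thesis .
  qed
  then show "\<exists>\<rho>0>0. \<forall>\<rho>\<ge>\<rho>0. \<forall>f\<in>H. comm \<rho> A f \<le> ennreal (\<epsilon> * (nm f)\<^sup>2)"
    using \<rho>1(1) by blast
qed

end

subsection \<open>Compactness\<close>

context bergman
begin

section \<open>Localisation of the Toeplitz algebra\<close>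

lemma Loc_mult: "Loc (\<lambda>f w. u w * f w)"
proof -
  have "E \<rho> (\<lambda>f w. u w * f w) y f = (\<lambda>w. 0)" for \<rho> y f
    by (simp add: E_def hm_def fun_eq_iff mult.left_commute)
  then show ?thesis unfolding Loc_def by (auto intro!: exI[of _ 1])
qed

text \<open>The commutator has integral kernel \<open>K\<close> times the difference of the tent at
  two points. Cauchy-Schwarz with the Schur weight and integration in \<open>y\<close> leave the
  kernel times the averaged squared difference. Up to distance \<open>t\<close> this average is
  small because \<rho> is large; beyond \<open>t\<close> it is at most 2, and the tail of the kernel
  is small.\<close>

lemma Loc_P:
  assumes "\<kappa> > 0"
  shows "Loc P"
proof -
  obtain s M where M: "M > 0"
     "\<And>z. z \<in> \<Omega> \<Longrightarrow> (\<integral>\<^sup>+w. ennreal (cmod (Kx z w) * Nx w powr s) \<partial>\<sigma>) \<le> ennreal (M * N z powr s)"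
     "\<And>\<epsilon>. \<epsilon> > 0 \<Longrightarrow> \<exists>t>0. \<forall>z\<in>\<Omega>.
       (\<integral>\<^sup>+w. ennreal (cmod (Kx z w) * Nx w powr s) * indicator {w. dx z w > t} w \<partial>\<sigma>) \<le> ennreal (\<epsilon> * N z powr s)"
    by (rule Schur_weight[OF assms]) (rule that)
  obtain C where C: "C \<ge> 0" "\<And>\<rho> z w. \<rho> > 0 \<Longrightarrow> z \<in> \<Omega> \<Longrightarrow> w \<in> \<Omega> \<Longrightarrow>
      (\<integral>\<^sup>+y. ennreal ((hh \<rho> y z - hh \<rho> y w)\<^sup>2) \<partial>lm) \<le> ennreal (C * (d z w / \<rho>)\<^sup>2)"
    using hh_diff_integral_le by blast
  show ?thesis
    unfolding Loc_def
  proof (intro allI impI)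
    fix \<epsilon> :: real assume \<epsilon>: "\<epsilon> > 0"
    \<comment> \<open>The far part contributes \<open>2 * M * \<epsilon>'\<close>, half of
      \<epsilon>.\<close>
    define \<epsilon>' where "\<epsilon>' = \<epsilon> / (4 * M)"
    have \<epsilon>': "\<epsilon>' > 0" using \<epsilon> M by (simp add: \<epsilon>'_def)
    obtain t where t: "t > 0" "\<And>z. z \<in> \<Omega> \<Longrightarrow>
       (\<integral>\<^sup>+w. ennreal (cmod (Kx z w) * Nx w powr s) * indicator {w. dx z w > t} w \<partial>\<sigma>) \<le> ennreal (\<epsilon>' * N z powr s)"
      using M(3)[OF \<epsilon>'] by blast
    \<comment> \<open>Makes the near part \<open>M\<^sup>2 * \<beta>\<close> at most the other half
      of \<epsilon>. The summand 1 ensures that \<rho> is at most its square.\<close>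
    define \<rho>0 where "\<rho>0 = 2 * M\<^sup>2 * C * t\<^sup>2 / \<epsilon> + 1"
    have \<rho>0: "\<rho>0 \<ge> 1" using M(1) C(1) t(1) \<epsilon> by (simp add: \<rho>0_def)
    have "comm \<rho> P f \<le> ennreal (\<epsilon> * (nm f)\<^sup>2)"
      if r: "\<rho> \<ge> \<rho>0" and f: "f \<in> H" for \<rho> f
    proof -
      have \<rho>: "\<rho> > 0" using r \<rho>0 by simp
      have fm [measurable]: "f \<in> borel_measurable borel"
        using L2D(1)[OF f] measurable_cong_sets[OF sets_sigma refl, of borel] by blast
      define \<beta> where "\<beta> = C * (t / \<rho>)\<^sup>2"
      have \<beta>: "\<beta> \<ge> 0" "M\<^sup>2 * \<beta> \<le> \<epsilon> / 2"
      proof -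
        show "\<beta> \<ge> 0" using C(1) by (simp add: \<beta>_def)
        have "\<rho> \<le> \<rho>\<^sup>2" using r \<rho>0 by (simp add: power2_eq_square)
        then have "2 * M\<^sup>2 * C * t\<^sup>2 / \<epsilon> \<le> \<rho>\<^sup>2" using r by (simp add: \<rho>0_def)
        then have "2 * (M\<^sup>2 * C * t\<^sup>2) \<le> \<epsilon> * \<rho>\<^sup>2" using \<epsilon> by (simp add: field_simps)
        then show "M\<^sup>2 * \<beta> \<le> \<epsilon> / 2" using \<rho> by (simp add: \<beta>_def power_divide field_simps)
      qed
      define \<Phi> where "\<Phi> = (\<lambda>y w v. ennreal (M * Nx w powr s * cmod (Kx w v) * (hh \<rho> y w - hh \<rho> y v)\<^sup>2
           * (cmod (f v))\<^sup>2 / Nx v powr s))"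
      have E_le: "ennreal ((nm (E \<rho> P y f))\<^sup>2) \<le> (\<integral>\<^sup>+w. \<integral>\<^sup>+v. \<Phi> y w v \<partial>\<sigma> \<partial>\<sigma>)" for y
      proof -
        have "ennreal ((cmod (E \<rho> P y f w))\<^sup>2) \<le> (\<integral>\<^sup>+v. \<Phi> y w v \<partial>\<sigma>)" for w
        proof (cases "w \<in> \<Omega>")
          case False
          then have "E \<rho> P y f w = 0"
            using B_outside[OF P_in[OF hm_in[OF \<rho> f]], of w y] by (simp add: E_def hm_def hh_def G_def)
          then show ?thesis by simp
        next
          case w: True
          define x where "x = (\<lambda>v. of_real (hh \<rho> y w) * f v - hm \<rho> y f v)"
          have x: "x \<in> H" unfolding x_def by (intro L2_diff L2_cmult f hm_in \<rho>)
          have "E \<rho> P y f w = of_real (hh \<rho> y w) * ip \<sigma> f (K w) - ip \<sigma> (hm \<rho> y f) (K w)"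
            by (simp add: E_def P_value[OF hm_in[OF \<rho> f] w] hm_def[of \<rho> y "P f"] P_value[OF f w])
          also have "\<dots> = ip \<sigma> x (K w)"
            unfolding x_def ip_diff_left[OF L2_cmult[OF f] hm_in[OF \<rho> f] K_L2[OF w]] ip_cmult_left ..
          finally have eq: "E \<rho> P y f w = ip \<sigma> x (K w)" .
          \<comment> \<open>The kernel is split into two square roots and the weight is moved
            between them: \<open>a\<close> is handled by the first Schur estimate, and the square of
            \<open>b\<close> carries the tent difference and \<open>f\<close>.\<close>
          define a where "a = (\<lambda>v. sqrt (cmod (Kx w v) * Nx v powr s))"
          define b where "b = (\<lambda>v. sqrt (cmod (Kx w v) / Nx v powr s) * (\<bar>hh \<rho> y w - hh \<rho> y v\<bar> * cmod (f v)))"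
          have [measurable]: "a \<in> borel_measurable borel" "b \<in> borel_measurable borel"
            unfolding a_def b_def by measurable
          have "ennreal (cmod (ip \<sigma> x (K w))) \<le> (\<integral>\<^sup>+v. ennreal (cmod (x v * cnj (K w v))) \<partial>\<sigma>)"
            unfolding ip_def by (rule integral_norm_bound_ennreal[OF L2_integrable_mult[OF x K_L2[OF w]]])
          also have "\<dots> = (\<integral>\<^sup>+v. ennreal (a v * b v) \<partial>\<sigma>)"
          proof (rule nn_integral_cong)
            fix v
            show "ennreal (cmod (x v * cnj (K w v))) = ennreal (a v * b v)"
            proof (cases "v \<in> \<Omega>")
              case True
              have "x v = of_real (hh \<rho> y w - hh \<rho> y v) * f v" by (simp add: x_def hm_def algebra_simps)
              then have "cmod (x v) = \<bar>hh \<rho> y w - hh \<rho> y v\<bar> * cmod (f v)" by (simp only: norm_mult norm_of_real)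
              moreover have "a v * sqrt (cmod (Kx w v) / Nx v powr s) = cmod (K w v)"
              proof -
                have "N v powr s > 0" using True by (simp add: less_imp_neq[symmetric])
                then have "(cmod (K w v) * N v powr s) * (cmod (K w v) / N v powr s) = (cmod (K w v))\<^sup>2"
                  by (simp add: power2_eq_square)
                then show ?thesis
                  unfolding a_def real_sqrt_mult[symmetric] using True w by (simp add: Kx_def Nx_def)
              qed
              ultimately show ?thesis
                unfolding b_def by (simp add: norm_mult mult.assoc[symmetric])
            next
              case False
              then show ?thesis using L2D(3)[OF f False] by (simp add: x_def hm_def b_def)
            qed
          qed
          finally have "(ennreal (cmod (ip \<sigma> x (K w))))\<^sup>2 \<le> (\<integral>\<^sup>+v. ennreal (a v * b v) \<partial>\<sigma>)\<^sup>2"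
            by (rule power_mono) simp
          also have "\<dots> \<le> ennreal (M * N w powr s) * (\<integral>\<^sup>+v. ennreal ((b v)\<^sup>2) \<partial>\<sigma>)"
          proof (rule nn_integral_Cauchy_Schwarz_power2)
            show "(\<integral>\<^sup>+v. ennreal ((a v)\<^sup>2) \<partial>\<sigma>) \<le> ennreal (M * N w powr s)"
              using M(2)[OF w] by (simp add: a_def)
            show "0 < M * N w powr s" using M(1) w by (simp add: less_imp_neq[symmetric])
          qed (auto simp: a_def b_def)
          also have "\<dots> = (\<integral>\<^sup>+v. ennreal (M * N w powr s) * ennreal ((b v)\<^sup>2) \<partial>\<sigma>)"
            by (rule nn_integral_cmult[symmetric]) measurable
          also have "\<dots> = (\<integral>\<^sup>+v. \<Phi> y w v \<partial>\<sigma>)"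
          proof (rule nn_integral_cong)
            fix v
            have "(b v)\<^sup>2 = cmod (Kx w v) / Nx v powr s * ((hh \<rho> y w - hh \<rho> y v)\<^sup>2 * (cmod (f v))\<^sup>2)"
              by (simp add: b_def power_mult_distrib)
            then show "ennreal (M * N w powr s) * ennreal ((b v)\<^sup>2) = \<Phi> y w v"
              using M(1) w by (simp add: \<Phi>_def Nx_def ennreal_mult[symmetric] mult_ac)
          qed
          finally show ?thesis by (simp add: eq ennreal_power)
        qed
        then show ?thesis
          unfolding nn_integral_L2[OF E_in[OF \<rho> hop_P f], symmetric] by (intro nn_integral_mono)
      qed
      interpret p1: pair_sigma_finite \<sigma> lm
        by (intro pair_sigma_finite.intro sigma_finite_measure_axioms lm.sigma_finite_measure_axioms)
      interpret p2: pair_sigma_finite \<sigma> \<sigma>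
        by (intro pair_sigma_finite.intro sigma_finite_measure_axioms)
      have \<Phi>_m [measurable (raw)]: "(\<lambda>x. \<Phi> (p x) (q x) (q' x)) \<in> borel_measurable Q"
        if [measurable]: "p \<in> borel_measurable Q" "q \<in> borel_measurable Q" "q' \<in> borel_measurable Q"
        for p q q' and Q :: "'x measure"
        unfolding \<Phi>_def by measurable
      \<comment> \<open>Tonelli brings \<open>y\<close> innermost, where the tent estimates apply,
        and \<open>w\<close> next, where the second use of the Schur weight applies;
        \<open>v\<close> stays outside with \<open>f\<close>.\<close>
      have "comm \<rho> P f \<le> (\<integral>\<^sup>+y. \<integral>\<^sup>+w. \<integral>\<^sup>+v. \<Phi> y w v \<partial>\<sigma> \<partial>\<sigma> \<partial>lm)"
        by (intro nn_integral_mono E_le)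
      also have "\<dots> = (\<integral>\<^sup>+w. \<integral>\<^sup>+y. \<integral>\<^sup>+v. \<Phi> y w v \<partial>\<sigma> \<partial>lm \<partial>\<sigma>)"
        by (rule p1.Fubini') measurable
      also have "\<dots> = (\<integral>\<^sup>+w. \<integral>\<^sup>+v. \<integral>\<^sup>+y. \<Phi> y w v \<partial>lm \<partial>\<sigma> \<partial>\<sigma>)"
        by (intro nn_integral_cong p1.Fubini') measurable
      also have "\<dots> = (\<integral>\<^sup>+v. \<integral>\<^sup>+w. \<integral>\<^sup>+y. \<Phi> y w v \<partial>lm \<partial>\<sigma> \<partial>\<sigma>)"
        by (rule p2.Fubini') measurable
      also have "\<dots> \<le> (\<integral>\<^sup>+v. ennreal \<epsilon> * ennreal ((cmod (f v))\<^sup>2) \<partial>\<sigma>)"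
      proof (rule nn_integral_mono)
        fix v
        show "(\<integral>\<^sup>+w. \<integral>\<^sup>+y. \<Phi> y w v \<partial>lm \<partial>\<sigma>) \<le> ennreal \<epsilon> * ennreal ((cmod (f v))\<^sup>2)"
        proof (cases "v \<in> \<Omega>")
          case False
          then have "\<Phi> y w v = 0" for y w using L2D(3)[OF f False] by (simp add: \<Phi>_def)
          then show ?thesis by simp
        next
          case v: True
          define c where "c = M * (cmod (f v))\<^sup>2 / N v powr s"
          have c: "c \<ge> 0" using M(1) by (simp add: c_def)
          define k where "k = (\<lambda>w. cmod (Kx v w) * Nx w powr s)"
          have k: "k w \<ge> 0" for w by (simp add: k_def)
          have [measurable]: "k \<in> borel_measurable borel" unfolding k_def by measurable
          have [measurable]: "{w. dx v w > t} \<in> sets borel"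
          proof -
            have "(\<lambda>w. dx v w) \<in> borel_measurable borel" by measurable
            from borel_measurable_iff_greater[THEN iffD1, OF this] show ?thesis by simp
          qed
          have "(\<integral>\<^sup>+w. \<integral>\<^sup>+y. \<Phi> y w v \<partial>lm \<partial>\<sigma>)
             \<le> (\<integral>\<^sup>+w. ennreal (2 * c) * (ennreal (k w) * indicator {w. dx v w > t} w) + ennreal (c * \<beta>) * ennreal (k w) \<partial>\<sigma>)"
          proof (rule nn_integral_mono)
            fix w
            show "(\<integral>\<^sup>+y. \<Phi> y w v \<partial>lm) \<le> ennreal (2 * c) * (ennreal (k w) * indicator {w. dx v w > t} w) + ennreal (c * \<beta>) * ennreal (k w)"
            proof (cases "w \<in> \<Omega>")
              case False
              then have "\<Phi> y w v = 0" for y by (simp add: \<Phi>_def Kx_def)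
              then show ?thesis by simp
            next
              case w: True
              have "cmod (Kx w v) = cmod (Kx v w)" using K_sym[OF v w] v w by (simp add: Kx_def)
              then have "\<Phi> y w v = ennreal ((c * k w) * (hh \<rho> y w - hh \<rho> y v)\<^sup>2)" for y
                unfolding \<Phi>_def using v by (intro arg_cong[where f = ennreal]) (simp add: c_def k_def Nx_def mult_ac)
              then have \<Phi>_eq: "\<Phi> y w v = ennreal (c * k w) * ennreal ((hh \<rho> y w - hh \<rho> y v)\<^sup>2)" for y
                using c k[of w] by (simp only: ennreal_mult mult_nonneg_nonneg zero_le_power2)
              have "(\<integral>\<^sup>+y. \<Phi> y w v \<partial>lm) = ennreal (c * k w) * (\<integral>\<^sup>+y. ennreal ((hh \<rho> y w - hh \<rho> y v)\<^sup>2) \<partial>lm)"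
                unfolding \<Phi>_eq by (rule nn_integral_cmult) measurable
              also have "\<dots> \<le> ennreal (c * k w) * (ennreal 2 * indicator {w. dx v w > t} w + ennreal \<beta>)"
              proof (rule mult_left_mono)
                show "(\<integral>\<^sup>+y. ennreal ((hh \<rho> y w - hh \<rho> y v)\<^sup>2) \<partial>lm) \<le> ennreal 2 * indicator {w. dx v w > t} w + ennreal \<beta>"
                proof (cases "dx v w > t")
                  case True
                  have "(\<integral>\<^sup>+y. ennreal ((hh \<rho> y w - hh \<rho> y v)\<^sup>2) \<partial>lm) \<le> ennreal 2 * indicator {w. dx v w > t} w + 0"
                    using hh_diff_integral_le_2[OF \<rho> w v] True by simp
                  also have "\<dots> \<le> ennreal 2 * indicator {w. dx v w > t} w + ennreal \<beta>" by (intro add_left_mono) simp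
                  finally show ?thesis .
                next
                  case False
                  then have "d w v \<le> t" using v w Met.commute[of w v] by (simp add: dx_def)
                  then have "C * (d w v / \<rho>)\<^sup>2 \<le> \<beta>"
                    unfolding \<beta>_def using C(1) \<rho> by (intro mult_left_mono power_mono divide_right_mono) auto
                  then have "(\<integral>\<^sup>+y. ennreal ((hh \<rho> y w - hh \<rho> y v)\<^sup>2) \<partial>lm) \<le> ennreal \<beta>"
                    using C(2)[OF \<rho> w v] ennreal_leI order_trans by blast
                  then show ?thesis using False by simp
                qed
              qed simp
              also have "\<dots> = ennreal (2 * c) * (ennreal (k w) * indicator {w. dx v w > t} w) + ennreal (c * \<beta>) * ennreal (k w)"
                using c k[of w] \<beta>(1) by (simp add: ennreal_mult distrib_left mult_ac)
              finally show ?thesis .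
            qed
          qed
          also have "\<dots> = ennreal (2 * c) * (\<integral>\<^sup>+w. ennreal (k w) * indicator {w. dx v w > t} w \<partial>\<sigma>)
              + ennreal (c * \<beta>) * (\<integral>\<^sup>+w. ennreal (k w) \<partial>\<sigma>)"
            by (simp add: nn_integral_add nn_integral_cmult)
          also have "\<dots> \<le> ennreal (2 * c) * ennreal (\<epsilon>' * N v powr s) + ennreal (c * \<beta>) * ennreal (M * N v powr s)"
            using t(2)[OF v] M(2)[OF v] by (intro add_mono mult_left_mono) (auto simp: k_def)
          also have "\<dots> = ennreal (2 * c * (\<epsilon>' * N v powr s) + c * \<beta> * (M * N v powr s))"
            using c \<beta>(1) \<epsilon>' M(1) by (simp add: ennreal_mult[symmetric] ennreal_plus[symmetric] del: ennreal_plus)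
          also have "\<dots> \<le> ennreal (\<epsilon> * (cmod (f v))\<^sup>2)"
          proof (rule ennreal_leI)
            have cN: "c * N v powr s = M * (cmod (f v))\<^sup>2" using v by (simp add: c_def less_imp_neq[symmetric])
            have "2 * c * (\<epsilon>' * N v powr s) + c * \<beta> * (M * N v powr s) = (c * N v powr s) * (2 * \<epsilon>' + M * \<beta>)"
              by (simp add: algebra_simps)
            also have "\<dots> = (2 * (M * \<epsilon>') + M\<^sup>2 * \<beta>) * (cmod (f v))\<^sup>2"
              unfolding cN by (simp add: algebra_simps power2_eq_square)
            also have "\<dots> \<le> \<epsilon> * (cmod (f v))\<^sup>2"
            proof (rule mult_right_mono)
              have "M * \<epsilon>' = \<epsilon> / 4" using M(1) by (simp add: \<epsilon>'_def)
              then show "2 * (M * \<epsilon>') + M\<^sup>2 * \<beta> \<le> \<epsilon>" using \<beta>(2) by simp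
            qed simp
            finally show "2 * c * (\<epsilon>' * N v powr s) + c * \<beta> * (M * N v powr s) \<le> \<epsilon> * (cmod (f v))\<^sup>2" .
          qed
          also have "\<dots> = ennreal \<epsilon> * ennreal ((cmod (f v))\<^sup>2)" using \<epsilon> by (simp add: ennreal_mult)
          finally show ?thesis .
        qed
      qed
      also have "\<dots> = ennreal \<epsilon> * ennreal ((nm f)\<^sup>2)"
        by (simp add: nn_integral_cmult nn_integral_L2[OF f])
      also have "\<dots> = ennreal (\<epsilon> * (nm f)\<^sup>2)" using \<epsilon> by (simp add: ennreal_mult)
      finally show ?thesis .
    qed
    then show "\<exists>\<rho>0>0. \<forall>\<rho>\<ge>\<rho>0. \<forall>f\<in>H. comm \<rho> P f \<le> ennreal (\<epsilon> * (nm f)\<^sup>2)"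
      using \<rho>0 by (intro exI[of _ \<rho>0]) auto
  qed
qed

text \<open>A Toeplitz operator after \<open>P\<close> is \<open>P\<close>, multiplication by the
  symbol, and \<open>P\<close> again. Multiplications commute with the tents exactly, so all reduces
  to \<open>Loc_P\<close>. For products, a \<open>P\<close> can be inserted between the factors
  since their values lie in \<open>B\<close>.\<close>

lemma toep_alg_Loc:
  assumes "\<kappa> > 0"
  shows "S \<in> toep_alg \<Omega> \<sigma> d \<Longrightarrow> Loc (\<lambda>f. S (P f))"
proof (induction rule: toep_alg.induct)
  case (base u)
  obtain M where M: "M \<ge> 0" "\<And>f. f \<in> H \<Longrightarrow> (\<lambda>w. u w * f w) \<in> H" "\<And>f. f \<in> H \<Longrightarrow> nm (\<lambda>w. u w * f w) \<le> M * nm f"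
    using BUC_mult[OF base] by metis
  have hu: "hop (\<lambda>f w. u w * f w) M"
    unfolding hop_def using M by (auto simp: algebra_simps)
  have "Loc (\<lambda>f. P ((\<lambda>f w. u w * f w) (P f)))"
    by (rule Loc_comp[OF hop_P Loc_P[OF assms] hop_comp[OF hu hop_P] Loc_comp[OF hu Loc_mult hop_P Loc_P[OF assms]]])
  then show ?case by (simp add: toeplitz_def)
next
  case (add S T)
  obtain C C' where "bop S C" "bop T C'" using toep_alg_bop add by blast
  then show ?case using Loc_add[OF hop_bop_P _ hop_bop_P] add by blast
next
  case (mult S T)
  obtain C C' where b: "bop S C" "bop T C'" using toep_alg_bop mult by blast
  have "Loc (\<lambda>f. S (P (T (P f))))"
    by (rule Loc_comp[OF hop_bop_P[OF b(1)] _ hop_bop_P[OF b(2)]]) (use mult in auto)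
  then show ?case
    by (rule Loc_cong) (simp add: P_id bopD(2)[OF b(2)] P_in)
qed

lemma T_BUC_Loc:
  assumes "\<kappa> > 0" and T: "T \<in> T_BUC \<Omega> \<sigma> d"
  shows "Loc (\<lambda>f. T (P f))"
proof -
  obtain C where C: "bop T C" using T_BUC_bop[OF T] by blast
  show ?thesis
  proof (rule Loc_limit[OF hop_bop_P[OF C]])
    fix e :: real assume e: "e > 0"
    obtain S C' where S: "S \<in> toep_alg \<Omega> \<sigma> d" "bop S C'" "\<And>f. f \<in> B \<Longrightarrow> nm (\<lambda>w. T f w - S f w) \<le> e * nm f"
      using T_BUC_approx[OF T e] by metis
    have "nm (\<lambda>w. T (P f) w - S (P f) w) \<le> e * nm f" if f: "f \<in> H" for f
      using S(3)[OF P_in[OF f]] mult_left_mono[OF P_nrm[OF f], of e] e by linarith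
    then show "\<exists>S C'. hop S C' \<and> Loc S \<and> (\<forall>f\<in>H. nm (\<lambda>w. T (P f) w - S f w) \<le> e * nm f)"
      using hop_bop_P[OF S(2)] toep_alg_Loc[OF assms(1) S(1)] by blast
  qed
qed

section \<open>From localisation to compactness\<close>

text \<open>\<open>U y\<close> moves the tent at \<open>y\<close> to the ball of radius \<rho>
  around 0, where truncation changes nothing; there \<open>T\<close> becomes its translate
  \<open>V T y\<close>.\<close>

lemma T_P_hm_le:
  assumes T: "bop T C" and \<rho>: "\<rho> > 0" and y: "y \<in> \<Omega>" and g: "g \<in> H"
    and small: "\<And>f. f \<in> H \<Longrightarrow> nm (V T y (P (cut \<rho> f))) \<le> \<delta> * nm f"
  shows "nm (T (P (hm \<rho> y g))) \<le> \<delta> * nm (hm \<rho> y g)"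
proof -
  let ?x = "hm \<rho> y g"
  have x: "?x \<in> H" by (rule hm_in[OF \<rho> g])
  have Ux: "U y ?x \<in> H" by (rule U_isometry(1)[OF y x])
  have "cut \<rho> (U y ?x) = U y ?x"
  proof
    fix w
    have "w \<in> D \<rho>" if "w \<in> \<Omega>" "hh \<rho> y (\<phi> y w) \<noteq> 0"
    proof -
      have "d y (\<phi> y w) < \<rho>" using hh_support[OF \<rho> that(2)] by blast
      moreover have "d (\<phi> y 0) (\<phi> y w) = d 0 w" using d_phi[OF y zero_in that(1)] .
      ultimately show ?thesis unfolding D_iff using that y by (simp add: Met.commute[of w 0])
    qed
    then show "cut \<rho> (U y ?x) w = U y ?x w"
      by (cases "w \<in> D \<rho>") (auto simp: cut_def Uop_def hm_def)
  qed
  then have "nm (V T y (P (U y ?x))) \<le> \<delta> * nm (U y ?x)" using small[OF Ux] by simp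
  moreover have "V T y (P (U y ?x)) = U y (T (P ?x))"
    by (simp add: V_def U_P[OF y Ux] U_U[OF y x])
  ultimately show ?thesis
    using U_isometry(2)[OF y x] U_isometry(2)[OF y Bsp_L2[OF bopD(2)[OF T P_in[OF x]]]] by simp
qed

lemma T_local_bound:
  assumes "\<kappa> > 0" and T: "T \<in> T_BUC \<Omega> \<sigma> d" and van: "vanishes_at_inf \<Omega> d (\<lambda>z. cmod (berezin \<sigma> K T z))"
    and \<epsilon>: "\<epsilon> > 0"
  shows "\<exists>r C. C \<ge> 0 \<and> (\<forall>g\<in>B. (nm (T g))\<^sup>2 \<le> \<epsilon> * (nm g)\<^sup>2 + C * (nm (cut r g))\<^sup>2)"
proof -
  obtain C where C: "bop T C" using T_BUC_bop[OF T] by blast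
  note A = hop_bop_P[OF C]
  have e6: "\<epsilon>/6 > 0" using \<epsilon> by simp
  obtain \<rho> where \<rho>: "\<rho> > 0" "\<And>f. f \<in> H \<Longrightarrow> comm \<rho> (\<lambda>f. T (P f)) f \<le> ennreal (\<epsilon>/6 * (nm f)\<^sup>2)"
    using LocD[OF T_BUC_Loc[OF assms(1) T] e6] by (metis order_refl)
  \<comment> \<open>Then \<open>3 * \<delta>\<^sup>2\<close> is half of \<epsilon>; the commutator
    term takes the other half.\<close>
  define \<delta> where "\<delta> = sqrt (\<epsilon>/6)"
  have \<delta>: "\<delta> > 0" "\<delta>\<^sup>2 = \<epsilon>/6" using \<epsilon> by (auto simp: \<delta>_def)
  obtain R where R: "\<And>z f. z \<in> \<Omega> \<Longrightarrow> d z 0 > R \<Longrightarrow> f \<in> H \<Longrightarrow> nm (V T z (P (cut \<rho> f))) \<le> \<delta> * nm f"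
    using V_P_cut_tendsto_zero[OF C V_tendsto_zero[OF T van] \<delta>(1)] by blast
  \<comment> \<open>Tents centred within distance \<open>R\<close> of 0 are supported in the ball of
    radius \<open>R + \<rho>\<close>, so the pieces outside the smallness estimate see only
    \<open>cut r g\<close>.\<close>
  define r where "r = R + \<rho>"
  have "(nm (T g))\<^sup>2 \<le> \<epsilon> * (nm g)\<^sup>2 + 3 * C\<^sup>2 * (nm (cut r g))\<^sup>2" if g: "g \<in> B" for g
  proof -
    note gH = Bsp_L2[OF g]
    note cH = cut_in[OF gH, of r]
    note [measurable] = E_measurable[OF \<rho>(1) A gH] hm_integral(1)[OF \<rho>(1) gH] hm_integral(1)[OF \<rho>(1) cH]
    have TgH: "T g \<in> H" by (rule Bsp_L2[OF bopD(2)[OF C g]])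
    have le: "nm (hm \<rho> y (T g)) \<le> nm (E \<rho> (\<lambda>f. T (P f)) y g) + \<delta> * nm (hm \<rho> y g) + C * nm (hm \<rho> y (cut r g))" for y
    proof -
      note hg = hm_in[OF \<rho>(1) gH, of y]
      have "hm \<rho> y (T g) = (\<lambda>w. E \<rho> (\<lambda>f. T (P f)) y g w + T (P (hm \<rho> y g)) w)"
        by (simp add: E_def P_id[OF g])
      then have 1: "nm (hm \<rho> y (T g)) \<le> nm (E \<rho> (\<lambda>f. T (P f)) y g) + nm (T (P (hm \<rho> y g)))"
        using nrm_triangle[OF E_in[OF \<rho>(1) A gH] hopD(2)[OF A hg], of y] by simp
      consider "y \<notin> \<Omega>" | "y \<in> \<Omega>" "d y 0 > R" | "y \<in> \<Omega>" "d y 0 \<le> R" by linarith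
      then have "nm (T (P (hm \<rho> y g))) \<le> \<delta> * nm (hm \<rho> y g) + C * nm (hm \<rho> y (cut r g))"
      proof cases
        case 1
        then show ?thesis using hop_zero[OF A] by (simp add: hm_outside)
      next
        case 2
        have "nm (T (P (hm \<rho> y g))) \<le> \<delta> * nm (hm \<rho> y g)"
          by (rule T_P_hm_le[OF C \<rho>(1) 2(1) gH R[OF 2]])
        moreover have "0 \<le> C * nm (hm \<rho> y (cut r g))" using bopD(1)[OF C] by simp
        ultimately show ?thesis by linarith
      next
        case 3
        have "hm \<rho> y (cut r g) = hm \<rho> y g"
        proof
          fix w
          have "w \<in> D r" if "hh \<rho> y w \<noteq> 0"
          proof -
            have w: "w \<in> \<Omega>" "d y w < \<rho>" using hh_support[OF \<rho>(1) that] by auto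
            have "d w 0 \<le> d w y + d y 0" by (rule Met.triangle) (use w 3 in auto)
            then show ?thesis unfolding D_iff using w 3 by (simp add: r_def Met.commute[of w y])
          qed
          then show "hm \<rho> y (cut r g) w = hm \<rho> y g w" by (cases "w \<in> D r") (auto simp: hm_def cut_def)
        qed
        moreover have "nm (T (P (hm \<rho> y g))) \<le> C * nm (hm \<rho> y g)" by (rule hopD(3)[OF A hg])
        moreover have "0 \<le> \<delta> * nm (hm \<rho> y g)" using \<delta>(1) by simp
        ultimately show ?thesis by simp
      qed
      with 1 show ?thesis by linarith
    qed
    have "ennreal ((nm (T g))\<^sup>2) = (\<integral>\<^sup>+y. ennreal ((nm (hm \<rho> y (T g)))\<^sup>2) \<partial>lm)"
      by (rule hm_integral(2)[OF \<rho>(1) TgH, symmetric])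
    also have "\<dots> \<le> ennreal (3 * (\<epsilon>/6 * (nm g)\<^sup>2) + 3 * \<delta>\<^sup>2 * (nm g)\<^sup>2 + 3 * C\<^sup>2 * (nm (cut r g))\<^sup>2)"
    proof (rule nn_integral_le_combination[where ?G1.0 = "\<lambda>y. (nm (E \<rho> (\<lambda>f. T (P f)) y g))\<^sup>2"
          and ?G2.0 = "\<lambda>y. (nm (hm \<rho> y g))\<^sup>2" and ?G3.0 = "\<lambda>y. (nm (hm \<rho> y (cut r g)))\<^sup>2"])
      show "(nm (hm \<rho> y (T g)))\<^sup>2 \<le> 3 * (nm (E \<rho> (\<lambda>f. T (P f)) y g))\<^sup>2 + 3 * \<delta>\<^sup>2 * (nm (hm \<rho> y g))\<^sup>2
          + 3 * C\<^sup>2 * (nm (hm \<rho> y (cut r g)))\<^sup>2" for y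
        using square_sum3_le[OF nrm_nonneg le[of y]] by (simp add: power_mult_distrib)
      show "comm \<rho> (\<lambda>f. T (P f)) g \<le> ennreal (\<epsilon>/6 * (nm g)\<^sup>2)"
        by (rule \<rho>(2)[OF gH])
      show "(\<integral>\<^sup>+y. ennreal ((nm (hm \<rho> y g))\<^sup>2) \<partial>lm) \<le> ennreal ((nm g)\<^sup>2)"
        unfolding hm_integral(2)[OF \<rho>(1) gH] by simp
      show "(\<integral>\<^sup>+y. ennreal ((nm (hm \<rho> y (cut r g)))\<^sup>2) \<partial>lm) \<le> ennreal ((nm (cut r g))\<^sup>2)"
        unfolding hm_integral(2)[OF \<rho>(1) cH] by simp
    qed (use \<epsilon> in auto)
    also have "3 * (\<epsilon>/6 * (nm g)\<^sup>2) + 3 * \<delta>\<^sup>2 * (nm g)\<^sup>2 + 3 * C\<^sup>2 * (nm (cut r g))\<^sup>2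
        = \<epsilon> * (nm g)\<^sup>2 + 3 * C\<^sup>2 * (nm (cut r g))\<^sup>2"
      by (simp add: \<delta>(2))
    finally show ?thesis using \<epsilon> by (subst (asm) ennreal_le_iff) auto
  qed
  then show ?thesis by (intro exI[of _ r] exI[of _ "3 * C\<^sup>2"]) auto
qed

lemma compact_if_berezin_vanishes:
  assumes "\<kappa> > 0" and T: "T \<in> T_BUC \<Omega> \<sigma> d" and van: "vanishes_at_inf \<Omega> d (\<lambda>z. cmod (berezin \<sigma> K T z))"
  shows "compact_op \<Omega> \<sigma> T"
  unfolding compact_op_def
proof (intro allI impI)
  fix f :: "nat \<Rightarrow> 'n fn" assume "(\<forall>n. f n \<in> B) \<and> (\<exists>b. \<forall>n. nm (f n) \<le> b)"
  then obtain b where f: "\<And>n. f n \<in> B" "\<And>n. nm (f n) \<le> b" by blast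
  have b0: "0 \<le> b" using f(2)[of 0] nrm_nonneg order_trans by blast
  obtain C where C: "bop T C" using T_BUC_bop[OF T] by blast
  obtain k :: "nat \<Rightarrow> nat" and q where k: "strict_mono k" and q: "q \<in> B" "nm q \<le> b" "\<And>w. (\<lambda>n. f (k n) w) \<longlonglongrightarrow> q w"
    by (rule B_Montel[OF f]) (rule that)
  define s where "s = (\<lambda>n w. f (k n) w - q w)"
  have s: "s n \<in> B" "nm (s n) \<le> 2 * b" for n
    using Bsp_diff[OF f(1) q(1)] nrm_triangle_diff[OF Bsp_L2[OF f(1)] Bsp_L2[OF q(1)], of "k n"] f(2)[of "k n"] q(2)
    by (auto simp: s_def)
  have s0: "(\<lambda>n. s n w) \<longlonglongrightarrow> 0" for w
    unfolding s_def using tendsto_diff[OF q(3) tendsto_const, of w "q w"] by simp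
  \<comment> \<open>The sequence \<open>s\<close> is bounded and tends to zero pointwise, so its
    truncations vanish in norm and \<open>T_local_bound\<close> leaves only a small multiple of its
    squared norm bound.\<close>
  have "(\<lambda>n. nm (T (s n))) \<longlonglongrightarrow> 0"
  proof (rule LIMSEQ_I)
    fix e :: real assume e: "e > 0"
    define \<epsilon> where "\<epsilon> = e\<^sup>2 / 2 / ((2 * b)\<^sup>2 + 1)"
    have \<epsilon>: "\<epsilon> > 0" using e by (simp add: \<epsilon>_def add_nonneg_pos)
    obtain r C' where C': "C' \<ge> 0" "\<And>g. g \<in> B \<Longrightarrow> (nm (T g))\<^sup>2 \<le> \<epsilon> * (nm g)\<^sup>2 + C' * (nm (cut r g))\<^sup>2"
      using T_local_bound[OF assms(1) T van \<epsilon>] by blast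
    have "(\<lambda>n. C' * (nm (cut r (s n)))\<^sup>2) \<longlonglongrightarrow> C' * 0\<^sup>2"
      by (intro tendsto_intros cut_tendsto_zero[OF s s0])
    then have lim: "(\<lambda>n. C' * (nm (cut r (s n)))\<^sup>2) \<longlonglongrightarrow> 0" by simp
    have "e\<^sup>2 / 2 > 0" using e by simp
    from LIMSEQ_D[OF lim this] obtain n0 where n0: "\<forall>n\<ge>n0. norm (C' * (nm (cut r (s n)))\<^sup>2 - 0) < e\<^sup>2 / 2" by blast
    have "nm (T (s n)) < e" if n: "n \<ge> n0" for n
    proof (rule power2_less_imp_less)
      have "\<epsilon> * (nm (s n))\<^sup>2 \<le> \<epsilon> * ((2 * b)\<^sup>2 + 1)"
        using \<epsilon> power_mono[OF s(2)[of n], of 2] by (intro mult_left_mono) auto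
      moreover have "\<epsilon> * ((2 * b)\<^sup>2 + 1) = e\<^sup>2 / 2"
      proof -
        have "(2 * b)\<^sup>2 + 1 \<noteq> 0" using zero_le_power2[of "2 * b"] by linarith
        moreover have "x / a * a = x" if "a \<noteq> 0" for x a :: real using that by simp
        ultimately show ?thesis unfolding \<epsilon>_def by blast
      qed
      moreover have "C' * (nm (cut r (s n)))\<^sup>2 < e\<^sup>2 / 2"
        using n0 n abs_ge_self[of "C' * (nm (cut r (s n)))\<^sup>2"] by (fastforce intro: order_le_less_trans)
      ultimately show "(nm (T (s n)))\<^sup>2 < e\<^sup>2" using C'(2)[OF s(1), of n] by linarith
    qed (use e in simp)
    then show "\<exists>n0. \<forall>n\<ge>n0. norm (nm (T (s n)) - 0) < e" by auto
  qed
  moreover have "T (s n) = (\<lambda>w. T (f (k n)) w - T q w)" for n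
    unfolding s_def by (rule bop_diff[OF C f(1) q(1)])
  ultimately show "\<exists>r g. strict_mono r \<and> g \<in> B \<and> (\<lambda>n. nm (\<lambda>w. T (f (r n)) w - g w)) \<longlonglongrightarrow> 0"
    using k bopD(2)[OF C q(1)] by (intro exI[of _ k] exI[of _ "T q"]) simp
qed

end

theorem theorem4p6:
  fixes \<Omega> :: "(complex ^ ('n::finite)) set"
    and \<phi> :: "complex ^ ('n::finite) \<Rightarrow> complex ^ 'n \<Rightarrow> complex ^ 'n"
    and d :: "complex ^ ('n::finite) \<Rightarrow> complex ^ 'n \<Rightarrow> real"
    and \<sigma> :: "(complex ^ ('n::finite)) measure"
    and K :: "complex ^ ('n::finite) \<Rightarrow> complex ^ 'n \<Rightarrow> complex"
    and \<kappa> :: real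
    and T :: "(complex ^ ('n::finite) \<Rightarrow> complex) \<Rightarrow> (complex ^ 'n \<Rightarrow> complex)"
  assumes "strong_bergman_type \<Omega> \<phi> d \<sigma> K \<kappa>"
    and "T \<in> T_BUC \<Omega> \<sigma> d"
  shows "(vanishes_at_inf \<Omega> d (\<lambda>z. cmod (berezin \<sigma> K T z)) \<longleftrightarrow>
           (\<forall>f\<in>Bsp \<Omega> \<sigma>. vanishes_at_inf \<Omega> d (\<lambda>z. nrm \<sigma> (transl \<Omega> \<phi> \<sigma> K T z f))))
       \<and> (\<kappa> > 0 \<and> vanishes_at_inf \<Omega> d (\<lambda>z. cmod (berezin \<sigma> K T z)) \<longrightarrow> compact_op \<Omega> \<sigma> T)"
proof (cases "nrm \<sigma> (K 0) = 0")
  case False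
  interpret bergman \<Omega> \<phi> d \<sigma> K \<kappa>
    by unfold_locales (use assms(1) False in auto)
  show ?thesis
    using vanishes_berezin_iff[OF assms(2)] compact_if_berezin_vanishes[OF _ assms(2)] by blast
next
  case True
  \<comment> \<open>degenerate case: condition (A.5) at \<open>w = z\<close> forces every kernel function, hence the whole space, to vanish\<close>
  have dom: "0 \<in> \<Omega>" "open \<Omega>" using assms(1) by (auto simp: strong_bergman_type_def is_domain_def)
  have KB: "K z \<in> Bsp \<Omega> \<sigma>" if "z \<in> \<Omega>" for z using assms(1) that by (simp add: strong_bergman_type_def)
  have rep: "f z = ip \<sigma> f (K z)" if "f \<in> Bsp \<Omega> \<sigma>" "z \<in> \<Omega>" for f z using assms(1) that by (simp add: strong_bergman_type_def)
  have N0: "nrm \<sigma> (K z) = 0" if z: "z \<in> \<Omega>" for z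
  proof (rule ccontr)
    assume nz: "nrm \<sigma> (K z) \<noteq> 0"
    have "inv_biholo_aut \<Omega> (\<phi> z)" "\<phi> z 0 = z" using assms(1) z by (auto simp: strong_bergman_type_def)
    then have "\<phi> z z = 0" using dom(1) unfolding inv_biholo_aut_def by metis
    then have "cmod (ip \<sigma> (nkern \<sigma> K z) (nkern \<sigma> K z)) = 0"
      using assms(1) z True by (simp add: strong_bergman_type_def)
    then have "nrm \<sigma> (nkern \<sigma> K z) = 0" by (simp add: ip_self del: of_real_power)
    moreover have "nkern \<sigma> K z = (\<lambda>w. inverse (of_real (nrm \<sigma> (K z))) * K z w)"
      by (simp add: nkern_def divide_inverse mult.commute)
    ultimately show False using nz by (simp add: nrm_cmult norm_inverse)
  qed
  have B0: "f = (\<lambda>w. 0)" if f: "f \<in> Bsp \<Omega> \<sigma>" for f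
  proof
    fix w show "f w = 0"
    proof (cases "w \<in> \<Omega>")
      case True
      have "cmod (f w) \<le> nrm \<sigma> f * nrm \<sigma> (K w)"
        using rep[OF f True] ip_Cauchy_Schwarz[OF Bsp_L2[OF f] Bsp_L2[OF KB[OF True]]] by simp
      then show ?thesis using N0[OF True] by simp
    qed (use L2D(3)[OF Bsp_L2[OF f]] in auto)
  qed
  have T0: "T f = (\<lambda>w. 0)" if "f \<in> Bsp \<Omega> \<sigma>" for f
    using assms(2) that B0 unfolding T_BUC_def by blast
  have zero: "(\<lambda>w. 0) \<in> Bsp \<Omega> \<sigma>" using holo_on_const[OF dom(2)] by (simp add: Bsp_def)
  have nk: "nkern \<sigma> K z = (\<lambda>w. 0)" if "z \<in> \<Omega>" for z using B0[OF KB[OF that]] by (simp add: nkern_def)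
  have "berezin \<sigma> K T z = 0" if "z \<in> \<Omega>" for z
    using nk[OF that] T0[OF zero] by (simp add: berezin_def)
  then have 1: "vanishes_at_inf \<Omega> d (\<lambda>z. cmod (berezin \<sigma> K T z))" by (auto simp: vanishes_at_inf_def)
  \<comment> \<open>The outer \<open>Uop\<close> carries the factor \<open>nkern\<close>, which is
    zero here, so the result is zero whatever value the description \<open>adj\<close> has.\<close>
  have "transl \<Omega> \<phi> \<sigma> K T z f = (\<lambda>w. 0)" if "z \<in> \<Omega>" for z f
    using nk[OF that] by (auto simp: transl_def Uop_def)
  then have 2: "vanishes_at_inf \<Omega> d (\<lambda>z. nrm \<sigma> (transl \<Omega> \<phi> \<sigma> K T z f))" for f by (auto simp: vanishes_at_inf_def)
  have 3: "compact_op \<Omega> \<sigma> T"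
    unfolding compact_op_def
  proof (intro allI impI)
    fix f :: "nat \<Rightarrow> 'n fn" assume "(\<forall>n. f n \<in> Bsp \<Omega> \<sigma>) \<and> (\<exists>b. \<forall>n. nrm \<sigma> (f n) \<le> b)"
    then show "\<exists>r g. strict_mono r \<and> g \<in> Bsp \<Omega> \<sigma> \<and> (\<lambda>n. nrm \<sigma> (\<lambda>w. T (f (r n)) w - g w)) \<longlonglongrightarrow> 0"
      using T0 zero by (intro exI[of _ id] exI[of _ "\<lambda>w. 0"]) (auto simp: strict_mono_def)
  qed
  show ?thesis using 1 2 3 by blast
qed

end
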